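(* Let $n,d,r$ be integers such that $\Omega(\log^2 n)\leq d\leq n^{0.01}$ and $r\leq \frac{\log n}{12}$. Any depth four $\Sigma\Pi\Sigma\Pi$ circuit of formal degree $d$ and bounded individual degree $r$ that computes a function equivalent to $\mathsf{IMM}_{n,d}$ on $\{0,1\}^{n^2d}$ must have size at least $n^{\Omega(\sqrt{d/r})}$.
   Context: $\mathsf{IMM}_{n,d}$: let $X^{(1)},\dots,X^{(d)}$ be $n\times n$ matrices of distinct variables (disjoint across matrices), $x^{(k)}_{i,j}$ the $(i,j)$ entry of $X^{(k)}$; $\mathsf{IMM}_{n,d}(X)=\sum_{i_1,\dots,i_{d-1}\in[n]} x^{(1)}_{1,i_1}x^{(2)}_{i_1,i_2}\cdots x^{(d-1)}_{i_{d-2},i_{d-1}}x^{(d)}_{i_{d-1},1}$. A depth four $\Sigma\Pi\Sigma\Pi$ circuit computes a polynomial of the form $\sum_i\prod_j Q_{i,j}$ with each $Q_{i,j}$ a sum of monomials; size is the number of nodes. Formal degree is defined inductively: a leaf has formal degree $1$ if labeled by a variable and $0$ if a constant; a sum gate has the maximum of its children's formal degrees; a product gate has the sum of its children's formal degrees; the circuit's formal degree is that of its output. Bounded individual degree $r$ means the output polynomial has degree at most $r$ in each variable. Computing a function equivalent to $P$ on $\{0,1\}^N$ means the output polynomial agrees with $P$ at every point of $\{0,1\}^N$. *)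

theory Defs
  imports Complex_Main "HOL-Library.Poly_Mapping" "HOL-Library.FuncSet"
begin

section \<open>Multivariate polynomials\<close>

text \<open>The convolution product that Poly_Mapping puts on finitely supported functions on
  exponent vectors makes this type the polynomial ring over 'a in the variables 'v.\<close>

type_synonym ('v, 'a) mpoly = "('v \<Rightarrow>\<^sub>0 nat) \<Rightarrow>\<^sub>0 'a"

definition mvar :: "'v \<Rightarrow> ('v, 'a::comm_ring_1) mpoly" where
  "mvar v = Poly_Mapping.single (Poly_Mapping.single v 1) 1"

definition mconst :: "'a::comm_ring_1 \<Rightarrow> ('v, 'a) mpoly" where
  "mconst c = Poly_Mapping.single 0 c"

definition mpoly_eval :: "('v \<Rightarrow> 'a) \<Rightarrow> ('v, 'a::comm_ring_1) mpoly \<Rightarrow> 'a" where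
  "mpoly_eval a p = (\<Sum>m\<in>Poly_Mapping.keys p. Poly_Mapping.lookup p m *
     (\<Prod>v\<in>Poly_Mapping.keys m. a v ^ Poly_Mapping.lookup m v))"

definition individual_degree_le :: "('v, 'a::comm_ring_1) mpoly \<Rightarrow> nat \<Rightarrow> bool" where
  "individual_degree_le p r \<longleftrightarrow> (\<forall>m\<in>Poly_Mapping.keys p. \<forall>v. Poly_Mapping.lookup m v \<le> r)"

definition agree_on_cube ::
  "'v set \<Rightarrow> ('v, 'a::comm_ring_1) mpoly \<Rightarrow> ('v, 'a) mpoly \<Rightarrow> bool" where
  "agree_on_cube V p q \<longleftrightarrow> (\<forall>a \<in> V \<rightarrow>\<^sub>E {0, 1}. mpoly_eval a p = mpoly_eval a q)"

section \<open>Iterated matrix multiplication\<close>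

text \<open>The triple (k, i, j) stands for the entry (i, j) of the k-th matrix.\<close>

type_synonym imm_var = "nat \<times> nat \<times> nat"

definition imm_vars :: "nat \<Rightarrow> nat \<Rightarrow> imm_var set" where
  "imm_vars n d = {1..d} \<times> {1..n} \<times> {1..n}"

text \<open>The summation index p is the tuple of intermediate indices p 1, ..., p (d - 1);
  the update adds the two fixed end points p 0 = p d = 1.\<close>

definition IMM :: "nat \<Rightarrow> nat \<Rightarrow> (imm_var, 'a::comm_ring_1) mpoly" where
  "IMM n d = (\<Sum>p \<in> {1..d - 1} \<rightarrow>\<^sub>E {1..n}.
     \<Prod>k = 1..d. mvar (k, (p(0 := 1, d := 1)) (k - 1), (p(0 := 1, d := 1)) k))"

section \<open>Arithmetic circuits\<close>

text \<open>A circuit is a directed acyclic graph whose nodes are listed in a topological order, the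
  output last. A gate names its children by their positions in the list, so nodes can be shared;
  a repeated position is a multiple edge.\<close>

datatype ('v, 'a) gate = Var 'v | Const 'a | Sum "nat list" | Prod "nat list"

type_synonym ('v, 'a) circuit = "('v, 'a) gate list"

fun children :: "('v, 'a) gate \<Rightarrow> nat list" where
  "children (Var v) = []"
| "children (Const c) = []"
| "children (Sum js) = js"
| "children (Prod js) = js"

definition circuit_over :: "'v set \<Rightarrow> ('v, 'a) circuit \<Rightarrow> bool" where
  "circuit_over V C \<longleftrightarrow> C \<noteq> [] \<and>
     (\<forall>i < length C. \<forall>j \<in> set (children (C ! i)). j < i) \<and>
     (\<forall>v. Var v \<in> set C \<longrightarrow> v \<in> V)"

definition output_node :: "('v, 'a) circuit \<Rightarrow> nat" where
  "output_node C = length C - 1"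

definition circuit_size :: "('v, 'a) circuit \<Rightarrow> nat" where
  "circuit_size C = length C"

text \<open>The filters below only serve termination: in a well-formed circuit they remove nothing.\<close>

fun gate_poly :: "('v, 'a::comm_ring_1) circuit \<Rightarrow> nat \<Rightarrow> ('v, 'a) mpoly" where
  "gate_poly C i = (case C ! i of
      Var v \<Rightarrow> mvar v
    | Const c \<Rightarrow> mconst c
    | Sum js \<Rightarrow> sum_list (map (gate_poly C) (filter (\<lambda>j. j < i) js))
    | Prod js \<Rightarrow> prod_list (map (gate_poly C) (filter (\<lambda>j. j < i) js)))"

fun gate_formal_degree :: "('v, 'a) circuit \<Rightarrow> nat \<Rightarrow> nat" where
  "gate_formal_degree C i = (case C ! i of
      Var v \<Rightarrow> 1
    | Const c \<Rightarrow> 0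
    | Sum js \<Rightarrow> Max (set (0 # map (gate_formal_degree C) (filter (\<lambda>j. j < i) js)))
    | Prod js \<Rightarrow> sum_list (map (gate_formal_degree C) (filter (\<lambda>j. j < i) js)))"

declare gate_poly.simps [simp del] gate_formal_degree.simps [simp del]

definition circuit_poly :: "('v, 'a::comm_ring_1) circuit \<Rightarrow> ('v, 'a) mpoly" where
  "circuit_poly C = gate_poly C (output_node C)"

definition formal_degree :: "('v, 'a) circuit \<Rightarrow> nat" where
  "formal_degree C = gate_formal_degree C (output_node C)"

definition nodes_below :: "('v, 'a) circuit \<Rightarrow> nat set \<Rightarrow> nat set" where
  "nodes_below C A = (\<Union>i\<in>A. set (children (C ! i)))"

definition depth_four :: "('v, 'a) circuit \<Rightarrow> bool" where
  "depth_four C \<longleftrightarrow>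
     (let L0 = {output_node C}; L1 = nodes_below C L0; L2 = nodes_below C L1;
          L3 = nodes_below C L2; L4 = nodes_below C L3
      in (\<forall>i\<in>L0. \<exists>js. C ! i = Sum js) \<and>
         (\<forall>i\<in>L1. \<exists>js. C ! i = Prod js) \<and>
         (\<forall>i\<in>L2. \<exists>js. C ! i = Sum js) \<and>
         (\<forall>i\<in>L3. \<exists>js. C ! i = Prod js) \<and>
         (\<forall>i\<in>L4. (\<exists>v. C ! i = Var v) \<or> (\<exists>c. C ! i = Const c)))"

end

theory Submission
  imports Defs "HOL-Computational_Algebra.Polynomial" "HOL-Library.Function_Algebras"
    "HOL-Analysis.Analysis" "HOL-Real_Asymp.Real_Asymp"
begin

text \<open>Restrict IMM to a layered graph with random vertex labels, made of k blocks, with k a small multiple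
  of \<open>sqrt (d / r)\<close>. In each block a walk first chooses one of g gadgets, by an X-variable, and then walks
  inside the gadget along Y-variables. The restriction kills all monomials of a small circuit that contain more
  than t variables.

  On the circuit side, put \<open>X = z * 1\<^sub>A\<close> with \<open>card A \<le> k\<close>. The circuit polynomial has degree at most
  \<open>q = r * k\<close> in z, so at most q factors of each product contribute a nonconstant term in z. Multiplying by
  monomials of degree l in Y yields functions on the cube that lie in the span of few products of constant
  terms, times monomials of degree at most \<open>l + t * q\<close>.

  On the IMM side, the same functions are the sums over the walks through the gadgets A of the monomial of the
  walk times a monomial S of degree l. Their sets of largest size, in which S avoids the walk, are leading terms,
  and the second moment method shows that there are many of them. This needs l slightly below half the number of
  Y-variables: then the number of subsets of size l grows by a factor \<open>x > 1\<close> for each added element, where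
  \<open>x ^ (block length) = g\<close>, so that every block gains a factor g, and the degree \<open>t * q\<close> costs only a third of
  the total gain.\<close>

section \<open>Evaluation of polynomials\<close>

text \<open>The substitution of z replaces them: only the value at \<open>z = 1\<close>, a point of
  the cube, has to agree, while the individual degree controls the degree in z. At
  \<open>z = 0\<close> every X-variable vanishes whatever A is, so constant terms are common to all
  A and one spanning set serves all \<open>g ^ k\<close> choices. On the cube monomials multiply by
  union of sets, so the degree drops when S meets a walk.

  Deleting variables independently would destroy the walks. Random vertex labels keep every walk of
  the layered graph, yet a fixed monomial survives only if it guesses the labels that it uses.

  Two walks through the same gadget may part and meet again. A width w of at least the square of the
  number of steps limits the effect to about \<open>sqrt w\<close> per block.

  The parameter t is a compromise: a large t leaves few groups of factors, about
  \<open>2 * d / t\<close>, hence few products of constant terms, but shifts the degree by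
  \<open>t * q\<close>. The bound on r is what makes the number of those products
  affordable.\<close>

definition hom_eval :: "('a \<Rightarrow> 'b) \<Rightarrow> ('v \<Rightarrow> 'b) \<Rightarrow> ('v, 'a::comm_ring_1) mpoly \<Rightarrow> 'b::comm_ring_1" where
  "hom_eval \<phi> \<theta> p = (\<Sum>m\<in>Poly_Mapping.keys p. \<phi> (Poly_Mapping.lookup p m) *
     (\<Prod>v\<in>Poly_Mapping.keys m. \<theta> v ^ Poly_Mapping.lookup m v))"

text \<open>Used for two coefficient maps: the identity, which gives \<open>mpoly_eval\<close>, and
  \<open>[:x:]\<close>, which substitutes univariate polynomials in z for the variables. The second
  one gives a meaning to degrees and coefficients in z before z is set to 1.\<close>

locale coeff_hom =
  fixes \<phi> :: "'a::comm_ring_1 \<Rightarrow> 'b::comm_ring_1"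
  assumes hom_zero: "\<phi> 0 = 0" and hom_one: "\<phi> 1 = 1"
    and hom_add: "\<phi> (x + y) = \<phi> x + \<phi> y" and hom_mult: "\<phi> (x * y) = \<phi> x * \<phi> y"
begin

lemma hom_eval_superset:
  assumes "finite S" "Poly_Mapping.keys p \<subseteq> S"
  shows "hom_eval \<phi> \<theta> p = (\<Sum>m\<in>S. \<phi> (Poly_Mapping.lookup p m) *
     (\<Prod>v\<in>Poly_Mapping.keys m. \<theta> v ^ Poly_Mapping.lookup m v))"
  unfolding hom_eval_def
  by (rule sum.mono_neutral_left) (use assms in \<open>auto simp: in_keys_iff hom_zero\<close>)

lemma monomial_eval_superset:
  fixes m :: "'v \<Rightarrow>\<^sub>0 nat" and \<theta> :: "'v \<Rightarrow> 'b"
  assumes "finite S" "Poly_Mapping.keys m \<subseteq> S"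
  shows "(\<Prod>v\<in>Poly_Mapping.keys m. \<theta> v ^ Poly_Mapping.lookup m v) = (\<Prod>v\<in>S. \<theta> v ^ Poly_Mapping.lookup m v)"
  by (rule prod.mono_neutral_left) (use assms in \<open>auto simp: in_keys_iff\<close>)

lemma monomial_eval_add:
  fixes m m' :: "'v \<Rightarrow>\<^sub>0 nat" and \<theta> :: "'v \<Rightarrow> 'b"
  shows "(\<Prod>v\<in>Poly_Mapping.keys (m + m'). \<theta> v ^ Poly_Mapping.lookup (m + m') v) =
   (\<Prod>v\<in>Poly_Mapping.keys m. \<theta> v ^ Poly_Mapping.lookup m v) *
   (\<Prod>v\<in>Poly_Mapping.keys m'. \<theta> v ^ Poly_Mapping.lookup m' v)"
proof -
  let ?S = "Poly_Mapping.keys m \<union> Poly_Mapping.keys m'"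
  have "Poly_Mapping.keys (m + m') \<subseteq> ?S" by (rule Poly_Mapping.keys_add)
  then show ?thesis
    by (subst (1 2 3) monomial_eval_superset[of ?S])
       (auto simp: lookup_add power_add prod.distrib)
qed

lemma hom_eval_add: "hom_eval \<phi> \<theta> (p + q) = hom_eval \<phi> \<theta> p + hom_eval \<phi> \<theta> q"
proof -
  let ?S = "Poly_Mapping.keys p \<union> Poly_Mapping.keys q"
  have "Poly_Mapping.keys (p + q) \<subseteq> ?S" by (rule Poly_Mapping.keys_add)
  then show ?thesis
    by (subst (1 2 3) hom_eval_superset[of ?S])
       (auto simp: lookup_add hom_add distrib_right sum.distrib)
qed

lemma hom_eval_zero: "hom_eval \<phi> \<theta> 0 = 0"
  by (simp add: hom_eval_def)

lemma hom_eval_single: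
  "hom_eval \<phi> \<theta> (Poly_Mapping.single m c) = \<phi> c * (\<Prod>v\<in>Poly_Mapping.keys m. \<theta> v ^ Poly_Mapping.lookup m v)"
  by (cases "c = 0") (simp_all add: hom_eval_def hom_zero)

lemma hom_eval_one: "hom_eval \<phi> \<theta> 1 = 1"
proof -
  have "hom_eval \<phi> \<theta> (Poly_Mapping.single 0 1) = 1" unfolding hom_eval_single by (simp add: hom_one)
  then show ?thesis by simp
qed

lemma hom_eval_sum: "hom_eval \<phi> \<theta> (sum f A) = (\<Sum>x\<in>A. hom_eval \<phi> \<theta> (f x))"
  by (induction A rule: infinite_finite_induct) (auto simp: hom_eval_add hom_eval_zero)

lemma mpoly_sum_monomials:
  fixes p :: "('v, 'a) mpoly"
  shows "p = (\<Sum>m\<in>Poly_Mapping.keys p. Poly_Mapping.single m (Poly_Mapping.lookup p m))"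
  by (rule poly_mapping_eqI) (auto simp: lookup_sum lookup_single when_def in_keys_iff)

lemma hom_eval_mult: "hom_eval \<phi> \<theta> (p * q) = hom_eval \<phi> \<theta> p * hom_eval \<phi> \<theta> q"
proof -
  have single: "hom_eval \<phi> \<theta> (Poly_Mapping.single m c * Poly_Mapping.single m' c') =
      hom_eval \<phi> \<theta> (Poly_Mapping.single m c) * hom_eval \<phi> \<theta> (Poly_Mapping.single m' c')" for m m' c c'
    unfolding mult_single hom_eval_single monomial_eval_add hom_mult by (simp add: mult_ac)
  have "hom_eval \<phi> \<theta> (p * q) =
      hom_eval \<phi> \<theta> ((\<Sum>m\<in>Poly_Mapping.keys p. Poly_Mapping.single m (Poly_Mapping.lookup p m)) *
        (\<Sum>m\<in>Poly_Mapping.keys q. Poly_Mapping.single m (Poly_Mapping.lookup q m)))"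
    by (simp only: mpoly_sum_monomials[symmetric])
  also have "\<dots> = hom_eval \<phi> \<theta> (\<Sum>m\<in>Poly_Mapping.keys p. Poly_Mapping.single m (Poly_Mapping.lookup p m)) *
        hom_eval \<phi> \<theta> (\<Sum>m\<in>Poly_Mapping.keys q. Poly_Mapping.single m (Poly_Mapping.lookup q m))"
    by (simp add: sum_product hom_eval_sum single)
  also have "\<dots> = hom_eval \<phi> \<theta> p * hom_eval \<phi> \<theta> q"
    by (simp only: mpoly_sum_monomials[symmetric])
  finally show ?thesis .
qed

lemma hom_eval_prod: "hom_eval \<phi> \<theta> (prod f A) = (\<Prod>x\<in>A. hom_eval \<phi> \<theta> (f x))"
  by (induction A rule: infinite_finite_induct) (auto simp: hom_eval_mult hom_eval_one)

lemma hom_eval_sum_list: "hom_eval \<phi> \<theta> (sum_list ps) = sum_list (map (hom_eval \<phi> \<theta>) ps)"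
  by (induction ps) (auto simp: hom_eval_add hom_eval_zero)

lemma hom_eval_prod_list: "hom_eval \<phi> \<theta> (prod_list ps) = prod_list (map (hom_eval \<phi> \<theta>) ps)"
  by (induction ps) (auto simp: hom_eval_mult hom_eval_one)

lemma hom_eval_mvar: "hom_eval \<phi> \<theta> (mvar v) = \<theta> v"
  by (simp add: mvar_def hom_eval_single hom_one)

lemma hom_eval_mconst: "hom_eval \<phi> \<theta> (mconst c) = \<phi> c"
  by (simp add: mconst_def hom_eval_single)

end

interpretation id_hom: coeff_hom "\<lambda>x::'a::comm_ring_1. x"
  by (rule coeff_hom.intro) (rule refl)+

interpretation const_hom: coeff_hom "\<lambda>x::'a::comm_ring_1. [:x:]"
  by (rule coeff_hom.intro) (simp_all add: one_pCons)

lemma mpoly_eval_hom_eval: "mpoly_eval a p = hom_eval (\<lambda>x. x) a p"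
  by (simp add: mpoly_eval_def hom_eval_def)

lemma poly_hom_eval_const:
  "poly (hom_eval (\<lambda>x. [:x:]) \<theta> p) z = mpoly_eval (\<lambda>v. poly (\<theta> v) z) p"
  by (simp add: hom_eval_def mpoly_eval_def poly_sum poly_prod poly_power)

lemma mpoly_eval_IMM:
  "mpoly_eval \<alpha> (IMM n d) = (\<Sum>p \<in> {1..d - 1} \<rightarrow>\<^sub>E {1..n}.
     \<Prod>k = 1..d. \<alpha> (k, (p(0 := 1, d := 1)) (k - 1), (p(0 := 1, d := 1)) k))"
  by (simp only: mpoly_eval_hom_eval IMM_def id_hom.hom_eval_sum id_hom.hom_eval_prod id_hom.hom_eval_mvar)

text \<open>In a monomial only the variables of A contribute to the degree, each with an exponent of
  at most r. Here the bound on the individual degree enters; it concerns the output polynomial and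
  says nothing about inner gates.\<close>

lemma degree_hom_eval_le:
  fixes p :: "('v, 'a::field) mpoly"
  assumes "individual_degree_le p r" "finite A"
    and \<theta>: "\<And>v. v \<notin> A \<Longrightarrow> degree (\<theta> v) = 0" "\<And>v. degree (\<theta> v) \<le> 1"
  shows "degree (hom_eval (\<lambda>x. [:x:]) \<theta> p) \<le> r * card A"
  unfolding hom_eval_def
proof (rule degree_sum_le)
  fix m assume m: "m \<in> Poly_Mapping.keys p"
  have "degree (\<Prod>v\<in>Poly_Mapping.keys m. \<theta> v ^ Poly_Mapping.lookup m v)
      \<le> (\<Sum>v\<in>Poly_Mapping.keys m. degree (\<theta> v ^ Poly_Mapping.lookup m v))"
    using degree_prod_sum_le[OF finite_keys] by (simp add: o_def)
  also have "\<dots> \<le> (\<Sum>v\<in>Poly_Mapping.keys m. if v \<in> A then r else 0)"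
  proof (rule sum_mono)
    fix v assume "v \<in> Poly_Mapping.keys m"
    have "degree (\<theta> v ^ Poly_Mapping.lookup m v) \<le> degree (\<theta> v) * Poly_Mapping.lookup m v"
      by (rule degree_power_le)
    also have "\<dots> \<le> (if v \<in> A then r else 0)"
    proof (cases "v \<in> A")
      case True
      have "Poly_Mapping.lookup m v \<le> r" using assms(1) m unfolding individual_degree_le_def by blast
      then have "degree (\<theta> v) * Poly_Mapping.lookup m v \<le> 1 * r"
        using \<theta>(2) by (intro mult_le_mono) auto
      then show ?thesis using True by simp
    next
      case False
      then show ?thesis using \<theta>(1) by simp
    qed
    finally show "degree (\<theta> v ^ Poly_Mapping.lookup m v) \<le> (if v \<in> A then r else 0)" .
  qed
  also have "\<dots> = r * card (Poly_Mapping.keys m \<inter> A)"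
    by (simp add: sum.inter_restrict[OF finite_keys, symmetric])
  also have "\<dots> \<le> r * card A"
    using assms(2) by (intro mult_le_mono2 card_mono) auto
  finally have "degree (\<Prod>v\<in>Poly_Mapping.keys m. \<theta> v ^ Poly_Mapping.lookup m v) \<le> r * card A" .
  then show "degree ([:Poly_Mapping.lookup p m:] * (\<Prod>v\<in>Poly_Mapping.keys m. \<theta> v ^ Poly_Mapping.lookup m v))
      \<le> r * card A"
    by (intro order.trans[OF degree_mult_le]) (unfold degree_pCons_0 add_0)
qed (rule finite_keys)

section \<open>Rank of shifted monomials\<close>

interpretation fun_vs: vector_space "\<lambda>(c::'a::field) (f::'b \<Rightarrow> 'a) x. c * f x"
  by unfold_locales (auto simp: fun_eq_iff algebra_simps)

lemma sum_fun_apply: "(\<Sum>i\<in>A. f i) x = (\<Sum>i\<in>A. f i x)" for f :: "'i \<Rightarrow> 'b \<Rightarrow> 'a::field"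
  by (induction A rule: infinite_finite_induct) auto

text \<open>A point of the cube is given by the set U of its coordinates equal to 1, so this is the
  multilinear monomial of S as a function on the cube. Idempotence of 0 and 1 turns products into
  unions.\<close>

definition set_monomial :: "'v set \<Rightarrow> 'v set \<Rightarrow> 'a::field" where
  "set_monomial S U = (if S \<subseteq> U then 1 else 0)"

lemma set_monomial_mult: "set_monomial S U * set_monomial S' U = set_monomial (S \<union> S') U"
  by (auto simp: set_monomial_def)

text \<open>At a minimal member M of the support every other monomial of the support vanishes,
  because no other member is contained in M.\<close>

lemma set_monomials_independent:
  fixes \<gamma> :: "'v set \<Rightarrow> 'a::field"
  assumes "finite W" "\<And>U. (\<Sum>S\<in>W. \<gamma> S * set_monomial S U) = 0" "T \<in> W"
  shows "\<gamma> T = 0"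
proof (rule ccontr)
  assume "\<gamma> T \<noteq> 0"
  let ?B = "{S \<in> W. \<gamma> S \<noteq> 0}"
  have "finite ?B" "?B \<noteq> {}" using assms \<open>\<gamma> T \<noteq> 0\<close> by auto
  then obtain M where M: "M \<in> ?B" "\<And>S. S \<in> ?B \<Longrightarrow> S \<subseteq> M \<Longrightarrow> M = S"
    using finite_has_minimal[of ?B] by auto
  have "(\<Sum>S\<in>W. \<gamma> S * set_monomial S M) = (\<Sum>S\<in>{M}. \<gamma> S * set_monomial S M)"
    by (rule sum.mono_neutral_right) (use assms(1) M in \<open>auto simp: set_monomial_def\<close>)
  then show False using assms(2)[of M] M(1) by (simp add: set_monomial_def)
qed

lemma finite_has_arg_max:
  fixes f :: "'b \<Rightarrow> nat"
  assumes "finite B" "B \<noteq> {}"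
  obtains x where "x \<in> B" "\<And>y. y \<in> B \<Longrightarrow> f y \<le> f x"
proof -
  have "Max (f ` B) \<in> f ` B" using assms by (intro Max_in) auto
  then obtain x where "x \<in> B" "f x = Max (f ` B)" by auto
  then show ?thesis using that[of x] assms by auto
qed

text \<open>Distinct leading sets give independence. In a relation, take j with the largest
  \<open>key (T j)\<close> among the nonzero coefficients: for any i that contributes to the
  coefficient of \<open>T j\<close>, the key of \<open>T i\<close> is squeezed to
  \<open>key (T j)\<close>, so \<open>T i = T j\<close> and i is j. Injectivity of v is part of the
  conclusion because independence of the image alone would hide repetitions.\<close>

lemma echelon_independent:
  fixes v :: "'i \<Rightarrow> 'v set \<Rightarrow> 'a::field" and key :: "'v set \<Rightarrow> nat"
  assumes "finite I" "finite W" "inj_on T I" "inj_on key W"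
    and v: "\<And>i. i \<in> I \<Longrightarrow> v i = (\<lambda>U. \<Sum>S\<in>W. m i S * set_monomial S U)"
    and T: "\<And>i. i \<in> I \<Longrightarrow> T i \<in> W" "\<And>i. i \<in> I \<Longrightarrow> m i (T i) \<noteq> 0"
    and lead: "\<And>i S. i \<in> I \<Longrightarrow> S \<in> W \<Longrightarrow> m i S \<noteq> 0 \<Longrightarrow> key S \<le> key (T i)"
  shows "inj_on v I \<and> fun_vs.independent (v ` I)"
proof -
  have zero: "\<gamma> i = 0" if \<gamma>: "\<And>U. (\<Sum>i\<in>I. \<gamma> i * v i U) = 0" and i: "i \<in> I" for \<gamma> i
  proof (rule ccontr)
    assume "\<gamma> i \<noteq> 0"
    let ?B = "{i \<in> I. \<gamma> i \<noteq> 0}"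
    have "finite ?B" "?B \<noteq> {}" using assms(1) i \<open>\<gamma> i \<noteq> 0\<close> by auto
    obtain j where j: "j \<in> ?B" and jmax: "\<And>i. i \<in> ?B \<Longrightarrow> key (T i) \<le> key (T j)"
      using finite_has_arg_max[OF \<open>finite ?B\<close> \<open>?B \<noteq> {}\<close>, of "\<lambda>i. key (T i)"] by metis
    have "(\<Sum>S\<in>W. (\<Sum>i\<in>I. \<gamma> i * m i S) * set_monomial S U) = (\<Sum>i\<in>I. \<gamma> i * v i U)" for U
    proof -
      have "(\<Sum>S\<in>W. (\<Sum>i\<in>I. \<gamma> i * m i S) * set_monomial S U)
          = (\<Sum>S\<in>W. \<Sum>i\<in>I. \<gamma> i * (m i S * set_monomial S U))"
        by (simp add: sum_distrib_right mult.assoc)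
      also have "\<dots> = (\<Sum>i\<in>I. \<Sum>S\<in>W. \<gamma> i * (m i S * set_monomial S U))" by (rule sum.swap)
      also have "\<dots> = (\<Sum>i\<in>I. \<gamma> i * v i U)"
        by (rule sum.cong[OF refl]) (simp add: v sum_distrib_left)
      finally show ?thesis .
    qed
    then have "(\<Sum>i\<in>I. \<gamma> i * m i (T j)) = 0"
      by (intro set_monomials_independent[OF assms(2), where \<gamma> = "\<lambda>S. \<Sum>i\<in>I. \<gamma> i * m i S"])
         (use \<gamma> j T(1) in simp_all)
    moreover have "(\<Sum>i\<in>I. \<gamma> i * m i (T j)) = (\<Sum>i\<in>{j}. \<gamma> i * m i (T j))"
    proof (rule sum.mono_neutral_right[OF assms(1)])
      show "\<forall>i\<in>I - {j}. \<gamma> i * m i (T j) = 0"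
      proof
        fix i assume "i \<in> I - {j}"
        then have i: "i \<in> I" "i \<noteq> j" by auto
        show "\<gamma> i * m i (T j) = 0"
        proof (rule ccontr)
          assume *: "\<gamma> i * m i (T j) \<noteq> 0"
          then have "key (T i) = key (T j)"
            using lead[of i "T j"] jmax[of i] i j T by force
          then have "T i = T j" using i j T assms(4) by (auto dest: inj_onD)
          then show False using i j assms(3) by (auto dest: inj_onD)
        qed
      qed
    qed (use j in auto)
    ultimately show False using j T by auto
  qed
  have inj: "inj_on v I"
  proof (rule inj_onI, rule ccontr)
    fix i j assume ij: "i \<in> I" "j \<in> I" "v i = v j" "i \<noteq> j"
    \<comment> \<open>A coincidence \<open>v i = v j\<close> is itself a nontrivial relation, with
      coefficients 1 and -1.\<close>
    define \<gamma> where "\<gamma> = (\<lambda>k. if k = i then 1 else if k = j then -1 else (0::'a))"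
    have "(\<Sum>k\<in>I. \<gamma> k * v k U) = (\<Sum>k\<in>{i,j}. \<gamma> k * v k U)" for U
      by (rule sum.mono_neutral_right) (use assms(1) ij in \<open>auto simp: \<gamma>_def\<close>)
    moreover have "(\<Sum>k\<in>{i,j}. \<gamma> k * v k U) = 0" for U using ij by (simp add: \<gamma>_def)
    ultimately have "\<And>U. (\<Sum>k\<in>I. \<gamma> k * v k U) = 0" by simp
    from zero[OF this ij(1)] have "\<gamma> i = 0" .
    then show False by (simp add: \<gamma>_def)
  qed
  moreover have "fun_vs.independent (v ` I)"
  proof (rule fun_vs.independent_if_scalars_zero)
    fix f x assume f: "(\<Sum>x\<in>v ` I. (\<lambda>y. f x * x y)) = 0" and x: "x \<in> v ` I"
    then obtain i where i: "i \<in> I" "x = v i" by auto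
    have "(\<Sum>i\<in>I. f (v i) * v i U) = 0" for U
    proof -
      have "(\<Sum>i\<in>I. f (v i) * v i U) = (\<Sum>x\<in>v ` I. (\<lambda>y. f x * x y)) U"
        by (subst sum_fun_apply) (use inj in \<open>simp add: sum.reindex\<close>)
      then show ?thesis by (simp add: f)
    qed
    then show "f x = 0" using zero[of "\<lambda>i. f (v i)" i] i by auto
  qed (use assms(1) in simp)
  ultimately show ?thesis by blast
qed

section \<open>Cauchy-Schwarz and the number of distinct values\<close>

lemma sum_card_fibres:
  assumes "finite A" "finite B" "f ` A \<subseteq> B"
  shows "(\<Sum>y\<in>B. card {x \<in> A. f x = y}) = card A"
  using sum.group[OF assms, of "\<lambda>_. 1::nat"] by simp

lemma cauchy_schwarz_nat:
  fixes f :: "'b \<Rightarrow> nat"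
  assumes "finite B"
  shows "(\<Sum>y\<in>B. f y)\<^sup>2 \<le> card B * (\<Sum>y\<in>B. (f y)\<^sup>2)"
proof -
  have "(\<Sum>y\<in>B. real (f y))\<^sup>2 \<le> real (card B) * (\<Sum>y\<in>B. (real (f y))\<^sup>2)"
    using sum_squared_le_sum_of_squares[of "\<lambda>y. real (f y)" B] by (simp add: mult.commute)
  then have "real ((\<Sum>y\<in>B. f y)\<^sup>2) \<le> real (card B * (\<Sum>y\<in>B. (f y)\<^sup>2))" by simp
  then show ?thesis by (simp only: of_nat_le_iff)
qed

text \<open>Cauchy-Schwarz over the fibres: few collisions force many distinct values. The values
  will be the leading sets of the shifted sums.\<close>

lemma card_image_squared_bound:
  assumes "finite A"
  shows "(card A)\<^sup>2 \<le> card (f ` A) * (\<Sum>y\<in>f ` A. (card {x \<in> A. f x = y})\<^sup>2)"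
  using cauchy_schwarz_nat[of "f ` A" "\<lambda>y. card {x \<in> A. f x = y}"] sum_card_fibres[of A "f ` A" f] assms
  by simp

text \<open>If S avoids some member of \<open>C a\<close>, then the largest sets \<open>S \<union> \<beta>\<close> are those with S and \<open>\<beta>\<close> disjoint,
  and each of them determines \<open>\<beta>\<close>. Hence they occur with coefficient 1, in every characteristic.\<close>

lemma shifted_monomials_rank:
  fixes C :: "'b \<Rightarrow> 'v set set" and G :: "('v set \<Rightarrow> 'a::field) set"
  assumes "finite Y" "finite \<A>" "finite G"
    and C: "\<And>a \<beta>. a \<in> \<A> \<Longrightarrow> \<beta> \<in> C a \<Longrightarrow> \<beta> \<subseteq> Y \<and> card \<beta> = D"
    and span: "\<And>a S. a \<in> \<A> \<Longrightarrow> S \<subseteq> Y \<Longrightarrow> card S = l \<Longrightarrow>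
      (\<lambda>U. \<Sum>\<beta>\<in>C a. set_monomial (S \<union> \<beta>) U) \<in> fun_vs.span G"
  shows "(\<Sum>a\<in>\<A>. card {S. S \<subseteq> Y \<and> card S = l \<and> (\<exists>\<beta>\<in>C a. S \<inter> \<beta> = {})})\<^sup>2
    \<le> card G * (\<Sum>T | T \<subseteq> Y \<and> card T = l + D. (card {(a, \<beta>). a \<in> \<A> \<and> \<beta> \<in> C a \<and> \<beta> \<subseteq> T})\<^sup>2)"
proof -
  have finC: "finite (C a)" if "a \<in> \<A>" for a
    by (rule finite_subset[of _ "Pow Y"]) (use C[OF that] assms(1) in auto)
  obtain g :: "'v set \<Rightarrow> nat" where g: "g ` Pow Y = {i. i < card (Pow Y)}" "inj_on g (Pow Y)"
    using finite_imp_inj_to_nat_seg[of "Pow Y"] assms(1)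
    by (metis card_Collect_less_nat card_image finite_Pow_iff)
  \<comment> \<open>The numbering g breaks ties: as \<open>g S < card (Pow Y)\<close>, the key is
    injective on subsets of Y and orders them by cardinality first.\<close>
  define key where "key S = card S * card (Pow Y) + g S" for S
  have key_card: "card S \<le> card T" if "key S \<le> key T" "S \<subseteq> Y" "T \<subseteq> Y" for S T
  proof (rule ccontr)
    assume "\<not> card S \<le> card T"
    then have "(card T + 1) * card (Pow Y) \<le> card S * card (Pow Y)" by (intro mult_le_mono1) simp
    moreover have "g T < card (Pow Y)" using g(1) that by auto
    ultimately show False using that(1) by (simp add: key_def)
  qed
  have key_inj: "inj_on key (Pow Y)"
  proof (rule inj_onI)
    fix S T assume *: "S \<in> Pow Y" "T \<in> Pow Y" "key S = key T"
    then have "card S = card T" using key_card[of S T] key_card[of T S] by auto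
    then show "S = T" using * g(2) by (auto simp: key_def dest: inj_onD)
  qed
  define I where "I = (SIGMA a:\<A>. {S. S \<subseteq> Y \<and> card S = l \<and> (\<exists>\<beta>\<in>C a. S \<inter> \<beta> = {})})"
  have finI: "finite I" unfolding I_def using assms by auto
  have cardI: "card I = (\<Sum>a\<in>\<A>. card {S. S \<subseteq> Y \<and> card S = l \<and> (\<exists>\<beta>\<in>C a. S \<inter> \<beta> = {})})"
    unfolding I_def using assms(1,2) by (subst card_SigmaI) auto
  have "\<exists>X. X \<in> (\<lambda>\<beta>. snd i \<union> \<beta>) ` C (fst i) \<and> (\<forall>\<beta>\<in>C (fst i). key (snd i \<union> \<beta>) \<le> key X)"
    if "i \<in> I" for i
  proof -
    let ?B = "(\<lambda>\<beta>. snd i \<union> \<beta>) ` C (fst i)"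
    have "?B \<noteq> {}" "finite ?B" using that finC by (auto simp: I_def)
    then obtain X where "X \<in> ?B" "\<And>X'. X' \<in> ?B \<Longrightarrow> key X' \<le> key X"
      using finite_has_arg_max[of ?B key] by metis
    then show ?thesis by auto
  qed
  then obtain T where T: "T i \<in> (\<lambda>\<beta>. snd i \<union> \<beta>) ` C (fst i) \<and> (\<forall>\<beta>\<in>C (fst i). key (snd i \<union> \<beta>) \<le> key (T i))"
    if "i \<in> I" for i by metis
  have T_card: "card (T i) = l + D" "T i \<subseteq> Y" and T_diff: "T i - snd i \<in> C (fst i)" "snd i \<subseteq> T i"
    and T_dec: "\<And>\<beta>. \<beta> \<in> C (fst i) \<Longrightarrow> snd i \<union> \<beta> = T i \<Longrightarrow> \<beta> = T i - snd i" if iI: "i \<in> I" for i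
  proof -
    obtain a S where i: "i = (a, S)" by (cases i)
    have aS: "a \<in> \<A>" "S \<subseteq> Y" "card S = l" using iI by (auto simp: I_def i)
    obtain \<beta>0 where \<beta>0: "\<beta>0 \<in> C a" "S \<inter> \<beta>0 = {}" using iI by (auto simp: I_def i)
    obtain \<beta> where \<beta>: "\<beta> \<in> C a" "T i = S \<union> \<beta>" using T[OF iI] by (auto simp: i)
    have fin: "finite S" "finite \<beta>0" "finite \<beta>"
      using aS(2) C[OF aS(1) \<beta>0(1)] C[OF aS(1) \<beta>(1)] assms(1) by (auto intro: finite_subset)
    have c0: "card (S \<union> \<beta>0) = l + D" using \<beta>0 aS C[of a \<beta>0] fin by (simp add: card_Un_disjoint)
    have "key (S \<union> \<beta>0) \<le> key (T i)" using T[OF iI] \<beta>0 by (auto simp: i)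
    then have "l + D \<le> card (T i)"
      using key_card[of "S \<union> \<beta>0" "T i"] c0 aS C[of a] \<beta>0 \<beta> by auto
    moreover have "card (T i) \<le> l + D" using card_Un_le[of S \<beta>] \<beta> aS C[of a \<beta>] by simp
    ultimately show cT: "card (T i) = l + D" by simp
    show "T i \<subseteq> Y" using aS \<beta> C[of a \<beta>] by auto
    have dis: "S \<inter> \<beta>' = {}" if "\<beta>' \<in> C a" "T i = S \<union> \<beta>'" for \<beta>'
    proof -
      have "finite \<beta>'" "card \<beta>' = D" using that C[of a \<beta>'] aS assms(1) by (auto intro: finite_subset)
      then have "card (S \<inter> \<beta>') = 0" using card_Un_Int[of S \<beta>'] fin cT aS that by simp
      then show ?thesis using fin by simp
    qed
    then show "T i - snd i \<in> C (fst i)" "snd i \<subseteq> T i" using dis[OF \<beta>] \<beta>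
      by (auto simp: i Un_Diff Diff_triv Int_commute)
    show "\<beta>' = T i - snd i" if "\<beta>' \<in> C (fst i)" "snd i \<union> \<beta>' = T i" for \<beta>'
      using dis[of \<beta>'] that by (auto simp: i)
  qed
  \<comment> \<open>One index is kept for each leading set, so that T becomes injective. The sizes
    of the fibres of T are then paid for by the second moment.\<close>
  define J where "J = (\<lambda>X. SOME i. i \<in> I \<and> T i = X) ` (T ` I)"
  have J: "J \<subseteq> I" "inj_on T J" "T ` J = T ` I"
  proof -
    have *: "(SOME i. i \<in> I \<and> T i = X) \<in> I \<and> T (SOME i. i \<in> I \<and> T i = X) = X" if "X \<in> T ` I" for X
      using someI_ex[of "\<lambda>i. i \<in> I \<and> T i = X"] that by auto
    show "J \<subseteq> I" "inj_on T J" "T ` J = T ` I"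
      using * unfolding J_def by (auto simp: inj_on_def image_image)
  qed
  define v :: "_ \<Rightarrow> 'v set \<Rightarrow> 'a" where "v i = (\<lambda>U. \<Sum>\<beta>\<in>C (fst i). set_monomial (snd i \<union> \<beta>) U)" for i
  define m :: "_ \<Rightarrow> 'v set \<Rightarrow> 'a" where "m i S = of_nat (card {\<beta> \<in> C (fst i). snd i \<union> \<beta> = S})" for i S
  have "inj_on v J \<and> fun_vs.independent (v ` J)"
  proof (rule echelon_independent[where T = T and W = "Pow Y" and key = key and m = m])
    show "finite J" using J(1) finI finite_subset by blast
    show "finite (Pow Y)" using assms(1) by simp
    fix i assume "i \<in> J"
    then have i: "i \<in> I" using J by blast
    have a: "fst i \<in> \<A>" and S: "snd i \<subseteq> Y" using i by (auto simp: I_def)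
    show "v i = (\<lambda>U. \<Sum>S\<in>Pow Y. m i S * set_monomial S U)"
    proof
      fix U
      have "v i U = (\<Sum>S\<in>Pow Y. \<Sum>\<beta>\<in>{\<beta> \<in> C (fst i). snd i \<union> \<beta> = S}. set_monomial (snd i \<union> \<beta>) U)"
        unfolding v_def by (rule sum.group[symmetric]) (use finC[OF a] assms(1) C[OF a] S in auto)
      also have "\<dots> = (\<Sum>S\<in>Pow Y. m i S * set_monomial S U)"
        by (rule sum.cong[OF refl]) (simp add: m_def)
      finally show "v i U = (\<Sum>S\<in>Pow Y. m i S * set_monomial S U)" .
    qed
    show "T i \<in> Pow Y" using T_card i by blast
    have "{\<beta> \<in> C (fst i). snd i \<union> \<beta> = T i} = {T i - snd i}"
      using T_diff[OF i] T_dec[OF i] by blast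
    then show "m i (T i) \<noteq> 0" by (simp add: m_def)
    fix S' assume "m i S' \<noteq> 0"
    then have "{\<beta> \<in> C (fst i). snd i \<union> \<beta> = S'} \<noteq> {}" unfolding m_def by (metis card.empty of_nat_0)
    then show "key S' \<le> key (T i)" using T[OF i] by auto
  qed (use J key_inj in auto)
  moreover have "v ` J \<subseteq> fun_vs.span G"
    using J(1) span unfolding v_def I_def by force
  ultimately have "card (v ` J) \<le> card G"
    using fun_vs.independent_span_bound[OF assms(3)] by blast
  then have cardJ: "card (T ` I) \<le> card G"
    using \<open>inj_on v J \<and> _\<close> J by (metis card_image)
  have "(card I)\<^sup>2 \<le> card (T ` I) * (\<Sum>X\<in>T ` I. (card {i \<in> I. T i = X})\<^sup>2)"
    by (rule card_image_squared_bound[OF finI])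
  also have "\<dots> \<le> card G * (\<Sum>X | X \<subseteq> Y \<and> card X = l + D. (card {(a, \<beta>). a \<in> \<A> \<and> \<beta> \<in> C a \<and> \<beta> \<subseteq> X})\<^sup>2)"
  proof (rule mult_le_mono[OF cardJ])
    have "(\<Sum>X\<in>T ` I. (card {i \<in> I. T i = X})\<^sup>2) \<le>
        (\<Sum>X\<in>T ` I. (card {(a, \<beta>). a \<in> \<A> \<and> \<beta> \<in> C a \<and> \<beta> \<subseteq> X})\<^sup>2)"
    proof (rule sum_mono, rule power_mono)
      fix X assume "X \<in> T ` I"
      \<comment> \<open>For a fixed leading set X the pair (a, S) is recovered from a and
        \<open>X - S\<close>, which is a member of \<open>C a\<close> inside X.\<close>
      let ?f = "\<lambda>i. (fst i, X - snd i)"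
      show "card {i \<in> I. T i = X} \<le> card {(a, \<beta>). a \<in> \<A> \<and> \<beta> \<in> C a \<and> \<beta> \<subseteq> X}"
      proof (rule card_inj_on_le[where f = ?f])
        show "inj_on ?f {i \<in> I. T i = X}"
        proof (rule inj_onI)
          fix i j assume *: "i \<in> {i \<in> I. T i = X}" "j \<in> {i \<in> I. T i = X}" "?f i = ?f j"
          then have "snd i \<subseteq> X" "snd j \<subseteq> X" using T_diff(2) by blast+
          with * show "i = j" by (simp add: prod_eq_iff) (metis double_diff order_refl)
        qed
        show "?f ` {i \<in> I. T i = X} \<subseteq> {(a, \<beta>). a \<in> \<A> \<and> \<beta> \<in> C a \<and> \<beta> \<subseteq> X}"
          using T_diff(1) by (auto simp: I_def)
        show "finite {(a, \<beta>). a \<in> \<A> \<and> \<beta> \<in> C a \<and> \<beta> \<subseteq> X}"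
          by (rule finite_subset[of _ "Sigma \<A> C"]) (use assms(2) finC in auto)
      qed
    qed simp
    also have "\<dots> \<le> (\<Sum>X | X \<subseteq> Y \<and> card X = l + D. (card {(a, \<beta>). a \<in> \<A> \<and> \<beta> \<in> C a \<and> \<beta> \<subseteq> X})\<^sup>2)"
    proof (rule sum_mono2)
      show "T ` I \<subseteq> {X. X \<subseteq> Y \<and> card X = l + D}" using T_card by blast
    qed (use assms(1) in auto)
    finally show "(\<Sum>X\<in>T ` I. (card {i \<in> I. T i = X})\<^sup>2) \<le> \<dots>" .
  qed
  finally show ?thesis by (simp only: cardI)
qed

section \<open>Counting sets\<close>

lemma card_subsets_disjoint:
  assumes "finite Y" "I \<subseteq> Y"
  shows "card {S. S \<subseteq> Y \<and> card S = l \<and> S \<inter> I = {}} = (card Y - card I) choose l"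
proof -
  have "{S. S \<subseteq> Y \<and> card S = l \<and> S \<inter> I = {}} = {S. S \<subseteq> Y - I \<and> card S = l}" by auto
  then show ?thesis
    using n_subsets[of "Y - I" l] assms by (simp add: card_Diff_subset finite_subset)
qed

lemma card_subsets_containing:
  assumes "finite Y" "I \<subseteq> Y" "card I \<le> l"
  shows "card {S. S \<subseteq> Y \<and> card S = l \<and> I \<subseteq> S} = (card Y - card I) choose (l - card I)"
proof -
  have fI: "finite I" using assms finite_subset by blast
  have "bij_betw (\<lambda>S. S \<union> I) {S. S \<subseteq> Y - I \<and> card S = l - card I} {S. S \<subseteq> Y \<and> card S = l \<and> I \<subseteq> S}"
  proof (rule bij_betwI[where g = "\<lambda>S. S - I"])
    show "(\<lambda>S. S \<union> I) \<in> {S. S \<subseteq> Y - I \<and> card S = l - card I} \<rightarrow> {S. S \<subseteq> Y \<and> card S = l \<and> I \<subseteq> S}"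
    proof
      fix S assume S: "S \<in> {S. S \<subseteq> Y - I \<and> card S = l - card I}"
      then have "finite S" using assms(1) by (auto intro: finite_subset)
      moreover have "S \<inter> I = {}" using S by auto
      ultimately have "card (S \<union> I) = l" using S fI assms(3) by (simp add: card_Un_disjoint)
      then show "S \<union> I \<in> {S. S \<subseteq> Y \<and> card S = l \<and> I \<subseteq> S}" using S assms(2) by auto
    qed
    show "(\<lambda>S. S - I) \<in> {S. S \<subseteq> Y \<and> card S = l \<and> I \<subseteq> S} \<rightarrow> {S. S \<subseteq> Y - I \<and> card S = l - card I}"
      using fI by (auto simp: card_Diff_subset)
  qed auto
  then have "card {S. S \<subseteq> Y \<and> card S = l \<and> I \<subseteq> S} = card {S. S \<subseteq> Y - I \<and> card S = l - card I}"
    by (simp add: bij_betw_same_card)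
  then show ?thesis
    using n_subsets[of "Y - I" "l - card I"] assms fI by (simp add: card_Diff_subset)
qed

text \<open>This lemma and the next two concern a uniformly random l-subset of N points: it avoids i
  given points with probability at most \<open>(1 - l / N) ^ i\<close> and at least
  \<open>((N - l - i) / N) ^ i\<close>, and contains them with probability at most
  \<open>(l / N) ^ i\<close>. The fourth, \<open>binomial_raise\<close>, bounds the growth of the
  level sizes by \<open>(N - l) / (l + 1)\<close> per element. All multiply bounds on ratios of
  consecutive binomials, cleared of denominators.\<close>

lemma binomial_drop_upper:
  assumes "i \<le> N"
  shows "real ((N - i) choose l) * real N ^ i \<le> real (N choose l) * real (N - l) ^ i"
  using assms
proof (induction i)
  case (Suc i)
  have "Suc (N - Suc i) * ((N - Suc i) choose l) = (Suc (N - Suc i) - l) * (Suc (N - Suc i) choose l)"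
    by (cases "l \<le> Suc (N - Suc i)") (auto simp: binomial_absorb_comp)
  then have eq: "(N - i) * ((N - Suc i) choose l) = (N - i - l) * ((N - i) choose l)"
    using Suc.prems by (simp add: Suc_diff_Suc)
  have pos: "real (N - i) > 0" using Suc.prems by simp
  have "real ((N - Suc i) choose l) * real (N - i) = real ((N - i) choose l) * real (N - i - l)"
    using arg_cong[OF eq, of real] by (simp add: mult.commute)
  then have e2: "real ((N - Suc i) choose l) = real ((N - i) choose l) * (real (N - i - l) / real (N - i))"
    using pos by (simp add: field_simps)
  have frac: "real (N - i - l) * real N \<le> real (N - l) * real (N - i)"
  proof (cases "l \<le> N - i")
    case True
    then have "real (N - i - l) = real N - real i - real l" "real (N - l) = real N - real l"
      "real (N - i) = real N - real i" using Suc.prems by (auto simp: of_nat_diff)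
    then show ?thesis by (simp add: algebra_simps)
  qed simp
  have "real ((N - Suc i) choose l) * real N ^ Suc i
      = (real ((N - i) choose l) * real N ^ i) * (real (N - i - l) * real N / real (N - i))"
    by (simp add: e2)
  also have "\<dots> \<le> (real (N choose l) * real (N - l) ^ i) * real (N - l)"
  proof (rule mult_mono)
    show "real ((N - i) choose l) * real N ^ i \<le> real (N choose l) * real (N - l) ^ i" using Suc by simp
    show "real (N - i - l) * real N / real (N - i) \<le> real (N - l)"
      using frac pos by (simp only: pos_divide_le_eq)
  qed auto
  finally show ?case by (simp add: mult_ac)
qed simp

lemma binomial_drop_lower:
  assumes "i + l \<le> N"
  shows "real (N choose l) * real (N - l - i) ^ i \<le> real ((N - i) choose l) * real N ^ i"
  using assms
proof (induction i)
  case (Suc i)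
  have "Suc (N - Suc i) * ((N - Suc i) choose l) = (Suc (N - Suc i) - l) * (Suc (N - Suc i) choose l)"
    by (cases "l \<le> Suc (N - Suc i)") (auto simp: binomial_absorb_comp)
  then have eq: "(N - i) * ((N - Suc i) choose l) = (N - i - l) * ((N - i) choose l)"
    using Suc.prems by (simp add: Suc_diff_Suc)
  have "real (N choose l) * real (N - l - Suc i) ^ Suc i \<le>
      (real (N choose l) * real (N - l - i) ^ i) * real (N - i - l)"
  proof -
    have "real (N - l - Suc i) ^ i \<le> real (N - l - i) ^ i" by (intro power_mono) auto
    moreover have "real (N - l - Suc i) \<le> real (N - i - l)" by auto
    ultimately have "real (N - l - Suc i) ^ i * real (N - l - Suc i) \<le> real (N - l - i) ^ i * real (N - i - l)"
      by (rule mult_mono) auto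
    then show ?thesis by (simp only: power_Suc2 mult.assoc mult_left_mono of_nat_0_le_iff)
  qed
  also have "\<dots> \<le> (real ((N - i) choose l) * real N ^ i) * real (N - i - l)"
    using Suc by (intro mult_right_mono) auto
  also have "\<dots> = real ((N - i - l) * ((N - i) choose l)) * real N ^ i" by simp
  also have "\<dots> = real (N - i) * (real ((N - Suc i) choose l) * real N ^ i)"
    unfolding eq[symmetric] by simp
  also have "\<dots> \<le> real N * (real ((N - Suc i) choose l) * real N ^ i)"
    by (intro mult_right_mono) auto
  finally show ?case by (simp add: mult_ac)
qed simp

lemma binomial_both_drop:
  assumes "i \<le> l" "l \<le> N"
  shows "real ((N - i) choose (l - i)) * real N ^ i \<le> real (N choose l) * real l ^ i"
  using assms
proof (induction i)
  case (Suc i)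
  have eq: "(l - i) * ((N - i) choose (l - i)) = (N - i) * ((N - Suc i) choose (l - Suc i))"
    using binomial_absorption[of "l - Suc i" "N - i"] Suc.prems
    by (simp add: Suc_diff_Suc)
  have pos: "real (N - i) > 0" using Suc.prems by simp
  have "real ((N - Suc i) choose (l - Suc i)) * real (N - i) = real ((N - i) choose (l - i)) * real (l - i)"
    using arg_cong[OF eq, of real] by (simp add: mult.commute)
  then have e2: "real ((N - Suc i) choose (l - Suc i)) = real ((N - i) choose (l - i)) * (real (l - i) / real (N - i))"
    using pos by (simp add: field_simps)
  have frac: "real (l - i) * real N \<le> real l * real (N - i)"
  proof -
    have "real i * real l \<le> real i * real N" using Suc.prems by (intro mult_left_mono) auto
    moreover have "real (l - i) = real l - real i" "real (N - i) = real N - real i"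
      using Suc.prems by (auto simp: of_nat_diff)
    ultimately show ?thesis by (simp only:) (simp add: algebra_simps)
  qed
  have "real ((N - Suc i) choose (l - Suc i)) * real N ^ Suc i
      = (real ((N - i) choose (l - i)) * real N ^ i) * (real (l - i) * real N / real (N - i))"
    by (simp add: e2)
  also have "\<dots> \<le> (real (N choose l) * real l ^ i) * real l"
  proof (rule mult_mono)
    show "real ((N - i) choose (l - i)) * real N ^ i \<le> real (N choose l) * real l ^ i" using Suc by simp
    show "real (l - i) * real N / real (N - i) \<le> real l"
      using frac pos by (simp only: pos_divide_le_eq)
  qed auto
  finally show ?case by (simp add: mult_ac)
qed simp

lemma binomial_raise:
  assumes "l + i \<le> N"
  shows "real (N choose (l + i)) * real (l + 1) ^ i \<le> real (N choose l) * real (N - l) ^ i"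
  using assms
proof (induction i)
  case (Suc i)
  have eq: "Suc (l + i) * (N choose Suc (l + i)) = (N - (l + i)) * (N choose (l + i))"
    using binomial_absorb_comp[of N "l + i"] binomial_absorption[of "l + i" N] Suc.prems
    by simp
  have "real (N choose (l + Suc i)) * real (l + 1) ^ Suc i \<le>
      (real (Suc (l + i)) * real (N choose Suc (l + i))) * real (l + 1) ^ i"
    by (auto intro!: mult_right_mono mult_left_mono simp: algebra_simps)
  also have "\<dots> = real (N - (l + i)) * (real (N choose (l + i)) * real (l + 1) ^ i)"
    using arg_cong[OF eq, of real] by (simp only: of_nat_mult mult.assoc)
  also have "\<dots> \<le> real (N - l) * (real (N choose l) * real (N - l) ^ i)"
  proof (rule mult_mono)
    show "real (N choose (l + i)) * real (l + 1) ^ i \<le> real (N choose l) * real (N - l) ^ i" using Suc by simp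
  qed auto
  finally show ?case by (simp add: mult_ac)
qed simp

lemma sum_rotate: "(\<Sum>s\<in>A. \<Sum>x\<in>B. \<Sum>y\<in>C. f s x y) = (\<Sum>x\<in>B. \<Sum>y\<in>C. \<Sum>s\<in>A. f s x y)"
proof -
  have "(\<Sum>s\<in>A. \<Sum>x\<in>B. \<Sum>y\<in>C. f s x y) = (\<Sum>x\<in>B. \<Sum>s\<in>A. \<Sum>y\<in>C. f s x y)" by (rule sum.swap)
  also have "\<dots> = (\<Sum>x\<in>B. \<Sum>y\<in>C. \<Sum>s\<in>A. f s x y)" by (intro sum.cong refl sum.swap)
  finally show ?thesis .
qed

lemma card_pairs_squared:
  assumes "finite A"
  shows "(card {x \<in> A. P x})\<^sup>2 = (\<Sum>x\<in>A. \<Sum>x'\<in>A. if P x \<and> P x' then 1 else 0)"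
proof -
  have "card {x \<in> A. P x} = (\<Sum>x\<in>A. if P x then 1 else 0)"
    using assms by (simp add: sum.inter_filter[symmetric])
  then have "(card {x \<in> A. P x})\<^sup>2 = (\<Sum>x\<in>A. \<Sum>x'\<in>A. (if P x then 1 else 0) * (if P x' then 1 else 0))"
    unfolding power2_eq_square by (simp only: sum_product)
  also have "\<dots> = (\<Sum>x\<in>A. \<Sum>x'\<in>A. if P x \<and> P x' then 1 else 0)"
    by (intro sum.cong refl) auto
  finally show ?thesis .
qed

lemma sum_card_filter:
  assumes "finite X"
  shows "(\<Sum>x\<in>X. if P x then 1 else 0) = card {x \<in> X. P x}"
  using assms by (simp add: sum.inter_filter[symmetric])

text \<open>Cauchy-Schwarz for the number of members of \<open>\<C>\<close> that S avoids, a
  function supported on the sets in question. Its first moment needs single \<beta>, its second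
  moment pairs, through the size of their union.\<close>

lemma avoiding_second_moment:
  assumes "finite Y" and C: "\<And>\<beta>. \<beta> \<in> \<C> \<Longrightarrow> \<beta> \<subseteq> Y \<and> card \<beta> = D"
  shows "(card \<C> * ((card Y - D) choose l))\<^sup>2 \<le>
    card {S. S \<subseteq> Y \<and> card S = l \<and> (\<exists>\<beta>\<in>\<C>. S \<inter> \<beta> = {})} *
    (\<Sum>\<beta>\<in>\<C>. \<Sum>\<beta>'\<in>\<C>. (card Y - card (\<beta> \<union> \<beta>')) choose l)"
proof -
  have finC: "finite \<C>" by (rule finite_subset[of _ "Pow Y"]) (use C assms(1) in auto)
  let ?A = "{S. S \<subseteq> Y \<and> card S = l}"
  let ?G = "{S. S \<subseteq> Y \<and> card S = l \<and> (\<exists>\<beta>\<in>\<C>. S \<inter> \<beta> = {})}"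
  have finA: "finite ?A" "finite ?G" using assms(1) by auto
  have zero: "card {\<beta> \<in> \<C>. S \<inter> \<beta> = {}} = 0" if "S \<in> ?A - ?G" for S
  proof -
    have "{\<beta> \<in> \<C>. S \<inter> \<beta> = {}} = {}" using that by blast
    then show ?thesis by (simp only: card.empty)
  qed
  have "(\<Sum>S\<in>?G. card {\<beta> \<in> \<C>. S \<inter> \<beta> = {}}) = (\<Sum>S\<in>?A. card {\<beta> \<in> \<C>. S \<inter> \<beta> = {}})"
    by (rule sum.mono_neutral_left) (use finA zero in \<open>simp_all add: Collect_mono\<close>)
  also have "\<dots> = (\<Sum>S\<in>?A. \<Sum>\<beta>\<in>\<C>. if S \<inter> \<beta> = {} then 1 else 0)"
    by (simp add: sum_card_filter[OF finC])
  also have "\<dots> = (\<Sum>\<beta>\<in>\<C>. \<Sum>S\<in>?A. if S \<inter> \<beta> = {} then 1 else 0)" by (rule sum.swap)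
  also have "\<dots> = (\<Sum>\<beta>\<in>\<C>. (card Y - D) choose l)"
  proof (rule sum.cong[OF refl])
    fix \<beta> assume "\<beta> \<in> \<C>"
    then have \<beta>: "\<beta> \<subseteq> Y" "card \<beta> = D" using C by auto
    have "(\<Sum>S\<in>?A. if S \<inter> \<beta> = {} then 1 else 0) = card {S \<in> ?A. S \<inter> \<beta> = {}}"
      by (rule sum_card_filter[OF finA(1)])
    also have "{S \<in> ?A. S \<inter> \<beta> = {}} = {S. S \<subseteq> Y \<and> card S = l \<and> S \<inter> \<beta> = {}}" by auto
    finally show "(\<Sum>S\<in>?A. if S \<inter> \<beta> = {} then 1 else 0) = (card Y - D) choose l"
      using card_subsets_disjoint[OF assms(1) \<beta>(1)] \<beta>(2) by simp
  qed
  finally have first: "(\<Sum>S\<in>?G. card {\<beta> \<in> \<C>. S \<inter> \<beta> = {}}) = card \<C> * ((card Y - D) choose l)" by simp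
  have "(\<Sum>S\<in>?G. (card {\<beta> \<in> \<C>. S \<inter> \<beta> = {}})\<^sup>2) = (\<Sum>S\<in>?A. (card {\<beta> \<in> \<C>. S \<inter> \<beta> = {}})\<^sup>2)"
    by (rule sum.mono_neutral_left) (use finA zero in \<open>simp_all add: Collect_mono\<close>)
  also have "\<dots> = (\<Sum>S\<in>?A. \<Sum>\<beta>\<in>\<C>. \<Sum>\<beta>'\<in>\<C>. if S \<inter> \<beta> = {} \<and> S \<inter> \<beta>' = {} then 1 else 0)"
    by (simp only: card_pairs_squared[OF finC])
  also have "\<dots> = (\<Sum>\<beta>\<in>\<C>. \<Sum>\<beta>'\<in>\<C>. \<Sum>S\<in>?A. if S \<inter> \<beta> = {} \<and> S \<inter> \<beta>' = {} then 1 else 0)"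
    by (rule sum_rotate)
  also have "\<dots> = (\<Sum>\<beta>\<in>\<C>. \<Sum>\<beta>'\<in>\<C>. (card Y - card (\<beta> \<union> \<beta>')) choose l)"
  proof (intro sum.cong refl)
    fix \<beta> \<beta>' assume "\<beta> \<in> \<C>" "\<beta>' \<in> \<C>"
    then have \<beta>: "\<beta> \<union> \<beta>' \<subseteq> Y" using C by auto
    have "(\<Sum>S\<in>?A. if S \<inter> \<beta> = {} \<and> S \<inter> \<beta>' = {} then 1 else 0) = card {S \<in> ?A. S \<inter> \<beta> = {} \<and> S \<inter> \<beta>' = {}}"
      by (rule sum_card_filter[OF finA(1)])
    also have "{S \<in> ?A. S \<inter> \<beta> = {} \<and> S \<inter> \<beta>' = {}} = {S. S \<subseteq> Y \<and> card S = l \<and> S \<inter> (\<beta> \<union> \<beta>') = {}}" by auto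
    finally show "(\<Sum>S\<in>?A. if S \<inter> \<beta> = {} \<and> S \<inter> \<beta>' = {} then 1 else 0) = (card Y - card (\<beta> \<union> \<beta>')) choose l"
      using card_subsets_disjoint[OF assms(1) \<beta>] by simp
  qed
  finally show ?thesis
    using cauchy_schwarz_nat[OF finA(2), of "\<lambda>S. card {\<beta> \<in> \<C>. S \<inter> \<beta> = {}}"] first by simp
qed

text \<open>The square counts pairs, and a random l-set contains both \<open>B x\<close> and
  \<open>B x'\<close> with probability at most the density \<open>l / card Y\<close> raised to the
  size of their union.\<close>

lemma covering_second_moment:
  assumes "finite Y" "finite A" and B: "\<And>x. x \<in> A \<Longrightarrow> B x \<subseteq> Y" and "l \<le> card Y"
  shows "real (\<Sum>T | T \<subseteq> Y \<and> card T = l. (card {x \<in> A. B x \<subseteq> T})\<^sup>2) \<le>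
    (\<Sum>x\<in>A. \<Sum>x'\<in>A. real (card Y choose l) * (real l / real (card Y)) ^ card (B x \<union> B x'))"
proof -
  let ?A = "{S. S \<subseteq> Y \<and> card S = l}"
  have finA: "finite ?A" using assms(1) by auto
  have "(\<Sum>T\<in>?A. (card {x \<in> A. B x \<subseteq> T})\<^sup>2)
      = (\<Sum>T\<in>?A. \<Sum>x\<in>A. \<Sum>x'\<in>A. if B x \<subseteq> T \<and> B x' \<subseteq> T then 1 else 0)"
    by (simp only: card_pairs_squared[OF assms(2)])
  also have "\<dots> = (\<Sum>x\<in>A. \<Sum>x'\<in>A. \<Sum>T\<in>?A. if B x \<subseteq> T \<and> B x' \<subseteq> T then 1 else 0)"
    by (rule sum_rotate)
  finally have "real (\<Sum>T\<in>?A. (card {x \<in> A. B x \<subseteq> T})\<^sup>2)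
      = (\<Sum>x\<in>A. \<Sum>x'\<in>A. real (\<Sum>T\<in>?A. if B x \<subseteq> T \<and> B x' \<subseteq> T then 1 else 0))" by simp
  also have "\<dots> \<le> (\<Sum>x\<in>A. \<Sum>x'\<in>A. real (card Y choose l) * (real l / real (card Y)) ^ card (B x \<union> B x'))"
  proof (intro sum_mono)
    fix x x' assume "x \<in> A" "x' \<in> A"
    then have I: "B x \<union> B x' \<subseteq> Y" using B by auto
    let ?i = "card (B x \<union> B x')"
    have "(\<Sum>T\<in>?A. if B x \<subseteq> T \<and> B x' \<subseteq> T then 1 else 0) = card {T \<in> ?A. B x \<subseteq> T \<and> B x' \<subseteq> T}"
      by (rule sum_card_filter[OF finA(1)])
    also have "{T \<in> ?A. B x \<subseteq> T \<and> B x' \<subseteq> T} = {T. T \<subseteq> Y \<and> card T = l \<and> B x \<union> B x' \<subseteq> T}" by auto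
    finally have eq: "(\<Sum>T\<in>?A. if B x \<subseteq> T \<and> B x' \<subseteq> T then 1 else 0)
      = card {T. T \<subseteq> Y \<and> card T = l \<and> B x \<union> B x' \<subseteq> T}" .
    show "real (\<Sum>T\<in>?A. if B x \<subseteq> T \<and> B x' \<subseteq> T then 1 else 0) \<le>
        real (card Y choose l) * (real l / real (card Y)) ^ ?i"
    proof (cases "?i \<le> l")
      case True
      show ?thesis
      \<comment> \<open>The quotient \<open>0 / 0\<close> is 0, so the empty Y is treated apart;
        there the exponent is 0 too, and \<open>0 ^ 0 = 1\<close>.\<close>
      proof (cases "card Y = 0")
        case True
        then have "Y = {}" using assms(1) by simp
        then have "card {T. T \<subseteq> Y \<and> card T = l \<and> B x \<union> B x' \<subseteq> T} \<le> card {{} :: 'a set}"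
          by (intro card_mono) auto
        then show ?thesis using assms(4) True I \<open>Y = {}\<close> unfolding eq by simp
      next
        case False
        then show ?thesis
          unfolding eq card_subsets_containing[OF assms(1) I True]
          using binomial_both_drop[OF True assms(4)] by (simp add: power_divide field_simps)
      qed
    next
      case False
      have "{T. T \<subseteq> Y \<and> card T = l \<and> B x \<union> B x' \<subseteq> T} = {}"
        using False assms(1) card_mono finite_subset by blast
      then show ?thesis unfolding eq by (simp only: card.empty) simp
    qed
  qed
  finally show ?thesis .
qed

lemma sum_binomial_le:
  assumes "2 * L \<le> N"
  shows "(\<Sum>i\<le>L. N choose i) \<le> (L + 1) * (N choose L)"
proof -
  have "(\<Sum>i\<le>L. N choose i) \<le> (\<Sum>i\<le>L. N choose L)"
    using assms by (intro sum_mono binomial_mono) auto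
  then show ?thesis by simp
qed

lemma card_bounded_subsets:
  assumes "finite Y"
  shows "card {S. S \<subseteq> Y \<and> card S \<le> L} = (\<Sum>i\<le>L. card Y choose i)"
proof -
  have "{S. S \<subseteq> Y \<and> card S \<le> L} = (\<Union>i\<le>L. {S. S \<subseteq> Y \<and> card S = i})" by auto
  also have "card \<dots> = (\<Sum>i\<le>L. card {S. S \<subseteq> Y \<and> card S = i})"
    by (rule card_UN_disjoint) (use assms in auto)
  finally show ?thesis using n_subsets[OF assms] by simp
qed

section \<open>Products of polynomials of low degree\<close>

text \<open>Products of the entries of \<open>cs\<close> with at most q of them left out. The
  entries left out stand for the factors that contribute a positive power of z; the others
  contribute their constant terms.\<close>

fun part_prods :: "('b \<Rightarrow> 'a::field) list \<Rightarrow> nat \<Rightarrow> ('b \<Rightarrow> 'a) set" where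
  "part_prods [] q = {\<lambda>_. 1}"
| "part_prods (c # cs) 0 = (\<lambda>\<pi> U. c U * \<pi> U) ` part_prods cs 0"
| "part_prods (c # cs) (Suc q) = (\<lambda>\<pi> U. c U * \<pi> U) ` part_prods cs (Suc q) \<union> part_prods cs q"

lemma finite_part_prods: "finite (part_prods cs q)"
  by (induction cs q rule: part_prods.induct) auto

text \<open>The recursion is that of binomial sums. A bound \<open>a ^ q * b ^ length cs\<close> is
  preserved as soon as \<open>b \<ge> 1 + 1 / a\<close>; the choice \<open>a = 2\<close>,
  \<open>b = 3 / 2\<close> is the one on which the final constants rest.\<close>

lemma card_part_prods: "real (card (part_prods cs q)) \<le> 2 ^ q * (3 / 2) ^ length cs"
proof (induction cs q rule: part_prods.induct)
  case (1 q)
  then show ?case by simp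
next
  case (2 c cs)
  have "real (card (part_prods (c # cs) 0)) \<le> real (card (part_prods cs 0))"
    by (simp add: card_image_le finite_part_prods)
  also have "\<dots> \<le> (3 / 2) ^ length cs" using 2 by simp
  also have "\<dots> \<le> (3 / 2) ^ length (c # cs)" by (rule power_increasing) auto
  finally show ?case by simp
next
  case (3 c cs q)
  have "card (part_prods (c # cs) (Suc q)) \<le> card (part_prods cs (Suc q)) + card (part_prods cs q)"
    using card_Un_le[of "(\<lambda>\<pi> U. c U * \<pi> U) ` part_prods cs (Suc q)" "part_prods cs q"]
      card_image_le[OF finite_part_prods[of cs "Suc q"], of "\<lambda>\<pi> U. c U * \<pi> U"] by simp
  then have "real (card (part_prods (c # cs) (Suc q))) \<le> real (card (part_prods cs (Suc q))) + real (card (part_prods cs q))"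
    by (simp only: of_nat_add[symmetric] of_nat_le_iff)
  also have "\<dots> \<le> 2 ^ Suc q * (3 / 2) ^ length cs + 2 ^ q * (3 / 2) ^ length cs"
    using 3 by (rule add_mono)
  also have "\<dots> = 2 ^ Suc q * (3 / 2) ^ length (c # cs)" by (simp add: algebra_simps)
  finally show ?case .
qed

lemma span_mult:
  fixes F G H :: "('b \<Rightarrow> 'a::field) set"
  assumes "f \<in> fun_vs.span F" "g \<in> fun_vs.span G"
    and FG: "\<And>x y. x \<in> F \<Longrightarrow> y \<in> G \<Longrightarrow> (\<lambda>U. x U * y U) \<in> fun_vs.span H"
  shows "(\<lambda>U. f U * g U) \<in> fun_vs.span H"
proof -
  have 1: "(\<lambda>U. x U * g U) \<in> fun_vs.span H" if "x \<in> F" for x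
    using assms(2)
  proof (induction rule: fun_vs.span_induct_alt)
    case base
    then show ?case using fun_vs.span_zero[of H] by (simp add: zero_fun_def)
  next
    case (step c y z)
    have "(\<lambda>U. x U * ((\<lambda>x. c * y x) + z) U) = (\<lambda>U. c * (\<lambda>U. x U * y U) U) + (\<lambda>U. x U * z U)"
      by (auto simp: fun_eq_iff algebra_simps)
    then show ?case using fun_vs.span_add[OF fun_vs.span_scale[OF FG[OF that step(1)], of c] step(2)]
      by (simp only:)
  qed
  show ?thesis using assms(1)
  proof (induction rule: fun_vs.span_induct_alt)
    case base
    then show ?case using fun_vs.span_zero[of H] by (simp add: zero_fun_def)
  next
    case (step c y z)
    have "(\<lambda>U. ((\<lambda>x. c * y x) + z) U * g U) = (\<lambda>U. c * (\<lambda>U. y U * g U) U) + (\<lambda>U. z U * g U)"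
      by (auto simp: fun_eq_iff algebra_simps)
    then show ?case using fun_vs.span_add[OF fun_vs.span_scale[OF 1[OF step(1)], of c] step(2)]
      by (simp only:)
  qed
qed

lemma span_sum_fun:
  fixes H :: "('b \<Rightarrow> 'a::field) set"
  assumes "\<And>i. i \<in> I \<Longrightarrow> (\<lambda>U. f i U) \<in> fun_vs.span H"
  shows "(\<lambda>U. \<Sum>i\<in>I. f i U) \<in> fun_vs.span H"
proof -
  have "(\<lambda>U. \<Sum>i\<in>I. f i U) = (\<Sum>i\<in>I. f i)" by (auto simp: fun_eq_iff sum_fun_apply)
  then show ?thesis using fun_vs.span_sum[of I f H] assms by simp
qed

lemma span_add_fun:
  fixes H :: "('b \<Rightarrow> 'a::field) set"
  assumes "f \<in> fun_vs.span H" "g \<in> fun_vs.span H"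
  shows "(\<lambda>U. f U + g U) \<in> fun_vs.span H"
  using fun_vs.span_add[OF assms] by (simp add: plus_fun_def)

text \<open>The spanning set of the circuit side for one product gate. Its elements depend on the
  constant terms \<open>cs\<close> but on no choice of X-variables.\<close>

definition shifted_products :: "'v set \<Rightarrow> ('v set \<Rightarrow> 'a::field) list \<Rightarrow> nat \<Rightarrow> nat \<Rightarrow> ('v set \<Rightarrow> 'a) set" where
  "shifted_products Y cs q s = (\<lambda>(\<pi>, S) U. \<pi> U * set_monomial S U) ` (part_prods cs q \<times> {S. S \<subseteq> Y \<and> card S \<le> s})"

lemma finite_shifted_products: "finite Y \<Longrightarrow> finite (shifted_products Y cs q s)"
  by (simp add: shifted_products_def finite_part_prods)

lemma card_shifted_products:
  assumes "finite Y"
  shows "real (card (shifted_products Y cs q s)) \<le> 2 ^ q * (3 / 2) ^ length cs * real (card {S. S \<subseteq> Y \<and> card S \<le> s})"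
proof -
  have "card (shifted_products Y cs q s) \<le> card (part_prods cs q) * card {S. S \<subseteq> Y \<and> card S \<le> s}"
    unfolding shifted_products_def using assms finite_part_prods
    by (intro order.trans[OF card_image_le] finite_cartesian_product) (auto simp: card_cartesian_product)
  then have "real (card (shifted_products Y cs q s)) \<le> real (card (part_prods cs q)) * real (card {S. S \<subseteq> Y \<and> card S \<le> s})"
    by (simp only: of_nat_mult[symmetric] of_nat_le_iff)
  also have "\<dots> \<le> 2 ^ q * (3 / 2) ^ length cs * real (card {S. S \<subseteq> Y \<and> card S \<le> s})"
    by (intro mult_right_mono card_part_prods) auto
  finally show ?thesis .
qed

definition monomial_span :: "'v set \<Rightarrow> nat \<Rightarrow> ('v set \<Rightarrow> 'a::field) set" where
  "monomial_span Y s = fun_vs.span (set_monomial ` {S. S \<subseteq> Y \<and> card S \<le> s})"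

lemma monomial_span_mono: "s \<le> s' \<Longrightarrow> f \<in> monomial_span Y s \<Longrightarrow> f \<in> monomial_span Y s'"
  unfolding monomial_span_def by (erule rev_subsetD) (intro fun_vs.span_mono image_mono, auto)

lemma monomial_span_mult:
  assumes "f \<in> monomial_span Y s" "g \<in> monomial_span Y s'"
  shows "(\<lambda>U. f U * g U) \<in> monomial_span Y (s + s')"
  using assms unfolding monomial_span_def
proof (rule span_mult)
  fix x y :: "'a set \<Rightarrow> 'b"
  assume "x \<in> set_monomial ` {S. S \<subseteq> Y \<and> card S \<le> s}" "y \<in> set_monomial ` {S. S \<subseteq> Y \<and> card S \<le> s'}"
  then obtain S S' where S: "S \<subseteq> Y" "card S \<le> s" "S' \<subseteq> Y" "card S' \<le> s'" "x = set_monomial S" "y = set_monomial S'"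
    by auto
  then have "card (S \<union> S') \<le> s + s'" using card_Un_le[of S S'] by simp
  then have "(set_monomial (S \<union> S') :: 'a set \<Rightarrow> 'b) \<in> set_monomial ` {S. S \<subseteq> Y \<and> card S \<le> s + s'}" using S by auto
  moreover have "(\<lambda>U. x U * y U) = set_monomial (S \<union> S')"
    by (simp add: S set_monomial_mult fun_eq_iff)
  ultimately show "(\<lambda>U. x U * y U) \<in> fun_vs.span (set_monomial ` {S. S \<subseteq> Y \<and> card S \<le> s + s'})"
    by (simp add: fun_vs.span_base)
qed

lemma shifted_products_mult:
  assumes "f \<in> monomial_span Y a" "g \<in> fun_vs.span (shifted_products Y cs q s)"
  shows "(\<lambda>U. f U * g U) \<in> fun_vs.span (shifted_products Y cs q (a + s))"
  using assms unfolding monomial_span_def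
proof (rule span_mult)
  fix x y :: "'a set \<Rightarrow> 'b"
  assume "x \<in> set_monomial ` {S. S \<subseteq> Y \<and> card S \<le> a}" "y \<in> shifted_products Y cs q s"
  then obtain S S' \<pi> where S: "S \<subseteq> Y" "card S \<le> a" "S' \<subseteq> Y" "card S' \<le> s" "x = set_monomial S"
    "y = (\<lambda>U. \<pi> U * set_monomial S' U)" "\<pi> \<in> part_prods cs q"
    unfolding shifted_products_def by auto
  then have "card (S \<union> S') \<le> a + s" using card_Un_le[of S S'] by simp
  moreover have "(\<lambda>U. x U * y U) = (\<lambda>U. \<pi> U * set_monomial (S \<union> S') U)"
    by (simp add: S set_monomial_mult[symmetric] fun_eq_iff)
  ultimately have "(\<lambda>U. x U * y U) \<in> shifted_products Y cs q (a + s)"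
    using S unfolding shifted_products_def by (auto intro!: image_eqI[of _ _ "(\<pi>, S \<union> S')"])
  then show "(\<lambda>U. x U * y U) \<in> fun_vs.span (shifted_products Y cs q (a + s))"
    by (simp add: fun_vs.span_base)
qed

text \<open>A family g of univariate polynomials: the second argument is the set of Y-variables that are
  set to 1, the first one selects the variables that are replaced by the indeterminate.\<close>

definition low_degree :: "'v set \<Rightarrow> ('i \<Rightarrow> 'v set \<Rightarrow> 'a::field poly) \<Rightarrow> nat \<Rightarrow> bool" where
  "low_degree Y g s \<longleftrightarrow> (\<forall>A m. (\<lambda>U. coeff (g A U) m) \<in> monomial_span Y s) \<and>
     (\<exists>c. \<forall>A U. coeff (g A U) 0 = c U)"

lemma low_degree_mono: "low_degree Y g s \<Longrightarrow> s \<le> s' \<Longrightarrow> low_degree Y g s'"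
  unfolding low_degree_def using monomial_span_mono by blast

lemma low_degree_const: "low_degree Y (\<lambda>A U. [:c:]) s"
proof -
  have "(\<lambda>U. coeff [:c:] m) \<in> monomial_span Y s" for m
  proof -
    have "set_monomial {} \<in> monomial_span Y s"
      unfolding monomial_span_def by (intro fun_vs.span_base) auto
    then have "(\<lambda>U. coeff [:c:] m * set_monomial {} U) \<in> monomial_span Y s"
      unfolding monomial_span_def by (rule fun_vs.span_scale)
    then show ?thesis by (simp add: set_monomial_def)
  qed
  then show ?thesis unfolding low_degree_def by auto
qed

lemma low_degree_sum_list:
  assumes "\<And>j. j \<in> set js \<Longrightarrow> low_degree Y (g j) s"
  shows "low_degree Y (\<lambda>A U. sum_list (map (\<lambda>j. g j A U) js)) s"
  using assms
proof (induction js)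
  case Nil
  then show ?case using low_degree_const[of Y 0 s] by simp
next
  case (Cons j js)
  from Cons.prems[of j] obtain c where g: "\<And>A m. (\<lambda>U. coeff (g j A U) m) \<in> monomial_span Y s" "\<And>A U. coeff (g j A U) 0 = c U"
    unfolding low_degree_def by auto
  from Cons obtain c' where h: "\<And>A m. (\<lambda>U. coeff (sum_list (map (\<lambda>j. g j A U) js)) m) \<in> monomial_span Y s"
    "\<And>A U. coeff (sum_list (map (\<lambda>j. g j A U) js)) 0 = c' U"
    unfolding low_degree_def by (auto simp del: coeff_0)
  show ?case unfolding low_degree_def
    using g h span_add_fun[OF g(1)[unfolded monomial_span_def] h(1)[unfolded monomial_span_def]]
    by (auto simp: monomial_span_def)
qed

text \<open>The constant term of a product is the product of the constant terms, so its independence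
  of A persists; the other coefficients are convolutions, whose degrees in Y add.\<close>

lemma low_degree_mult:
  assumes "low_degree Y g s" "low_degree Y h s'"
  shows "low_degree Y (\<lambda>A U. g A U * h A U) (s + s')"
proof -
  from assms obtain c c' where g: "\<And>A m. (\<lambda>U. coeff (g A U) m) \<in> monomial_span Y s" "\<And>A U. coeff (g A U) 0 = c U"
    and h: "\<And>A m. (\<lambda>U. coeff (h A U) m) \<in> monomial_span Y s'" "\<And>A U. coeff (h A U) 0 = c' U"
    unfolding low_degree_def by auto
  have "(\<lambda>U. coeff (g A U * h A U) m) \<in> monomial_span Y (s + s')" for A m
    unfolding coeff_mult
    using monomial_span_mult[OF g(1) h(1)] unfolding monomial_span_def by (intro span_sum_fun)
  moreover have "\<forall>A U. coeff (g A U * h A U) 0 = c U * c' U" by (simp add: coeff_mult g h)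
  ultimately show ?thesis
    unfolding low_degree_def by (intro conjI allI exI[of _ "\<lambda>U. c U * c' U"]) auto
qed

text \<open>Next-fit bin packing: any two consecutive groups have total weight more than t.\<close>

lemma low_degree_groups:
  assumes "\<And>j. j \<in> set js \<Longrightarrow> low_degree Y (g j) (w j) \<and> w j \<le> t"
  shows "\<exists>gs. length gs \<ge> 1 \<and> t * (length gs - 1) \<le> 2 * sum_list (map w js) \<and> (\<forall>h\<in>set gs. low_degree Y h t) \<and>
    (\<forall>A U. prod_list (map (\<lambda>j. g j A U) js) = prod_list (map (\<lambda>h. h A U) gs))"
proof -
  have "\<exists>h gs w0. w0 \<le> t \<and> low_degree Y h w0 \<and> t * length gs + w0 \<le> 2 * sum_list (map w js) \<and>
      (\<forall>h\<in>set gs. low_degree Y h t) \<and>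
      (\<forall>A U. prod_list (map (\<lambda>j. g j A U) js) = h A U * prod_list (map (\<lambda>h. h A U) gs))"
    using assms
  proof (induction js)
    case Nil
    show ?case
      by (rule exI[of _ "\<lambda>A U. [:1:]"], rule exI[of _ "[]"], rule exI[of _ 0])
         (use low_degree_const in auto)
  next
    case (Cons j js)
    then obtain h gs w0 where IH: "w0 \<le> t" "low_degree Y h w0" "t * length gs + w0 \<le> 2 * sum_list (map w js)"
      "\<forall>h\<in>set gs. low_degree Y h t"
      "\<And>A U. prod_list (map (\<lambda>j. g j A U) js) = h A U * prod_list (map (\<lambda>h. h A U) gs)"
      by (metis list.set_intros(2))
    have j: "low_degree Y (g j) (w j)" "w j \<le> t" using Cons.prems by auto
    show ?case
    proof (cases "w0 + w j \<le> t")
      case True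
      show ?thesis
        by (rule exI[of _ "\<lambda>A U. g j A U * h A U"], rule exI[of _ gs], rule exI[of _ "w j + w0"])
           (use IH True low_degree_mult[OF j(1) IH(2)] in \<open>auto simp: mult_ac\<close>)
    next
      \<comment> \<open>The open group h, of weight w0, is closed and \<open>g j\<close> opens a new
        one. As \<open>w0 + w j > t\<close>, the increase \<open>t + w j - w0\<close> of the left
        side is at most \<open>2 * w j\<close>.\<close>
      case False
      show ?thesis
        by (rule exI[of _ "g j"], rule exI[of _ "h # gs"], rule exI[of _ "w j"])
           (use IH False j low_degree_mono[OF IH(2,1)] in auto)
    qed
  qed
  then obtain h gs w0 where *: "w0 \<le> t" "low_degree Y h w0" "t * length gs + w0 \<le> 2 * sum_list (map w js)"
    "\<forall>h\<in>set gs. low_degree Y h t"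
    "\<And>A U. prod_list (map (\<lambda>j. g j A U) js) = h A U * prod_list (map (\<lambda>h. h A U) gs)" by blast
  show ?thesis
    by (rule exI[of _ "h # gs"]) (use * low_degree_mono[OF *(2,1)] in auto)
qed

text \<open>Expansion along the first factor. Its term of degree 0 in z is its constant term and
  leaves the budget q untouched. A term of degree \<open>i > 0\<close> has degree at most t in Y and
  uses one unit of the budget, which is affordable because the degree \<open>m - i\<close> left for
  the other factors drops as well. The list \<open>cs\<close> is chosen before q, m and A.\<close>

lemma coeff_prod_list_span:
  fixes gs :: "('i \<Rightarrow> 'v set \<Rightarrow> 'a::field poly) list"
  assumes "\<And>g. g \<in> set gs \<Longrightarrow> low_degree Y g t"
  shows "\<exists>cs. length cs = length gs \<and> (\<forall>q m A. m \<le> q \<longrightarrow>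
     (\<lambda>U. coeff (prod_list (map (\<lambda>g. g A U) gs)) m) \<in> fun_vs.span (shifted_products Y cs q (t * q)))"
  using assms
proof (induction gs)
  case Nil
  have "(\<lambda>U. coeff 1 m) \<in> fun_vs.span (shifted_products Y ([] :: ('v set \<Rightarrow> 'a) list) q (t * q))"
    for q m :: nat
  proof -
    have "(\<lambda>U. 1) \<in> shifted_products Y ([] :: ('v set \<Rightarrow> 'a) list) q (t * q)"
      unfolding shifted_products_def by (auto simp: set_monomial_def intro!: image_eqI[of _ _ "(\<lambda>_. 1, {})"])
    then have "(\<lambda>U. coeff 1 m * 1) \<in> fun_vs.span (shifted_products Y ([] :: ('v set \<Rightarrow> 'a) list) q (t * q))"
      by (intro fun_vs.span_scale fun_vs.span_base)
    then show ?thesis by simp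
  qed
  then show ?case by (intro exI[of _ "[]"]) (simp del: coeff_1)
next
  case (Cons g gs)
  from Cons obtain cs where cs: "length cs = length gs" "\<And>q m A. m \<le> q \<Longrightarrow>
     (\<lambda>U. coeff (prod_list (map (\<lambda>g. g A U) gs)) m) \<in> fun_vs.span (shifted_products Y cs q (t * q))"
    by (metis list.set_intros(2))
  from Cons.prems[of g] obtain c where g: "\<And>A m. (\<lambda>U. coeff (g A U) m) \<in> monomial_span Y t"
    "\<And>A U. coeff (g A U) 0 = c U"
    unfolding low_degree_def by auto
  have "(\<lambda>U. coeff (prod_list (map (\<lambda>g. g A U) (g # gs))) m) \<in> fun_vs.span (shifted_products Y (c # cs) q (t * q))"
    if "m \<le> q" for q m A
  proof -
    let ?R = "\<lambda>U. prod_list (map (\<lambda>g. g A U) gs)"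
    have "(\<lambda>U. coeff (g A U) i * coeff (?R U) (m - i)) \<in> fun_vs.span (shifted_products Y (c # cs) q (t * q))"
      if i: "i \<le> m" for i
    proof (cases "i = 0")
      case True
      have "(\<lambda>U. c U * coeff (?R U) m) \<in> fun_vs.span (shifted_products Y (c # cs) q (t * q))"
      proof (rule span_mult[of _ "{c}" _ "shifted_products Y cs q (t * q)"])
        show "c \<in> fun_vs.span {c}" by (simp add: fun_vs.span_base)
        show "(\<lambda>U. coeff (?R U) m) \<in> fun_vs.span (shifted_products Y cs q (t * q))" using cs(2) \<open>m \<le> q\<close> .
        fix x y assume x: "x \<in> {c}" and "y \<in> shifted_products Y cs q (t * q)"
        then obtain \<pi> S where y: "\<pi> \<in> part_prods cs q" "S \<subseteq> Y" "card S \<le> t * q" "y = (\<lambda>U. \<pi> U * set_monomial S U)"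
          unfolding shifted_products_def by auto
        have "(\<lambda>U. c U * \<pi> U) \<in> part_prods (c # cs) q" using y(1) by (cases q) auto
        then have "(\<lambda>U. x U * y U) \<in> shifted_products Y (c # cs) q (t * q)"
          using x y unfolding shifted_products_def
          by (auto intro!: image_eqI[of _ _ "(\<lambda>U. c U * \<pi> U, S)"] simp: mult.assoc)
        then show "(\<lambda>U. x U * y U) \<in> fun_vs.span (shifted_products Y (c # cs) q (t * q))"
          by (rule fun_vs.span_base)
      qed
      then show ?thesis using True g(2) by simp
    next
      case False
      then obtain q' where q': "q = Suc q'" using i \<open>m \<le> q\<close> by (cases q) auto
      have "m - i \<le> q'" using False i \<open>m \<le> q\<close> q' by linarith
      from shifted_products_mult[OF g(1) cs(2)[OF this], of A i A]
      have "(\<lambda>U. coeff (g A U) i * coeff (?R U) (m - i)) \<in> fun_vs.span (shifted_products Y cs q' (t + t * q'))" .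
      moreover have "shifted_products Y cs q' (t + t * q') \<subseteq> shifted_products Y (c # cs) q (t * q)"
        unfolding shifted_products_def q' by (intro image_mono) auto
      ultimately show ?thesis using fun_vs.span_mono by blast
    qed
    then have "(\<lambda>U. \<Sum>i\<le>m. coeff (g A U) i * coeff (?R U) (m - i)) \<in> fun_vs.span (shifted_products Y (c # cs) q (t * q))"
      by (intro span_sum_fun) auto
    then show ?thesis by (simp add: coeff_mult)
  qed
  then show ?case using cs(1) by (intro exI[of _ "c # cs"]) auto
qed

section \<open>Depth four circuits\<close>

lemma gate_poly_Sum:
  assumes "circuit_over V C" "i < length C" "C ! i = Sum js"
  shows "gate_poly C i = sum_list (map (gate_poly C) js)"
proof -
  have "\<forall>j\<in>set js. j < i" using assms unfolding circuit_over_def by (metis children.simps(3))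
  then have "filter (\<lambda>j. j < i) js = js" by (simp add: filter_id_conv)
  then show ?thesis by (subst gate_poly.simps) (simp add: assms(3))
qed

lemma gate_poly_Prod:
  assumes "circuit_over V C" "i < length C" "C ! i = Prod js"
  shows "gate_poly C i = prod_list (map (gate_poly C) js)"
proof -
  have "\<forall>j\<in>set js. j < i" using assms unfolding circuit_over_def by (metis children.simps(4))
  then have "filter (\<lambda>j. j < i) js = js" by (simp add: filter_id_conv)
  then show ?thesis by (subst gate_poly.simps) (simp add: assms(3))
qed

lemma gate_formal_degree_Sum:
  assumes "circuit_over V C" "i < length C" "C ! i = Sum js" "j \<in> set js"
  shows "gate_formal_degree C j \<le> gate_formal_degree C i"
proof -
  have "\<forall>j\<in>set js. j < i" using assms unfolding circuit_over_def by (metis children.simps(3))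
  then have "filter (\<lambda>j. j < i) js = js" by (simp add: filter_id_conv)
  then have "gate_formal_degree C i = Max (set (0 # map (gate_formal_degree C) js))"
    by (subst gate_formal_degree.simps) (simp add: assms(3))
  then show ?thesis using assms(4) by (auto intro!: Max_ge)
qed

lemma gate_formal_degree_Prod:
  assumes "circuit_over V C" "i < length C" "C ! i = Prod js"
  shows "gate_formal_degree C i = sum_list (map (gate_formal_degree C) js)"
proof -
  have "\<forall>j\<in>set js. j < i" using assms unfolding circuit_over_def by (metis children.simps(4))
  then have "filter (\<lambda>j. j < i) js = js" by (simp add: filter_id_conv)
  then show ?thesis by (subst gate_formal_degree.simps) (simp add: assms(3))
qed

text \<open>A set, not a multiset: repeated Y-variables make no difference on the cube, and both the
  survival of a product gate and its degree in Y refer to distinct variables.\<close>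

definition product_vars :: "('v, 'a) circuit \<Rightarrow> nat list \<Rightarrow> 'v set" where
  "product_vars C js = {v. \<exists>j\<in>set js. C ! j = Var v}"

lemma product_vars_Cons:
  "product_vars C (j # js) = (case C ! j of Var v \<Rightarrow> insert v (product_vars C js) | _ \<Rightarrow> product_vars C js)"
  by (auto simp: product_vars_def split: gate.split)

lemma card_product_vars:
  "finite (product_vars C js) \<and> card (product_vars C js) \<le> sum_list (map (gate_formal_degree C) js)"
proof (induction js)
  case Nil
  then show ?case by (simp add: product_vars_def)
next
  case (Cons j js)
  show ?case
  proof (cases "C ! j")
    case (Var v)
    then have "gate_formal_degree C j = 1" by (subst gate_formal_degree.simps) simp
    then show ?thesis using Cons Var by (auto simp: product_vars_Cons card_insert_if)
  qed (use Cons in \<open>auto simp: product_vars_Cons\<close>)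
qed

text \<open>On the cube a product of leaves splits into the monomial of its distinct Y-variables and
  a polynomial E in z that depends on A only. The constant term of E does not even depend on A,
  because \<zeta> does not.\<close>

lemma leaf_product_eval:
  fixes \<theta> :: "'i \<Rightarrow> 'v set \<Rightarrow> 'v \<Rightarrow> 'a::field poly"
  assumes \<theta>Y: "\<And>A U v. v \<in> Y \<Longrightarrow> \<theta> A U v = [:set_monomial {v} U:]"
    and \<theta>: "\<And>A U v. v \<in> V - Y \<Longrightarrow> \<theta> A U v = \<eta> A v" "\<And>A v. v \<in> V - Y \<Longrightarrow> coeff (\<eta> A v) 0 = \<zeta> v"
    and leaf: "\<And>j. j \<in> set js \<Longrightarrow> (\<exists>v\<in>V. C ! j = Var v) \<or> (\<exists>c. C ! j = Const c)"
  shows "\<exists>E e. (\<forall>A U. prod_list (map (\<lambda>j. hom_eval (\<lambda>x. [:x:]) (\<theta> A U) (gate_poly C j)) js) =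
      smult (set_monomial (product_vars C js \<inter> Y) U) (E A)) \<and> (\<forall>A. coeff (E A) 0 = e)"
  using leaf
proof (induction js)
  case Nil
  show ?case by (intro exI[of _ "\<lambda>_. 1"] exI[of _ 1]) (auto simp: product_vars_def set_monomial_def)
next
  case (Cons j js)
  then obtain E e where E: "\<And>A U. prod_list (map (\<lambda>j. hom_eval (\<lambda>x. [:x:]) (\<theta> A U) (gate_poly C j)) js) =
      smult (set_monomial (product_vars C js \<inter> Y) U) (E A)" "\<And>A. coeff (E A) 0 = e"
    by (metis list.set_intros(2))
  consider v where "C ! j = Var v" "v \<in> Y" | v where "C ! j = Var v" "v \<in> V - Y" | c where "C ! j = Const c"
    using Cons.prems[of j] by auto
  then show ?case
  proof cases
    case 1
    then have "hom_eval (\<lambda>x. [:x:]) (\<theta> A U) (gate_poly C j) = [:set_monomial {v} U:]" for A U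
      by (subst gate_poly.simps) (simp add: const_hom.hom_eval_mvar \<theta>Y)
    moreover have "product_vars C (j # js) \<inter> Y = {v} \<union> (product_vars C js \<inter> Y)"
      using 1 by (auto simp: product_vars_Cons)
    ultimately show ?thesis using E
      by (intro exI[of _ E] exI[of _ e]) (simp add: set_monomial_mult Un_commute mult.commute)
  next
    case 2
    then have "hom_eval (\<lambda>x. [:x:]) (\<theta> A U) (gate_poly C j) = \<eta> A v" for A U
      by (subst gate_poly.simps) (simp add: const_hom.hom_eval_mvar \<theta>)
    moreover have "product_vars C (j # js) \<inter> Y = product_vars C js \<inter> Y"
      using 2 by (auto simp: product_vars_Cons)
    ultimately show ?thesis using E \<theta>(2)[OF 2(2)]
      by (intro exI[of _ "\<lambda>A. \<eta> A v * E A"] exI[of _ "\<zeta> v * e"]) (simp add: coeff_mult)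
  next
    case 3
    then have "hom_eval (\<lambda>x. [:x:]) (\<theta> A U) (gate_poly C j) = [:c:]" for A U
      by (subst gate_poly.simps) (simp add: const_hom.hom_eval_mconst)
    moreover have "product_vars C (j # js) \<inter> Y = product_vars C js \<inter> Y"
      using 3 by (auto simp: product_vars_Cons)
    ultimately show ?thesis using E
      by (intro exI[of _ "\<lambda>A. [:c:] * E A"] exI[of _ "c * e"]) (simp add: mult.commute)
  qed
qed

lemma span_sum_list_fun:
  fixes H :: "('b \<Rightarrow> 'a::field) set"
  assumes "\<And>i. i \<in> set is \<Longrightarrow> (\<lambda>U. f i U) \<in> fun_vs.span H"
  shows "(\<lambda>U. \<Sum>i\<leftarrow>is. f i U) \<in> fun_vs.span H"
  using assms
proof (induction "is")
  case Nil
  then show ?case using fun_vs.span_zero[of H] by (simp add: zero_fun_def)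
qed (use span_add_fun in auto)

lemma coeff_sum_list: "coeff (sum_list ps) m = (\<Sum>p\<leftarrow>ps. coeff p m)"
  by (induction ps) auto

text \<open>Each product gate below the output has its own list of constant terms, whence the factor
  \<open>length C\<close>; grouping its factors leaves a list of length at most
  \<open>2 * d div t + 1\<close>. G is found before A and S, which is essential, since the rank
  argument uses all of them at once.\<close>

lemma depth_four_span:
  fixes \<theta> :: "'i \<Rightarrow> 'v set \<Rightarrow> 'v \<Rightarrow> 'a::field poly" and C :: "('v, 'a) circuit"
  assumes C: "circuit_over V C" "depth_four C" "formal_degree C \<le> d" and "t > 0" "finite Y"
    and \<theta>Y: "\<And>A U v. v \<in> Y \<Longrightarrow> \<theta> A U v = [:set_monomial {v} U:]"
    and \<theta>: "\<And>A U v. v \<in> V - Y \<Longrightarrow> \<theta> A U v = \<eta> A v" "\<And>A v. v \<in> V - Y \<Longrightarrow> coeff (\<eta> A v) 0 = \<zeta> v"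
    and support: "\<And>i js. i < length C \<Longrightarrow> C ! i = Prod js \<Longrightarrow>
      (\<exists>v\<in>product_vars C js. \<forall>A U. \<theta> A U v = 0) \<or> card (product_vars C js \<inter> Y) \<le> t"
  shows "\<exists>G. finite G \<and> real (card G) \<le> real (length C) * (2 ^ q * (3 / 2) ^ (2 * d div t + 1)) *
      real (\<Sum>i\<le>l + t * q. card Y choose i) \<and>
    (\<forall>A S. (\<forall>U. degree (hom_eval (\<lambda>x. [:x:]) (\<theta> A U) (circuit_poly C)) \<le> q) \<longrightarrow> S \<subseteq> Y \<longrightarrow> card S = l \<longrightarrow>
      (\<lambda>U. set_monomial S U * poly (hom_eval (\<lambda>x. [:x:]) (\<theta> A U) (circuit_poly C)) 1) \<in> fun_vs.span G)"
proof -
  define val where "val j A U = hom_eval (\<lambda>x. [:x:]) (\<theta> A U) (gate_poly C j)" for j A U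
  define out where "out = output_node C"
  have out: "out < length C" using C(1) by (auto simp: out_def output_node_def circuit_over_def)
  have bound: "j < length C" if "i < length C" "j \<in> set (children (C ! i))" for i j
    using C(1) that unfolding circuit_over_def by (meson order.strict_trans)
  obtain os where os: "C ! out = Sum os" using C(2) by (auto simp: depth_four_def Let_def out_def)
  have L1: "i < length C \<and> (\<exists>js. C ! i = Prod js)" if "i \<in> set os" for i
    using C(2) that os bound[OF out, of i] unfolding depth_four_def Let_def nodes_below_def out_def[symmetric] by auto
  have L2: "i < length C \<and> (\<exists>js. C ! i = Sum js)" if "i0 \<in> set os" "i \<in> set (children (C ! i0))" for i0 i
    using C(2) that os bound[OF conjunct1[OF L1[OF that(1)]] that(2)]
    unfolding depth_four_def Let_def nodes_below_def out_def[symmetric] by auto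
  have L3: "i < length C \<and> (\<exists>js. C ! i = Prod js)"
    if "i0 \<in> set os" "i1 \<in> set (children (C ! i0))" "i \<in> set (children (C ! i1))" for i0 i1 i
    using C(2) that os bound[OF conjunct1[OF L2[OF that(1,2)]] that(3)]
    unfolding depth_four_def Let_def nodes_below_def out_def[symmetric] by auto
  have L4: "(\<exists>v\<in>V. C ! i = Var v) \<or> (\<exists>c. C ! i = Const c)"
    if "i0 \<in> set os" "i1 \<in> set (children (C ! i0))" "i2 \<in> set (children (C ! i1))" "i \<in> set (children (C ! i2))" for i0 i1 i2 i
  proof -
    have len: "i < length C" using bound[OF conjunct1[OF L3[OF that(1-3)]] that(4)] .
    have "(\<exists>v. C ! i = Var v) \<or> (\<exists>c. C ! i = Const c)"
      using C(2) that os unfolding depth_four_def Let_def nodes_below_def out_def[symmetric] by auto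
    moreover have "v \<in> V" if "C ! i = Var v" for v
      using C(1) len that nth_mem[OF len] unfolding circuit_over_def by metis
    ultimately show ?thesis by blast
  qed
  have val_Sum: "val i A U = sum_list (map (\<lambda>j. val j A U) js)" if "i < length C" "C ! i = Sum js" for i js A U
    by (simp add: val_def gate_poly_Sum[OF C(1) that] const_hom.hom_eval_sum_list comp_def)
  have val_Prod: "val i A U = prod_list (map (\<lambda>j. val j A U) js)" if "i < length C" "C ! i = Prod js" for i js A U
    by (simp add: val_def gate_poly_Prod[OF C(1) that] const_hom.hom_eval_prod_list comp_def)
  \<comment> \<open>The weight of a gate is capped twice: by t, so that it fits into a group, and by
    the formal degree, so that the weights below a product gate add up to at most d.\<close>
  have low3: "low_degree Y (val i) (min t (gate_formal_degree C i))"
    if i: "i0 \<in> set os" "i1 \<in> set (children (C ! i0))" "i \<in> set (children (C ! i1))" for i0 i1 i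
  proof -
    obtain js where js: "i < length C" "C ! i = Prod js" using L3[OF i] by auto
    have "\<And>j. j \<in> set js \<Longrightarrow> (\<exists>v\<in>V. C ! j = Var v) \<or> (\<exists>c. C ! j = Const c)" using L4[OF i] js by auto
    from leaf_product_eval[of Y \<theta> V \<eta> \<zeta>, OF \<theta>Y \<theta> this]
    obtain E e where E: "\<And>A U. prod_list (map (\<lambda>j. val j A U) js) =
      smult (set_monomial (product_vars C js \<inter> Y) U) (E A)" "\<And>A. coeff (E A) 0 = e"
      unfolding val_def by blast
    have val: "val i A U = smult (set_monomial (product_vars C js \<inter> Y) U) (E A)" for A U
      by (simp add: val_Prod[OF js] E)
    have fd: "card (product_vars C js \<inter> Y) \<le> gate_formal_degree C i"
      using card_product_vars[of C js] card_mono[of "product_vars C js" "product_vars C js \<inter> Y"]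
      by (simp add: gate_formal_degree_Prod[OF C(1) js])
    from support[OF js] show ?thesis
    proof
      assume "\<exists>v\<in>product_vars C js. \<forall>A U. \<theta> A U v = 0"
      then obtain v j where v: "j \<in> set js" "C ! j = Var v" "\<And>A U. \<theta> A U v = 0"
        by (auto simp: product_vars_def)
      have "val j A U = 0" for A U
        unfolding val_def by (subst gate_poly.simps) (simp add: v const_hom.hom_eval_mvar)
      then have "val i = (\<lambda>A U. [:0:])"
        using v(1) by (auto simp: val_Prod[OF js] fun_eq_iff prod_list_zero_iff image_iff)
      then show ?thesis using low_degree_const by metis
    next
      assume "card (product_vars C js \<inter> Y) \<le> t"
      then have c: "card (product_vars C js \<inter> Y) \<le> min t (gate_formal_degree C i)" using fd by simp
      have "(\<lambda>U. coeff (val i A U) m) \<in> monomial_span Y (min t (gate_formal_degree C i))" for A m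
      proof -
        have "(\<lambda>U. coeff (E A) m * set_monomial (product_vars C js \<inter> Y) U) \<in> monomial_span Y (min t (gate_formal_degree C i))"
          unfolding monomial_span_def by (intro fun_vs.span_scale fun_vs.span_base) (use c in auto)
        then show ?thesis by (simp add: val mult.commute)
      qed
      then show ?thesis unfolding low_degree_def
        by (intro conjI allI exI[of _ "\<lambda>U. set_monomial (product_vars C js \<inter> Y) U * e"]) (auto simp: val E)
    qed
  qed
  have low2: "low_degree Y (val i) (min t (gate_formal_degree C i))"
    if i: "i0 \<in> set os" "i \<in> set (children (C ! i0))" for i0 i
  proof -
    obtain js where js: "i < length C" "C ! i = Sum js" using L2[OF i] by auto
    have "low_degree Y (\<lambda>A U. sum_list (map (\<lambda>j. val j A U) js)) (min t (gate_formal_degree C i))"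
    proof (rule low_degree_sum_list)
      fix j assume j: "j \<in> set js"
      then have "low_degree Y (val j) (min t (gate_formal_degree C j))" using low3[OF i] js by auto
      then show "low_degree Y (val j) (min t (gate_formal_degree C i))"
        by (rule low_degree_mono) (use gate_formal_degree_Sum[OF C(1) js j] in auto)
    qed
    then show ?thesis by (simp add: val_Sum[OF js, symmetric])
  qed
  have "\<exists>cs. length cs \<le> 2 * d div t + 1 \<and> (\<forall>m A. m \<le> q \<longrightarrow>
     (\<lambda>U. coeff (val i A U) m) \<in> fun_vs.span (shifted_products Y cs q (t * q)))" if i: "i \<in> set os" for i
  proof -
    obtain js where js: "i < length C" "C ! i = Prod js" using L1[OF i] by auto
    have "\<exists>gs. length gs \<ge> 1 \<and>
      t * (length gs - 1) \<le> 2 * sum_list (map (\<lambda>j. min t (gate_formal_degree C j)) js) \<and>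
      (\<forall>h\<in>set gs. low_degree Y h t) \<and>
      (\<forall>A U. prod_list (map (\<lambda>j. val j A U) js) = prod_list (map (\<lambda>h. h A U) gs))"
      by (rule low_degree_groups) (use low2[OF i] js in auto)
    then obtain gs where gs0: "length gs \<ge> 1 \<and>
      t * (length gs - 1) \<le> 2 * sum_list (map (\<lambda>j. min t (gate_formal_degree C j)) js) \<and>
      (\<forall>h\<in>set gs. low_degree Y h t) \<and>
      (\<forall>A U. prod_list (map (\<lambda>j. val j A U) js) = prod_list (map (\<lambda>h. h A U) gs))" by (elim exE)
    note gs = conjunct1[OF gs0] conjunct1[OF conjunct2[OF gs0]]
      bspec[OF conjunct1[OF conjunct2[OF conjunct2[OF gs0]]]]
      spec[OF spec[OF conjunct2[OF conjunct2[OF conjunct2[OF gs0]]]]]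
    have "sum_list (map (\<lambda>j. min t (gate_formal_degree C j)) js) \<le> gate_formal_degree C i"
      unfolding gate_formal_degree_Prod[OF C(1) js] by (rule sum_list_mono) auto
    also have "\<dots> \<le> d" using gate_formal_degree_Sum[OF C(1) out os i] C(3) by (simp add: formal_degree_def out_def)
    finally have "t * (length gs - 1) \<le> 2 * d" using gs(2) by linarith
    then have "length gs - 1 \<le> 2 * d div t"
      using \<open>t > 0\<close> by (simp add: less_eq_div_iff_mult_less_eq mult.commute)
    then have len: "length gs \<le> 2 * d div t + 1" by linarith
    from coeff_prod_list_span[OF gs(3)] obtain cs where cs: "length cs = length gs"
      "\<And>q m A. m \<le> q \<Longrightarrow> (\<lambda>U. coeff (prod_list (map (\<lambda>g. g A U) gs)) m) \<in> fun_vs.span (shifted_products Y cs q (t * q))"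
      by blast
    show ?thesis
      by (rule exI[of _ cs]) (use cs len in \<open>simp add: val_Prod[OF js] gs(4)\<close>)
  qed
  then obtain cs where cs: "\<And>i. i \<in> set os \<Longrightarrow> length (cs i) \<le> 2 * d div t + 1"
    "\<And>i m A. i \<in> set os \<Longrightarrow> m \<le> q \<Longrightarrow> (\<lambda>U. coeff (val i A U) m) \<in> fun_vs.span (shifted_products Y (cs i) q (t * q))"
    by metis
  define G where "G = (\<Union>i\<in>set os. shifted_products Y (cs i) q (l + t * q))"
  have finG: "finite G" unfolding G_def using finite_shifted_products[OF \<open>finite Y\<close>] by auto
  have card_os: "card (set os) \<le> length C"
  proof -
    have "set os \<subseteq> {..<length C}" using L1 by auto
    then show ?thesis using card_mono[of "{..<length C}" "set os"] by simp
  qed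
  let ?B = "2 ^ q * (3 / 2) ^ (2 * d div t + 1) * real (\<Sum>i\<le>l + t * q. card Y choose i)"
  have "real (card G) \<le> real (\<Sum>i\<in>set os. card (shifted_products Y (cs i) q (l + t * q)))"
    unfolding G_def by (simp only: of_nat_le_iff) (rule card_UN_le, simp)
  also have "\<dots> \<le> (\<Sum>i\<in>set os. ?B)"
    unfolding of_nat_sum
  proof (rule sum_mono)
    fix i assume i: "i \<in> set os"
    have "real (card (shifted_products Y (cs i) q (l + t * q))) \<le>
        2 ^ q * (3 / 2) ^ length (cs i) * real (\<Sum>i\<le>l + t * q. card Y choose i)"
      using card_shifted_products[OF \<open>finite Y\<close>, of "cs i" q "l + t * q"]
      by (simp only: card_bounded_subsets[OF \<open>finite Y\<close>])
    also have "\<dots> \<le> ?B"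
      by (intro mult_right_mono mult_left_mono power_increasing cs(1)[OF i])
        (simp_all only: of_nat_0_le_iff, auto)
    finally show "real (card (shifted_products Y (cs i) q (l + t * q))) \<le> 2 ^ q * (3 / 2) ^ (2 * d div t + 1) *
      (\<Sum>i\<le>l + t * q. real (card Y choose i))" by simp
  qed
  also have "\<dots> \<le> real (length C) * ?B"
    unfolding sum_constant
  proof (rule mult_right_mono)
    show "0 \<le> ?B" by (intro mult_nonneg_nonneg) (simp_all only: of_nat_0_le_iff zero_le_power zero_le_numeral divide_nonneg_nonneg)
  qed (use card_os in simp)
  finally have cardG: "real (card G) \<le> real (length C) * ?B" .
  have "(\<lambda>U. set_monomial S U * poly (val out A U) 1) \<in> fun_vs.span G"
    if deg: "\<And>U. degree (val out A U) \<le> q" and S: "S \<subseteq> Y" "card S = l" for A S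
  proof -
    \<comment> \<open>Inner gates may have a degree in z beyond q. The output does not, so its value
      at 1 is the sum of its coefficients up to q, and the same coefficients suffice at every
      product gate: the higher ones cancel in the sum.\<close>
    have "poly (val out A U) 1 = (\<Sum>m\<le>q. coeff (val out A U) m)" for U
    proof -
      have "poly (val out A U) 1 = (\<Sum>m\<le>degree (val out A U). coeff (val out A U) m)" by (simp add: poly_altdef)
      also have "\<dots> = (\<Sum>m\<le>q. coeff (val out A U) m)"
        by (rule sum.mono_neutral_left) (use deg in \<open>auto simp: coeff_eq_0 not_le\<close>)
      finally show ?thesis .
    qed
    moreover have "coeff (val out A U) m = (\<Sum>i\<leftarrow>os. coeff (val i A U) m)" for U m
      by (simp add: val_Sum[OF out os] coeff_sum_list comp_def)
    ultimately have eq: "set_monomial S U * poly (val out A U) 1 =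
      (\<Sum>m\<in>{..q}. \<Sum>i\<leftarrow>os. set_monomial S U * coeff (val i A U) m)" for U
      by (simp add: sum_distrib_left sum_list_const_mult)
    show ?thesis unfolding eq
    proof (intro span_sum_fun span_sum_list_fun)
      fix m i assume m: "m \<in> {..q}" and i: "i \<in> set os"
      have "set_monomial S \<in> monomial_span Y l"
        unfolding monomial_span_def using S by (intro fun_vs.span_base) auto
      from shifted_products_mult[OF this cs(2)[OF i, of m A]] m
      have "(\<lambda>U. set_monomial S U * coeff (val i A U) m) \<in> fun_vs.span (shifted_products Y (cs i) q (l + t * q))"
        by simp
      moreover have "shifted_products Y (cs i) q (l + t * q) \<subseteq> G" using i unfolding G_def by blast
      ultimately show "(\<lambda>U. set_monomial S U * coeff (val i A U) m) \<in> fun_vs.span G"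
        using fun_vs.span_mono by blast
    qed
  qed
  then show ?thesis using finG cardG unfolding val_def circuit_poly_def out_def[symmetric]
    by (intro exI[of _ G]) (auto simp: mult.assoc)
qed

section \<open>Walks in layered graphs with random labels\<close>

text \<open>A code assigns a value to every coordinate. Coordinate x is remembered by the layers
  \<open>lo x, \<dots>, hi x\<close> of a layered graph: a vertex of layer j is an assignment of values to the coordinates
  remembered at layer j, so that the walks through consistent vertices are exactly the codes.\<close>

locale windowed_walks =
  fixes n d h M :: nat and I :: "'c set" and R :: "'c \<Rightarrow> nat" and lo hi :: "'c \<Rightarrow> nat"
    and enc :: "nat \<Rightarrow> ('c \<Rightarrow> nat) \<Rightarrow> nat" and marked :: "nat set" and at_target :: "nat \<Rightarrow> bool"
  assumes finI: "finite I" and d: "d \<ge> 1" and h: "h \<ge> 1" and Mh: "M * h \<le> n" and M: "M \<ge> 1"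
    and lo: "\<And>x. x \<in> I \<Longrightarrow> 1 \<le> lo x \<and> lo x \<le> hi x \<and> hi x < d"
    and enc: "\<And>j. inj_on (enc j) (PiE {x \<in> I. lo x \<le> j \<and> j \<le> hi x} (\<lambda>x. {..<R x}))"
      "\<And>j. enc j ` (PiE {x \<in> I. lo x \<le> j \<and> j \<le> hi x} (\<lambda>x. {..<R x})) \<subseteq> {..<M}"
    and marked: "\<And>j. j \<in> marked \<Longrightarrow> 1 \<le> j \<and> j \<le> d"
    and target: "\<And>j x. j \<in> marked \<Longrightarrow> at_target j \<Longrightarrow> x \<in> I \<Longrightarrow> lo x \<le> j - 1 \<Longrightarrow> j - 1 \<le> hi x \<Longrightarrow> j \<le> hi x"
      "\<And>j. j \<in> marked \<Longrightarrow> at_target j \<Longrightarrow> j < d"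
    and source: "\<And>j x. j \<in> marked \<Longrightarrow> \<not> at_target j \<Longrightarrow> x \<in> I \<Longrightarrow> lo x \<le> j \<Longrightarrow> j \<le> hi x \<Longrightarrow> lo x \<le> j - 1"
      "\<And>j. j \<in> marked \<Longrightarrow> \<not> at_target j \<Longrightarrow> j > 1"
begin

definition window :: "nat \<Rightarrow> 'c set" where "window j = {x \<in> I. lo x \<le> j \<and> j \<le> hi x}"
definition codes :: "('c \<Rightarrow> nat) set" where "codes = PiE I (\<lambda>x. {..<R x})"
definition vertex :: "nat \<Rightarrow> ('c \<Rightarrow> nat) \<Rightarrow> ('c \<Rightarrow> nat)" where "vertex j c = restrict c (window j)"
definition labelings :: "(nat \<times> nat \<Rightarrow> nat) set" where
  "labelings = PiE ({1..<d} \<times> {..<M}) (\<lambda>_. {..<h})"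
text \<open>Vertex number e of a layer owns the h indices from \<open>e * h + 1\<close> to
  \<open>e * h + h\<close>, and \<rho> selects one of them. Hence different vertices never collide,
  and an index reveals both the vertex and its random label. The two end points carry the index 1
  that \<open>IMM\<close> prescribes.\<close>

definition label :: "(nat \<times> nat \<Rightarrow> nat) \<Rightarrow> nat \<Rightarrow> ('c \<Rightarrow> nat) \<Rightarrow> nat" where
  "label \<rho> j c = (if j = 0 \<or> j = d then 1 else 1 + enc j (vertex j c) * h + \<rho> (j, enc j (vertex j c)))"
definition edge :: "(nat \<times> nat \<Rightarrow> nat) \<Rightarrow> nat \<Rightarrow> ('c \<Rightarrow> nat) \<Rightarrow> imm_var" where
  "edge \<rho> j c = (j, label \<rho> (j - 1) c, label \<rho> j c)"
definition edges :: "(nat \<times> nat \<Rightarrow> nat) \<Rightarrow> nat set \<Rightarrow> imm_var set" where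
  "edges \<rho> J = {edge \<rho> j c | j c. j \<in> J \<and> c \<in> codes}"

lemma finite_codes: "finite codes"
  unfolding codes_def using finI by (intro finite_PiE) auto

lemma finite_edges: "finite J \<Longrightarrow> finite (edges \<rho> J)"
proof -
  assume "finite J"
  have "edges \<rho> J = (\<lambda>(j, c). edge \<rho> j c) ` (J \<times> codes)" unfolding edges_def by auto
  then show ?thesis using \<open>finite J\<close> finite_codes by simp
qed

section \<open>Vertices, labels and edges of the layered graph\<close>

lemma vertex_eq_iff: "vertex j c = vertex j c' \<longleftrightarrow> (\<forall>x\<in>window j. c x = c' x)"
  by (auto simp: vertex_def restrict_def fun_eq_iff)

lemma vertex_PiE: "c \<in> codes \<Longrightarrow> vertex j c \<in> PiE (window j) (\<lambda>x. {..<R x})"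
  by (auto simp: vertex_def codes_def window_def)

lemma window_ends: "window 0 = {}" "window d = {}"
  using lo by (force simp: window_def)+

lemma enc_vertex_less: "c \<in> codes \<Longrightarrow> enc j (vertex j c) < M"
  using enc(2)[of j] vertex_PiE[of c j] by (auto simp: window_def)

lemma enc_vertex_eq: "c \<in> codes \<Longrightarrow> c' \<in> codes \<Longrightarrow> enc j (vertex j c) = enc j (vertex j c') \<longleftrightarrow> vertex j c = vertex j c'"
  using enc(1)[of j] vertex_PiE[of c j] vertex_PiE[of c' j] by (auto simp: window_def dest: inj_onD)

lemma labeling_less: "\<rho> \<in> labelings \<Longrightarrow> 1 \<le> j \<Longrightarrow> j < d \<Longrightarrow> c \<in> codes \<Longrightarrow> \<rho> (j, enc j (vertex j c)) < h"
  using enc_vertex_less[of c j] unfolding labelings_def by (auto dest!: PiE_mem)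

lemma label_decode:
  assumes "\<rho> \<in> labelings" "1 \<le> j" "j < d" "c \<in> codes"
  shows "label \<rho> j c \<ge> 1" "(label \<rho> j c - 1) div h = enc j (vertex j c)"
    "(label \<rho> j c - 1) mod h = \<rho> (j, enc j (vertex j c))"
  using labeling_less[OF assms] assms h by (auto simp: label_def)

lemma label_range:
  assumes "\<rho> \<in> labelings" "j \<le> d" "c \<in> codes"
  shows "label \<rho> j c \<in> {1..n}"
proof (cases "j = 0 \<or> j = d")
  case True
  have "1 * 1 \<le> M * h" using M h by (intro mult_le_mono)
  then have "1 \<le> n" using Mh by linarith
  then show ?thesis using True by (auto simp: label_def)
next
  case False
  then have "\<rho> (j, enc j (vertex j c)) < h" using labeling_less[of \<rho> j c] assms by auto
  moreover have "(enc j (vertex j c) + 1) * h \<le> M * h"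
    using enc_vertex_less[OF assms(3), of j] by (intro mult_le_mono1) simp
  ultimately show ?thesis using False Mh by (auto simp: label_def)
qed

lemma label_eq_iff:
  assumes "\<rho> \<in> labelings" "j \<le> d" "c \<in> codes" "c' \<in> codes"
  shows "label \<rho> j c = label \<rho> j c' \<longleftrightarrow> vertex j c = vertex j c'"
proof (cases "j = 0 \<or> j = d")
  case True
  then show ?thesis using window_ends by (auto simp: label_def vertex_eq_iff)
next
  case False
  then have j: "1 \<le> j" "j < d" using assms by auto
  show ?thesis
  proof
    assume "label \<rho> j c = label \<rho> j c'"
    then have "enc j (vertex j c) = enc j (vertex j c')"
      using label_decode(2)[OF assms(1) j] assms(3,4) by metis
    then show "vertex j c = vertex j c'" using enc_vertex_eq assms(3,4) by blast
  qed (auto simp: label_def)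
qed

lemma edge_eq_iff:
  assumes "\<rho> \<in> labelings" "j \<le> d" "c \<in> codes" "c' \<in> codes"
  shows "edge \<rho> j c = edge \<rho> j' c' \<longleftrightarrow> j = j' \<and> (\<forall>x\<in>window (j - 1) \<union> window j. c x = c' x)"
  using assms label_eq_iff[of \<rho> j c c'] label_eq_iff[of \<rho> "j - 1" c c']
  by (auto simp: edge_def vertex_eq_iff)

lemma edge_in_imm_vars:
  assumes "\<rho> \<in> labelings" "1 \<le> j" "j \<le> d" "c \<in> codes"
  shows "edge \<rho> j c \<in> imm_vars n d"
  using assms label_range[of \<rho> j c] label_range[of \<rho> "j - 1" c] by (auto simp: edge_def imm_vars_def)

text \<open>A path with nonzero product uses only edges of the graph, each of which comes from some
  code. Consecutive edges meet in a vertex, so their codes agree on what its layer remembers. As a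
  coordinate is remembered by an interval of layers, the codes along that interval agree on it, and
  everything glues to a single code.\<close>

lemma walk_sum:
  fixes \<alpha> :: "imm_var \<Rightarrow> 'a::field"
  assumes \<rho>: "\<rho> \<in> labelings"
    and zero: "\<And>v. v \<in> imm_vars n d \<Longrightarrow> v \<notin> edges \<rho> {1..d} \<Longrightarrow> \<alpha> v = 0"
  shows "mpoly_eval \<alpha> (IMM n d) = (\<Sum>c\<in>codes. \<Prod>k = 1..d. \<alpha> (edge \<rho> k c))"
proof -
  define full where "full p = (p(0 := 1, d := 1))" for p :: "nat \<Rightarrow> nat"
  define path where "path c = restrict (\<lambda>j. label \<rho> j c) {1..d - 1}" for c
  have full_path: "full (path c) j = label \<rho> j c" if "j \<le> d" for j c
    using that d by (auto simp: full_def path_def label_def)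
  have inj: "inj_on path codes"
  proof (rule inj_onI)
    fix c c' assume c: "c \<in> codes" "c' \<in> codes" "path c = path c'"
    have "c x = c' x" if "x \<in> I" for x
    proof -
      have "lo x \<in> {1..d - 1}" "lo x \<le> d" using lo[OF that] by auto
      moreover have "full (path c) (lo x) = full (path c') (lo x)" using c by simp
      ultimately have "label \<rho> (lo x) c = label \<rho> (lo x) c'" using full_path by metis
      then have "vertex (lo x) c = vertex (lo x) c'" using label_eq_iff[OF \<rho> \<open>lo x \<le> d\<close>] c by blast
      moreover have "x \<in> window (lo x)" using lo[OF that] that by (auto simp: window_def)
      ultimately show ?thesis by (auto simp: vertex_eq_iff)
    qed
    then show "c = c'" using c unfolding codes_def by (intro PiE_ext[of c I _ c']) auto
  qed
  have sub: "path ` codes \<subseteq> {1..d - 1} \<rightarrow>\<^sub>E {1..n}"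
  proof (rule image_subsetI)
    fix c assume c: "c \<in> codes"
    show "path c \<in> {1..d - 1} \<rightarrow>\<^sub>E {1..n}"
      unfolding path_def using label_range[OF \<rho> _ c] by fastforce
  qed
  have vanish: "(\<Prod>k = 1..d. \<alpha> (k, full p (k - 1), full p k)) = 0"
    if p: "p \<in> ({1..d - 1} \<rightarrow>\<^sub>E {1..n}) - path ` codes" for p
  proof (rule ccontr)
    assume nz: "(\<Prod>k = 1..d. \<alpha> (k, full p (k - 1), full p k)) \<noteq> 0"
    have n1: "1 \<le> n" using label_range[OF \<rho>, of 0] h M Mh by (metis One_nat_def Suc_leI le_trans less_le_trans mult_pos_pos less_one not_less)
    have full_range: "full p j \<in> {1..n}" if "j \<le> d" for j
      using p that n1 by (cases "j = 0 \<or> j = d") (auto simp: full_def PiE_iff)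
    have "\<exists>c. c \<in> codes \<and> edge \<rho> k c = (k, full p (k - 1), full p k)" if k: "k \<in> {1..d}" for k
    proof -
      have "(k, full p (k - 1), full p k) \<in> imm_vars n d"
        using k full_range[of k] full_range[of "k - 1"] by (auto simp: imm_vars_def)
      moreover have "\<alpha> (k, full p (k - 1), full p k) \<noteq> 0" using nz k by auto
      ultimately have "(k, full p (k - 1), full p k) \<in> edges \<rho> {1..d}" using zero by blast
      then show ?thesis by (auto simp: edges_def edge_def)
    qed
    then obtain ck where ck: "\<And>k. k \<in> {1..d} \<Longrightarrow> ck k \<in> codes"
      "\<And>k. k \<in> {1..d} \<Longrightarrow> edge \<rho> k (ck k) = (k, full p (k - 1), full p k)" by metis
    \<comment> \<open>Each coordinate is read off at the first layer that remembers it.\<close>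
    define c where "c = restrict (\<lambda>x. ck (lo x) x) I"
    have c: "c \<in> codes"
    proof -
      have "ck (lo x) x < R x" if "x \<in> I" for x
        using ck(1)[of "lo x"] lo[OF that] that unfolding codes_def by (auto dest!: PiE_mem)
      then show ?thesis by (auto simp: codes_def c_def)
    qed
    have agree: "ck (Suc j) x = ck j x" if "x \<in> window j" "1 \<le> j" "Suc j \<le> d" for j x
    proof -
      have "label \<rho> j (ck (Suc j)) = full p j" "label \<rho> j (ck j) = full p j"
        using ck(2)[of j] ck(2)[of "Suc j"] that by (auto simp: edge_def)
      then have "vertex j (ck (Suc j)) = vertex j (ck j)"
        using label_eq_iff[OF \<rho>, of j "ck (Suc j)" "ck j"] ck(1)[of j] ck(1)[of "Suc j"] that by simp
      then show ?thesis using that by (auto simp: vertex_eq_iff)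
    qed
    have const: "ck j x = ck (lo x) x" if "x \<in> I" "lo x \<le> j" "j \<le> hi x" for j x
      using that(2,3)
    proof (induction j rule: dec_induct)
      case (step j)
      then show ?case using agree[of x j] lo[OF that(1)] that(1) by (auto simp: window_def)
    qed simp
    have "label \<rho> j c = full p j" if j: "1 \<le> j" "j \<le> d" for j
    proof -
      have "vertex j c = vertex j (ck j)"
      proof -
        have "c x = ck j x" if "x \<in> window j" for x
          using const[of x j] that by (simp add: window_def c_def)
        then show ?thesis by (simp only: vertex_eq_iff) blast
      qed
      then have "label \<rho> j c = label \<rho> j (ck j)" by (simp add: label_def)
      also have "\<dots> = full p j" using ck(2)[of j] j by (auto simp: edge_def)
      finally show ?thesis .
    qed
    then have "path c = p" using p
      by (intro extensionalityI[of _ "{1..d - 1}"]) (auto simp: path_def full_def PiE_def)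
    then show False using p c by blast
  qed
  have "mpoly_eval \<alpha> (IMM n d) = (\<Sum>p \<in> {1..d - 1} \<rightarrow>\<^sub>E {1..n}. \<Prod>k = 1..d. \<alpha> (k, full p (k - 1), full p k))"
    unfolding mpoly_eval_IMM full_def ..
  also have "\<dots> = (\<Sum>p \<in> path ` codes. \<Prod>k = 1..d. \<alpha> (k, full p (k - 1), full p k))"
    by (rule sum.mono_neutral_right) (use sub vanish in \<open>auto intro!: finite_PiE\<close>)
  also have "\<dots> = (\<Sum>c\<in>codes. \<Prod>k = 1..d. \<alpha> (k, full (path c) (k - 1), full (path c) k))"
    by (simp add: sum.reindex[OF inj])
  also have "\<dots> = (\<Sum>c\<in>codes. \<Prod>k = 1..d. \<alpha> (edge \<rho> k c))"
    by (intro sum.cong prod.cong refl) (auto simp: edge_def full_path)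
  finally show ?thesis .
qed

text \<open>For a marked layer j, an edge is determined by the vertex at one of its ends, whose label is
  random. At most the two layers next to a vertex use it in this way.\<close>

definition pin :: "imm_var \<Rightarrow> nat \<times> nat" where
  "pin v = (case v of (j, a, b) \<Rightarrow> if at_target j then (j, b) else (j - 1, a))"
text \<open>The vertex behind an index, computed from the index alone: a monomial thus dictates
  which labels it needs without reference to \<rho>.\<close>

definition slot :: "nat \<times> nat \<Rightarrow> nat \<times> nat" where
  "slot p = (fst p, (snd p - 1) div h)"

lemma pin_edge:
  assumes "j \<in> marked"
  shows "\<exists>i. pin (edge \<rho> j c) = (i, label \<rho> i c) \<and> 1 \<le> i \<and> i < d \<and> (j = i \<or> j = i + 1) \<and> window (j - 1) \<union> window j \<subseteq> window i"
proof (cases "at_target j")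
  case True
  have "window (j - 1) \<union> window j \<subseteq> window j" using target(1)[OF assms True] by (auto simp: window_def)
  then show ?thesis using True target(2)[OF assms] marked[OF assms] by (auto simp: pin_def edge_def)
next
  case False
  have "window (j - 1) \<union> window j \<subseteq> window (j - 1)" using source(1)[OF assms False] by (auto simp: window_def)
  then show ?thesis using False source(2)[OF assms] marked[OF assms]
    by (intro exI[of _ "j - 1"]) (auto simp: pin_def edge_def)
qed

text \<open>Labels of different vertices are independent and uniform, so prescribing those in Q has
  probability \<open>1 / h ^ card Q\<close>.\<close>

lemma card_labelings_agreeing:
  assumes "\<rho>0 \<in> labelings" "Q \<subseteq> {1..<d} \<times> {..<M}"
  shows "card {\<rho> \<in> labelings. \<forall>x\<in>Q. \<rho> x = \<rho>0 x} * h ^ card Q = card labelings"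
proof -
  define S where "S = {1..<d} \<times> {..<M}"
  have finS: "finite S" by (simp add: S_def)
  have labelings: "labelings = PiE S (\<lambda>_. {..<h})" by (simp add: labelings_def S_def)
  have QS: "Q \<subseteq> S" using assms(2) by (simp add: S_def)
  have "{\<rho> \<in> labelings. \<forall>x\<in>Q. \<rho> x = \<rho>0 x} = PiE S (\<lambda>x. if x \<in> Q then {\<rho>0 x} else {..<h})"
    using assms(1) QS unfolding labelings by (auto simp: PiE_iff extensional_def split: if_splits)
  then have "card {\<rho> \<in> labelings. \<forall>x\<in>Q. \<rho> x = \<rho>0 x} = (\<Prod>x\<in>S. if x \<in> Q then 1 else h)"
    by (simp add: card_PiE[OF finS] if_distrib[of card] cong: if_cong)
  also have "\<dots> = h ^ card (S - Q)"
  proof -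
    have "(\<Prod>x\<in>S. if x \<in> Q then 1 else h) = (\<Prod>x\<in>S - Q. h)"
      by (rule prod.mono_neutral_cong_right[OF finS]) auto
    then show ?thesis by simp
  qed
  finally have "card {\<rho> \<in> labelings. \<forall>x\<in>Q. \<rho> x = \<rho>0 x} * h ^ card Q = h ^ (card (S - Q) + card Q)"
    by (simp add: power_add)
  also have "card (S - Q) + card Q = card S"
    using QS finS card_mono[OF finS QS] by (simp add: card_Diff_subset finite_subset[OF QS])
  also have "h ^ card S = card labelings"
    unfolding labelings by (simp add: card_PiE[OF finS])
  finally show ?thesis .
qed

definition survives :: "(nat \<times> nat \<Rightarrow> nat) \<Rightarrow> nat \<Rightarrow> imm_var set \<Rightarrow> bool" where
  "survives \<rho> t m \<longleftrightarrow> m \<subseteq> edges \<rho> {1..d} \<and> card {v \<in> m. fst v \<in> marked} > t"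

text \<open>To survive, m has to guess the labels of the vertices to which its marked edges are
  pinned. A vertex pins at most two edges of m, so at least \<open>(t + 1) / 2\<close> labels are
  prescribed. The resulting probability is squared to avoid the root.\<close>

lemma card_surviving:
  assumes "finite m"
  shows "(card {\<rho> \<in> labelings. survives \<rho> t m})\<^sup>2 * h ^ (t + 1) \<le> (card labelings)\<^sup>2"
proof (cases "\<exists>\<rho>0\<in>labelings. survives \<rho>0 t m")
  case True
  let ?m = "{v \<in> m. fst v \<in> marked}"
  let ?Q = "slot ` pin ` ?m"
  have edge_ex: "\<exists>c\<in>codes. v = edge \<rho> (fst v) c" if "survives \<rho> t m" "v \<in> ?m" for \<rho> v
  proof -
    have "v \<in> edges \<rho> {1..d}" using that by (auto simp: survives_def)
    then obtain j c where "v = edge \<rho> j c" "c \<in> codes" by (auto simp: edges_def)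
    then show ?thesis by (auto simp: edge_def)
  qed
  have key: "\<rho> (slot (pin v)) = (snd (pin v) - 1) mod h \<and> slot (pin v) \<in> {1..<d} \<times> {..<M} \<and> snd (pin v) \<ge> 1"
    if \<rho>: "\<rho> \<in> labelings" "survives \<rho> t m" and v: "v \<in> ?m" for \<rho> v
  proof -
    obtain c where c: "c \<in> codes" "v = edge \<rho> (fst v) c" using edge_ex[OF \<rho>(2) v] by blast
    obtain i where i: "pin (edge \<rho> (fst v) c) = (i, label \<rho> i c)" "1 \<le> i" "i < d"
      using pin_edge[of "fst v" \<rho> c] v by blast
    have "pin v = (i, label \<rho> i c)" using i(1) c(2) by metis
    then show ?thesis using label_decode[OF \<rho>(1) i(2,3) c(1)] enc_vertex_less[OF c(1)] i by (simp add: slot_def)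
  qed
  \<comment> \<open>One surviving labeling serves as reference. The slots and the residues modulo h
    are read off m, so every surviving labeling agrees with \<rho>0 on the slots.\<close>
  obtain \<rho>0 where \<rho>0: "\<rho>0 \<in> labelings" "survives \<rho>0 t m" using True by blast
  have injslot: "inj_on slot (pin ` ?m)"
  proof (rule inj_onI)
    fix p p' assume p: "p \<in> pin ` ?m" "p' \<in> pin ` ?m" "slot p = slot p'"
    then have "(snd p - 1) mod h = (snd p' - 1) mod h" "snd p \<ge> 1" "snd p' \<ge> 1"
    proof -
      obtain v v' where v: "v \<in> ?m" "p = pin v" "v' \<in> ?m" "p' = pin v'" using p by auto
      show "(snd p - 1) mod h = (snd p' - 1) mod h" "snd p \<ge> 1" "snd p' \<ge> 1"
        using key[OF \<rho>0 v(1)] key[OF \<rho>0 v(3)] p(3) v(2,4) by (metis, metis, metis)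
    qed
    moreover have "(snd p - 1) div h = (snd p' - 1) div h" "fst p = fst p'" using p(3) by (auto simp: slot_def)
    ultimately have "snd p - 1 = snd p' - 1" by (metis div_mod_decomp)
    then show "p = p'" using \<open>snd p \<ge> 1\<close> \<open>snd p' \<ge> 1\<close> \<open>fst p = fst p'\<close> by (simp add: prod_eq_iff)
  qed
  \<comment> \<open>An edge is recovered from its pin and its layer, and its layer is that of the
    pin or the next one; this gives the factor 2.\<close>
  have "card ?m \<le> card ((\<lambda>(p, b). (p, fst p + b)) ` (pin ` ?m \<times> {0, 1}))"
  proof (rule card_inj_on_le[where f = "\<lambda>v. (pin v, fst v)"])
    show "inj_on (\<lambda>v. (pin v, fst v)) ?m"
    proof (rule inj_onI)
      fix v v' assume v: "v \<in> ?m" "v' \<in> ?m" "(pin v, fst v) = (pin v', fst v')"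
      obtain c c' where c: "c \<in> codes" "v = edge \<rho>0 (fst v) c" "c' \<in> codes" "v' = edge \<rho>0 (fst v') c'"
        using edge_ex[OF \<rho>0(2) v(1)] edge_ex[OF \<rho>0(2) v(2)] by blast
      define j where "j = fst v"
      have j: "j \<in> marked" "v = edge \<rho>0 j c" "v' = edge \<rho>0 j c'" using v c by (auto simp: j_def)
      obtain i where i: "pin v = (i, label \<rho>0 i c)" "1 \<le> i" "i < d" "j = i \<or> j = i + 1" "window (j - 1) \<union> window j \<subseteq> window i"
        using pin_edge[OF j(1), of \<rho>0 c] j(2) by blast
      obtain i' where i': "pin v' = (i', label \<rho>0 i' c')" using pin_edge[OF j(1), of \<rho>0 c'] j(3) by blast
      have "label \<rho>0 i c = label \<rho>0 i c'" using i i' v by auto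
      then have "vertex i c = vertex i c'" using label_eq_iff[OF \<rho>0(1), of i c c'] c i by simp
      then have "\<forall>x\<in>window (j - 1) \<union> window j. c x = c' x" using i(5) by (auto simp: vertex_eq_iff)
      then show "v = v'" using edge_eq_iff[OF \<rho>0(1), of j c c' j] marked[OF j(1)] c j by simp
    qed
    show "(\<lambda>v. (pin v, fst v)) ` ?m \<subseteq> (\<lambda>(p, b). (p, fst p + b)) ` (pin ` ?m \<times> {0, 1})"
    proof (rule image_subsetI)
      fix v assume "v \<in> ?m"
      then obtain j a b where v0: "v = (j, a, b)" and v: "(j, a, b) \<in> m" "fst (j, a, b) \<in> marked"
        by (cases v) auto
      consider "fst (pin v) = j" | "fst (pin v) + 1 = j"
        using marked[of j] v by (cases "at_target j") (auto simp: pin_def v0)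
      then show "(pin v, fst v) \<in> (\<lambda>(p, b). (p, fst p + b)) ` (pin ` ?m \<times> {0, 1})"
      proof cases
        case 1
        then show ?thesis using v unfolding v0 by (intro image_eqI[of _ _ "(pin (j, a, b), 0)"]) auto
      next
        case 2
        then show ?thesis using v unfolding v0 by (intro image_eqI[of _ _ "(pin (j, a, b), 1)"]) auto
      qed
    qed
  qed (use assms in auto)
  also have "\<dots> \<le> card (pin ` ?m \<times> {0 :: nat, 1})" using assms by (intro card_image_le) auto
  also have "\<dots> = 2 * card ?Q" using card_image[OF injslot] by (simp add: card_cartesian_product)
  finally have "t + 1 \<le> 2 * card ?Q" using \<rho>0(2) by (simp add: survives_def)
  have "{\<rho> \<in> labelings. survives \<rho> t m} \<subseteq> {\<rho> \<in> labelings. \<forall>x\<in>?Q. \<rho> x = \<rho>0 x}"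
  proof
    fix \<rho> assume \<rho>: "\<rho> \<in> {\<rho> \<in> labelings. survives \<rho> t m}"
    have "\<rho> (slot (pin v)) = \<rho>0 (slot (pin v))" if "v \<in> ?m" for v
      using key[of \<rho> v] key[OF \<rho>0 that] \<rho> that by simp
    then show "\<rho> \<in> {\<rho> \<in> labelings. \<forall>x\<in>?Q. \<rho> x = \<rho>0 x}" using \<rho> by simp
  qed
  moreover have "finite labelings" unfolding labelings_def by (intro finite_PiE) auto
  ultimately have le: "card {\<rho> \<in> labelings. survives \<rho> t m} \<le> card {\<rho> \<in> labelings. \<forall>x\<in>?Q. \<rho> x = \<rho>0 x}"
    by (intro card_mono) auto
  have "(card {\<rho> \<in> labelings. survives \<rho> t m})\<^sup>2 * h ^ (t + 1) \<le>
      (card {\<rho> \<in> labelings. \<forall>x\<in>?Q. \<rho> x = \<rho>0 x})\<^sup>2 * h ^ (2 * card ?Q)"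
    using le \<open>t + 1 \<le> 2 * card ?Q\<close> h by (intro mult_le_mono power_mono power_increasing) auto
  also have "\<dots> = (card {\<rho> \<in> labelings. \<forall>x\<in>?Q. \<rho> x = \<rho>0 x} * h ^ card ?Q)\<^sup>2"
    by (simp add: power_mult_distrib power_mult[symmetric] mult.commute)
  also have "\<dots> = (card labelings)\<^sup>2"
    using card_labelings_agreeing[OF \<rho>0(1), of ?Q] key[OF \<rho>0] by (simp add: image_subset_iff)
  finally show ?thesis .
next
  case False
  then have "{\<rho> \<in> labelings. survives \<rho> t m} = {}" by auto
  then show ?thesis by (simp only: card.empty) simp
qed

text \<open>Union bound over the monomials. As \<open>card_surviving\<close> bounds squared counts,
  Cauchy-Schwarz is applied to the sum over the monomials, whence the square of
  \<open>card \<M>\<close>.\<close>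

lemma ex_killing_labeling:
  assumes "finite \<M>" "\<And>m. m \<in> \<M> \<Longrightarrow> finite m" "(card \<M>)\<^sup>2 < h ^ (t + 1)"
  shows "\<exists>\<rho>\<in>labelings. \<forall>m\<in>\<M>. \<not> survives \<rho> t m"
proof (rule ccontr)
  assume "\<not> ?thesis"
  then have "labelings \<subseteq> (\<Union>m\<in>\<M>. {\<rho> \<in> labelings. survives \<rho> t m})" by auto
  moreover have fin: "finite labelings" unfolding labelings_def by (intro finite_PiE) auto
  ultimately have "card labelings \<le> card (\<Union>m\<in>\<M>. {\<rho> \<in> labelings. survives \<rho> t m})"
    using assms(1) by (intro card_mono) auto
  also have "\<dots> \<le> (\<Sum>m\<in>\<M>. card {\<rho> \<in> labelings. survives \<rho> t m})"
    by (rule card_UN_le[OF assms(1)])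
  finally have "(card labelings)\<^sup>2 \<le> (\<Sum>m\<in>\<M>. card {\<rho> \<in> labelings. survives \<rho> t m})\<^sup>2"
    by (rule power_mono) simp
  also have "\<dots> \<le> card \<M> * (\<Sum>m\<in>\<M>. (card {\<rho> \<in> labelings. survives \<rho> t m})\<^sup>2)"
    by (rule cauchy_schwarz_nat[OF assms(1)])
  finally have "(card labelings)\<^sup>2 * h ^ (t + 1) \<le> card \<M> * (\<Sum>m\<in>\<M>. (card {\<rho> \<in> labelings. survives \<rho> t m})\<^sup>2 * h ^ (t + 1))"
    by (simp only: sum_distrib_right[symmetric] mult.assoc[symmetric] mult_le_mono1)
  also have "\<dots> \<le> card \<M> * (\<Sum>m\<in>\<M>. (card labelings)\<^sup>2)"
    using card_surviving assms(2) by (intro mult_le_mono2 sum_mono) auto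
  also have "\<dots> = (card labelings)\<^sup>2 * (card \<M>)\<^sup>2" by (simp add: power2_eq_square)
  finally have "(card labelings)\<^sup>2 * h ^ (t + 1) \<le> (card labelings)\<^sup>2 * (card \<M>)\<^sup>2" .
  moreover have "card labelings > 0"
    unfolding labelings_def using h by (subst card_PiE) (auto intro!: prod_pos)
  ultimately show False using assms(3) by simp
qed

end

section \<open>Pairs of walks\<close>

lemma sum_PiE_insert:
  assumes "x \<notin> S"
  shows "(\<Sum>b\<in>PiE (insert x S) R. f b) = (\<Sum>b\<in>PiE S R. \<Sum>y\<in>R x. f (b(x := y)))"
proof -
  have "(\<Sum>b\<in>PiE (insert x S) R. f b) = (\<Sum>(y, b)\<in>R x \<times> PiE S R. f (b(x := y)))"
    unfolding PiE_insert_eq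
    by (subst sum.reindex[OF inj_combinator[OF assms]]) (auto simp: comp_def case_prod_beta)
  also have "\<dots> = (\<Sum>y\<in>R x. \<Sum>b\<in>PiE S R. f (b(x := y)))" by (rule sum.cartesian_product[symmetric])
  also have "\<dots> = (\<Sum>b\<in>PiE S R. \<Sum>y\<in>R x. f (b(x := y)))" by (rule sum.swap)
  finally show ?thesis .
qed

text \<open>The blocks are independent: a code is a family of codes, one for each i, and a product
  over i of functions of the i-th pair sums to the product of the sums.\<close>

lemma sum_pairs_product_PiE:
  fixes F :: "'i \<Rightarrow> ('s \<Rightarrow> nat) \<Rightarrow> ('s \<Rightarrow> nat) \<Rightarrow> real"
  assumes "finite A" "finite S" "\<And>i s. finite (R (i, s))"
  shows "(\<Sum>c\<in>PiE (A \<times> S) R. \<Sum>c'\<in>PiE (A \<times> S) R. \<Prod>i\<in>A. F i (\<lambda>s\<in>S. c (i, s)) (\<lambda>s\<in>S. c' (i, s))) =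
    (\<Prod>i\<in>A. \<Sum>b\<in>PiE S (\<lambda>s. R (i, s)). \<Sum>b'\<in>PiE S (\<lambda>s. R (i, s)). F i b b')"
proof -
  let ?P = "PiE A (\<lambda>i. PiE S (\<lambda>s. R (i, s)))"
  let ?\<phi> = "\<lambda>f. \<lambda>(i, s)\<in>A \<times> S. f i s"
  have bij: "bij_betw ?\<phi> ?P (PiE (A \<times> S) R)"
  proof (rule bij_betwI[where g = "\<lambda>c. \<lambda>i\<in>A. \<lambda>s\<in>S. c (i, s)"])
    show "(\<lambda>i\<in>A. \<lambda>s\<in>S. (?\<phi> f) (i, s)) = f" if "f \<in> ?P" for f
    proof
      fix i
      show "(\<lambda>i\<in>A. \<lambda>s\<in>S. (?\<phi> f) (i, s)) i = f i"
      proof (cases "i \<in> A")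
        case True
        then have "f i \<in> PiE S (\<lambda>s. R (i, s))" using that by auto
        then show ?thesis using True by (auto simp: fun_eq_iff PiE_iff extensional_def)
      qed (use that in \<open>auto simp: PiE_iff extensional_def\<close>)
    qed
  qed (auto simp: PiE_iff extensional_def fun_eq_iff)
  have swap: "(\<lambda>s\<in>S. (?\<phi> f) (i, s)) = f i" if "f \<in> ?P" "i \<in> A" for f i
  proof -
    have "f i \<in> PiE S (\<lambda>s. R (i, s))" using that by auto
    then show ?thesis using that(2) by (auto simp: fun_eq_iff PiE_iff extensional_def)
  qed
  have finb: "finite (PiE S (\<lambda>s. R (i, s)))" for i using assms by (intro finite_PiE) auto
  have "(\<Sum>c\<in>PiE (A \<times> S) R. \<Sum>c'\<in>PiE (A \<times> S) R. \<Prod>i\<in>A. F i (\<lambda>s\<in>S. c (i, s)) (\<lambda>s\<in>S. c' (i, s)))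
      = (\<Sum>f\<in>?P. \<Sum>f'\<in>?P. \<Prod>i\<in>A. F i (\<lambda>s\<in>S. (?\<phi> f) (i, s)) (\<lambda>s\<in>S. (?\<phi> f') (i, s)))"
    by (simp only: sum.reindex_bij_betw[OF bij, symmetric])
  also have "\<dots> = (\<Sum>f\<in>?P. \<Sum>f'\<in>?P. \<Prod>i\<in>A. F i (f i) (f' i))"
    by (intro sum.cong prod.cong refl) (simp only: swap)
  also have "\<dots> = (\<Sum>f\<in>?P. \<Prod>i\<in>A. \<Sum>b'\<in>PiE S (\<lambda>s. R (i, s)). F i (f i) b')"
    using finb by (simp add: prod_sum_PiE[OF assms(1)])
  also have "\<dots> = (\<Prod>i\<in>A. \<Sum>b\<in>PiE S (\<lambda>s. R (i, s)). \<Sum>b'\<in>PiE S (\<lambda>s. R (i, s)). F i b b')"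
    using finb by (simp add: prod_sum_PiE[OF assms(1)])
  finally show ?thesis .
qed

text \<open>Counts the steps in which two walks through a block use the same strand.
  \<open>b 0\<close> is the gadget, and a strand is private to the gadget and to two consecutive
  values; for \<open>s = 1\<close> the earlier value is the gadget itself.\<close>

definition shared_steps :: "nat \<Rightarrow> (nat \<Rightarrow> nat) \<Rightarrow> (nat \<Rightarrow> nat) \<Rightarrow> nat" where
  "shared_steps K b b' = card {s \<in> {1..K}. b 0 = b' 0 \<and> b (s - 1) = b' (s - 1) \<and> b s = b' s}"

lemma shared_steps_le: "shared_steps K b b' \<le> K"
proof -
  have "shared_steps K b b' \<le> card {1..K}" unfolding shared_steps_def by (intro card_mono) auto
  then show ?thesis by simp
qed

lemma shared_steps_Suc:
  "shared_steps (Suc K) (b(Suc K := y)) (b'(Suc K := y')) =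
    shared_steps K b b' + (if b 0 = b' 0 \<and> b K = b' K \<and> y = y' then 1 else 0)"
proof -
  let ?P = "\<lambda>s. b 0 = b' 0 \<and> b (s - 1) = b' (s - 1) \<and> b s = b' s"
  have "{s \<in> {1..Suc K}. (b(Suc K := y)) 0 = (b'(Suc K := y')) 0 \<and> (b(Suc K := y)) (s - 1) = (b'(Suc K := y')) (s - 1) \<and>
      (b(Suc K := y)) s = (b'(Suc K := y')) s} =
    {s \<in> {1..K}. ?P s} \<union> (if b 0 = b' 0 \<and> b K = b' K \<and> y = y' then {Suc K} else {})"
  proof (rule set_eqI)
    fix s
    show "s \<in> {s \<in> {1..Suc K}. (b(Suc K := y)) 0 = (b'(Suc K := y')) 0 \<and> (b(Suc K := y)) (s - 1) = (b'(Suc K := y')) (s - 1) \<and>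
      (b(Suc K := y)) s = (b'(Suc K := y')) s} \<longleftrightarrow>
      s \<in> {s \<in> {1..K}. ?P s} \<union> (if b 0 = b' 0 \<and> b K = b' K \<and> y = y' then {Suc K} else {})"
      by (cases "s = Suc K") (auto simp: le_Suc_eq)
  qed
  then show ?thesis unfolding shared_steps_def by (auto simp: card_insert_if)
qed

lemma sum_diagonal_pairs:
  "(\<Sum>y<w. \<Sum>y'<w. if y = y' then p else q) = real w * p + real w * (real w - 1) * q" for p q :: real
proof -
  have "(\<Sum>y'<w. if y = y' then p else q) = p + (real w - 1) * q" if "y < w" for y
  proof -
    have "(\<Sum>y'<w. if y = y' then p else q) = (\<Sum>y'<w. q + (if y = y' then p - q else 0))"
      by (intro sum.cong) auto
    also have "\<dots> = real w * q + (p - q)" using that by (simp add: sum.distrib)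
    finally show ?thesis by (simp add: algebra_simps)
  qed
  then have "(\<Sum>y<w. \<Sum>y'<w. if y = y' then p else q) = (\<Sum>y<w. p + (real w - 1) * q)"
    by (intro sum.cong) auto
  then show ?thesis by (simp add: algebra_simps)
qed

text \<open>Two walks through a gadget either coincide or differ at present. After a coincidence, w
  continuations agree with gain \<psi> and \<open>w * (w - 1)\<close> part; after a difference, w
  continuations meet again without gain. Up to the factor \<open>1 + 2 / q\<close>, the weights 1
  and \<open>1 / q\<close> of the two states are multiplied by at most \<open>w ^ 2\<close>.\<close>

lemma diverging_step_bound:
  fixes \<psi> :: real
  assumes "w \<ge> 1" "0 \<le> \<psi>" "\<psi> \<le> real w + 1"
  defines "q \<equiv> sqrt (real w)"
  shows "real w * \<psi> + real w * (real w - 1) / q \<le> (1 + 2 / q) * real w ^ 2"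
    "real w + real w * (real w - 1) / q \<le> (1 + 2 / q) * real w ^ 2 / q"
proof -
  have q: "q \<ge> 1" "real w = q * q" using assms by (auto simp: q_def)
  have "q * q * \<psi> + q * q * (q * q - 1) / q \<le> q * q * (q * q + 1) + q * q * (q * q - 1) / q"
    using assms(3) q by (intro add_right_mono mult_left_mono) auto
  also have "\<dots> = q ^ 4 + q ^ 2 + q ^ 3 - q"
    using q by (simp add: field_simps power2_eq_square power3_eq_cube power4_eq_xxxx)
  also have "\<dots> \<le> q ^ 4 + 2 * q ^ 3"
  proof -
    have "q ^ 2 \<le> q ^ 3" using q by (intro power_increasing) auto
    then show ?thesis using q by simp
  qed
  also have "\<dots> = (1 + 2 / q) * (q * q) ^ 2"
    using q by (simp add: field_simps power2_eq_square power3_eq_cube power4_eq_xxxx)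
  finally show "real w * \<psi> + real w * (real w - 1) / q \<le> (1 + 2 / q) * real w ^ 2" by (simp add: q(2))
  have "q * q + q * q * (q * q - 1) / q = q ^ 2 + q ^ 3 - q"
    using q by (simp add: field_simps power2_eq_square power3_eq_cube)
  also have "\<dots> \<le> q ^ 3 + 2 * q ^ 2" using q by (simp add: add_increasing)
  also have "\<dots> = (1 + 2 / q) * (q * q) ^ 2 / q"
    using q by (simp add: field_simps power2_eq_square power3_eq_cube)
  finally show "real w + real w * (real w - 1) / q \<le> (1 + 2 / q) * real w ^ 2 / q" by (simp add: q(2))
qed

text \<open>The weight \<open>1 / sqrt w\<close> of pairs that currently differ makes this potential grow by at most the
  factor \<open>1 + 2 / sqrt w\<close> in each step.\<close>

lemma shared_steps_potential:
  fixes \<psi> :: real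
  assumes "w \<ge> 1" "0 \<le> \<psi>" "\<psi> \<le> real w + 1" "finite (R 0)" and R: "\<And>s. s \<ge> 1 \<Longrightarrow> R s = {..<w}"
  shows "(\<Sum>b\<in>PiE {..K} R. \<Sum>b'\<in>PiE {..K} R. if b 0 = b' 0
      then \<psi> ^ shared_steps K b b' * (if b K = b' K then 1 else 1 / sqrt (real w)) else 0)
    \<le> (1 + 2 / sqrt (real w)) ^ K * real w ^ (2 * K) * real (card (R 0))"
proof (induction K)
  case 0
  have "(\<Sum>b\<in>PiE {..0} R. \<Sum>b'\<in>PiE {..0} R. if b 0 = b' 0
      then \<psi> ^ shared_steps 0 b b' * (if b 0 = b' 0 then 1 else 1 / sqrt (real w)) else 0)
    = (\<Sum>b\<in>PiE {..0} R. \<Sum>b'\<in>PiE {..0} R. if b = b' then 1 else 0)"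
  proof (intro sum.cong refl)
    fix b b' :: "nat \<Rightarrow> nat" assume "b \<in> PiE {..0} R" "b' \<in> PiE {..0} R"
    then have "b x = b' x" if "x \<noteq> 0" for x using that by (auto simp: PiE_iff extensional_def)
    then have "b 0 = b' 0 \<longleftrightarrow> b = b'" by (metis ext)
    then show "(if b 0 = b' 0 then \<psi> ^ shared_steps 0 b b' * (if b 0 = b' 0 then 1 else 1 / sqrt (real w)) else 0)
       = (if b = b' then 1 else 0)"
      by (auto simp: shared_steps_def)
  qed
  also have "\<dots> = real (card (PiE {..0} R))"
  proof -
    have "finite (PiE {..0} R)" by (intro finite_PiE) (use assms(4) in auto)
    then have "(\<Sum>b'\<in>PiE {..0} R. if b = b' then 1 else 0) = (1 :: real)" if "b \<in> PiE {..0} R" for b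
      using that by (subst sum.delta') (simp_all only: if_True)
    then have "(\<Sum>b\<in>PiE {..0} R. \<Sum>b'\<in>PiE {..0} R. if b = b' then 1 else 0) = (\<Sum>b\<in>PiE {..0} R. 1 :: real)"
      by (intro sum.cong refl)
    then show ?thesis by (simp only: sum_constant mult_1_right)
  qed
  also have "\<dots> = real (card (R 0))" by (simp add: card_PiE)
  finally show ?case by simp
next
  case (Suc K)
  let ?q = "sqrt (real w)"
  let ?\<Lambda> = "1 + 2 / ?q"
  have R': "R (Suc K) = {..<w}" using R by simp
  have inner: "(\<Sum>y<w. \<Sum>y'<w. if (b(Suc K := y)) 0 = (b'(Suc K := y')) 0
      then \<psi> ^ shared_steps (Suc K) (b(Suc K := y)) (b'(Suc K := y')) * (if (b(Suc K := y)) (Suc K) = (b'(Suc K := y')) (Suc K) then 1 else 1 / ?q) else 0)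
    \<le> ?\<Lambda> * real w ^ 2 * (if b 0 = b' 0 then \<psi> ^ shared_steps K b b' * (if b K = b' K then 1 else 1 / ?q) else 0)"
    (is "?L \<le> _") for b b' :: "nat \<Rightarrow> nat"
  proof (cases "b 0 = b' 0")
    case True
    let ?e = "\<psi> ^ shared_steps K b b'"
    have e: "?e \<ge> 0" using assms(2) by simp
    show ?thesis
    proof (cases "b K = b' K")
      case eq: True
      have "?L = (\<Sum>y<w. \<Sum>y'<w. if y = y' then ?e * \<psi> else ?e * (1 / ?q))"
        unfolding shared_steps_Suc using True eq by (intro sum.cong refl) simp
      also have "\<dots> = ?e * (real w * \<psi> + real w * (real w - 1) / ?q)"
        unfolding sum_diagonal_pairs by (simp add: algebra_simps diff_divide_distrib)
      also have "\<dots> \<le> ?e * (?\<Lambda> * real w ^ 2)"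
        by (rule mult_left_mono[OF diverging_step_bound(1)[OF assms(1-3)] e])
      finally show ?thesis using True eq by (simp add: mult_ac)
    next
      case neq: False
      have "?L = (\<Sum>y<w. \<Sum>y'<w. if y = y' then ?e else ?e * (1 / ?q))"
        unfolding shared_steps_Suc using True neq by (intro sum.cong refl) simp
      also have "\<dots> = ?e * (real w + real w * (real w - 1) / ?q)"
        unfolding sum_diagonal_pairs by (simp add: algebra_simps diff_divide_distrib)
      also have "\<dots> \<le> ?e * (?\<Lambda> * real w ^ 2 / ?q)"
        by (rule mult_left_mono[OF diverging_step_bound(2)[OF assms(1-3)] e])
      finally show ?thesis using True neq by (simp add: mult_ac)
    qed
  next
    case False
    then show ?thesis by simp
  qed
  have "{..Suc K} = insert (Suc K) {..K}" by auto
  then have "(\<Sum>b\<in>PiE {..Suc K} R. \<Sum>b'\<in>PiE {..Suc K} R. if b 0 = b' 0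
      then \<psi> ^ shared_steps (Suc K) b b' * (if b (Suc K) = b' (Suc K) then 1 else 1 / ?q) else 0)
    = (\<Sum>b\<in>PiE {..K} R. \<Sum>y<w. \<Sum>b'\<in>PiE {..K} R. \<Sum>y'<w. if (b(Suc K := y)) 0 = (b'(Suc K := y')) 0
      then \<psi> ^ shared_steps (Suc K) (b(Suc K := y)) (b'(Suc K := y')) * (if (b(Suc K := y)) (Suc K) = (b'(Suc K := y')) (Suc K) then 1 else 1 / ?q) else 0)"
    by (simp only: sum_PiE_insert[of "Suc K" "{..K}"] atMost_iff Suc_n_not_le_n not_False_eq_True R')
  also have "\<dots> = (\<Sum>b\<in>PiE {..K} R. \<Sum>b'\<in>PiE {..K} R. \<Sum>y<w. \<Sum>y'<w. if (b(Suc K := y)) 0 = (b'(Suc K := y')) 0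
      then \<psi> ^ shared_steps (Suc K) (b(Suc K := y)) (b'(Suc K := y')) * (if (b(Suc K := y)) (Suc K) = (b'(Suc K := y')) (Suc K) then 1 else 1 / ?q) else 0)"
    by (rule sum.cong[OF refl], rule sum.swap)
  also have "\<dots> \<le> (\<Sum>b\<in>PiE {..K} R. \<Sum>b'\<in>PiE {..K} R. ?\<Lambda> * real w ^ 2 *
      (if b 0 = b' 0 then \<psi> ^ shared_steps K b b' * (if b K = b' K then 1 else 1 / ?q) else 0))"
    by (intro sum_mono inner)
  also have "\<dots> = ?\<Lambda> * real w ^ 2 * (\<Sum>b\<in>PiE {..K} R. \<Sum>b'\<in>PiE {..K} R.
      if b 0 = b' 0 then \<psi> ^ shared_steps K b b' * (if b K = b' K then 1 else 1 / ?q) else 0)"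
    by (simp only: sum_distrib_left)
  also have "\<dots> \<le> ?\<Lambda> * real w ^ 2 * (?\<Lambda> ^ K * real w ^ (2 * K) * real (card (R 0)))"
    by (intro mult_left_mono Suc) auto
  also have "\<dots> = ?\<Lambda> ^ Suc K * real w ^ (2 * Suc K) * real (card (R 0))"
    by (simp add: power_add power2_eq_square mult_ac)
  finally show ?case .
qed

text \<open>Replacing the weight \<open>1 / sqrt w\<close> of the pairs that differ at the end by 1
  costs the factor \<open>sqrt w\<close>.\<close>

lemma sum_shared_steps_same_start:
  fixes \<psi> :: real
  assumes "w \<ge> 1" "0 \<le> \<psi>" "\<psi> \<le> real w + 1" "finite (R 0)" and R: "\<And>s. s \<ge> 1 \<Longrightarrow> R s = {..<w}"
  shows "(\<Sum>b\<in>PiE {..K} R. \<Sum>b'\<in>PiE {..K} R. if b 0 = b' 0 then \<psi> ^ shared_steps K b b' else 0)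
    \<le> sqrt (real w) * (1 + 2 / sqrt (real w)) ^ K * real w ^ (2 * K) * real (card (R 0))"
proof -
  let ?q = "sqrt (real w)"
  have q: "?q \<ge> 1" using assms(1) by simp
  have "(\<Sum>b\<in>PiE {..K} R. \<Sum>b'\<in>PiE {..K} R. if b 0 = b' 0 then \<psi> ^ shared_steps K b b' else 0) \<le>
    (\<Sum>b\<in>PiE {..K} R. \<Sum>b'\<in>PiE {..K} R. ?q * (if b 0 = b' 0
      then \<psi> ^ shared_steps K b b' * (if b K = b' K then 1 else 1 / ?q) else 0))"
  proof (intro sum_mono)
    fix b b' :: "nat \<Rightarrow> nat"
    have "\<psi> ^ shared_steps K b b' \<ge> 0" using assms(2) by simp
    then have "\<psi> ^ shared_steps K b b' \<le> ?q * \<psi> ^ shared_steps K b b'" 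
      using mult_right_mono[OF q, of "\<psi> ^ shared_steps K b b'"] by simp
    then show "(if b 0 = b' 0 then \<psi> ^ shared_steps K b b' else 0) \<le> ?q * (if b 0 = b' 0
      then \<psi> ^ shared_steps K b b' * (if b K = b' K then 1 else 1 / ?q) else 0)" using assms(1) by auto
  qed
  also have "\<dots> = ?q * (\<Sum>b\<in>PiE {..K} R. \<Sum>b'\<in>PiE {..K} R. if b 0 = b' 0
      then \<psi> ^ shared_steps K b b' * (if b K = b' K then 1 else 1 / ?q) else 0)"
    by (simp only: sum_distrib_left)
  also have "\<dots> \<le> ?q * ((1 + 2 / ?q) ^ K * real w ^ (2 * K) * real (card (R 0)))"
    by (intro mult_left_mono shared_steps_potential) (use assms in auto)
  finally show ?thesis by (simp add: mult_ac)
qed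

text \<open>Pairs in different gadgets share nothing and contribute 1 each. For pairs in the same
  gadget, the surplus \<tau> of \<theta> over \<psi> acts in at most K steps. In the application
  \<open>\<tau> ^ K\<close> is at most twice the number of gadgets, which balances the fewer pairs
  of the second kind against those of the first.\<close>

lemma sum_shared_steps:
  fixes \<theta> \<psi> \<tau> :: real
  assumes "w \<ge> 1" "0 \<le> \<psi>" "\<psi> \<le> real w + 1" "finite (R 0)" and R: "\<And>s. s \<ge> 1 \<Longrightarrow> R s = {..<w}"
    and "\<tau> \<ge> 1" "0 \<le> \<theta>" "\<theta> \<le> \<tau> * \<psi>"
  shows "(\<Sum>b\<in>PiE {..K} R. \<Sum>b'\<in>PiE {..K} R. \<theta> ^ shared_steps K b b')
    \<le> real w ^ (2 * K) * real (card (R 0)) * (real (card (R 0)) + \<tau> ^ K * (sqrt (real w) * (1 + 2 / sqrt (real w)) ^ K))"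
proof -
  have "(\<Sum>b\<in>PiE {..K} R. \<Sum>b'\<in>PiE {..K} R. \<theta> ^ shared_steps K b b') \<le>
     (\<Sum>b\<in>PiE {..K} R. \<Sum>b'\<in>PiE {..K} R. \<tau> ^ K * (if b 0 = b' 0 then \<psi> ^ shared_steps K b b' else 0) + 1)"
  proof (intro sum_mono)
    fix b b' :: "nat \<Rightarrow> nat"
    show "\<theta> ^ shared_steps K b b' \<le> \<tau> ^ K * (if b 0 = b' 0 then \<psi> ^ shared_steps K b b' else 0) + 1"
    proof (cases "b 0 = b' 0")
      case True
      have "\<theta> ^ shared_steps K b b' \<le> (\<tau> * \<psi>) ^ shared_steps K b b'" using assms by (intro power_mono) auto
      also have "\<dots> = \<tau> ^ shared_steps K b b' * \<psi> ^ shared_steps K b b'" by (rule power_mult_distrib)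
      also have "\<dots> \<le> \<tau> ^ K * \<psi> ^ shared_steps K b b'"
        using assms shared_steps_le by (intro mult_right_mono power_increasing) auto
      finally show ?thesis using True by simp
    next
      case False
      then show ?thesis by (simp add: shared_steps_def)
    qed
  qed
  also have "\<dots> = \<tau> ^ K * (\<Sum>b\<in>PiE {..K} R. \<Sum>b'\<in>PiE {..K} R. if b 0 = b' 0 then \<psi> ^ shared_steps K b b' else 0)
      + real (card (PiE {..K} R)) ^ 2"
    by (simp add: sum.distrib sum_distrib_left power2_eq_square)
  also have "\<dots> \<le> \<tau> ^ K * (sqrt (real w) * (1 + 2 / sqrt (real w)) ^ K * real w ^ (2 * K) * real (card (R 0)))
      + real (card (PiE {..K} R)) ^ 2"
    by (intro add_right_mono mult_left_mono sum_shared_steps_same_start) (use assms in auto)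
  also have "card (PiE {..K} R) = card (R 0) * w ^ K"
  proof -
    have "(\<Prod>s\<le>K. card (R s)) = card (R 0) * (\<Prod>s\<in>{1..K}. card (R s))"
    proof -
      have "{..K} = insert 0 {1..K}" by auto
      then show ?thesis by simp
    qed
    also have "(\<Prod>s\<in>{1..K}. card (R s)) = w ^ K" using R by simp
    finally show ?thesis by (simp add: card_PiE)
  qed
  finally show ?thesis by (simp add: algebra_simps power2_eq_square power_mult)
qed

section \<open>The restricted matrix product\<close>

text \<open>The layers are cut into k blocks of length \<open>K * u + 2\<close>, followed by padding. In each block a walk
  chooses a gadget (coordinate \<open>(i, 0)\<close>), then makes K steps, each along a strand of u edges that is private
  to the gadget and to the values of two consecutive coordinates, and returns to a common vertex.\<close>

locale imm_blocks =
  fixes n d h k K u g w :: nat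
  assumes K: "K \<ge> 1" and u: "u \<ge> 2" and g: "g \<ge> 1" and w: "w \<ge> 1" and h1: "h \<ge> 1" and k1: "k \<ge> 1"
    and size: "g * w\<^sup>2 * h \<le> n" and length: "k * (K * u + 2) \<le> d"
begin

definition block_length :: nat where "block_length = K * u + 2"
definition coords :: "(nat \<times> nat) set" where "coords = {..<k} \<times> {..K}"
definition range_size :: "nat \<times> nat \<Rightarrow> nat" where "range_size = (\<lambda>(i, s). if s = 0 then g else w)"
text \<open>Node s of a block sits at offset \<open>s * u + 1\<close> and remembers the gadget and
  coordinate s; the \<open>u - 1\<close> vertices inside the strand to the next node remember both
  of its ends. So coordinate s lives from the strand before its node to the strand after it, and no
  layer needs more than \<open>g * w\<^sup>2\<close> vertices.\<close>

definition first_layer :: "nat \<times> nat \<Rightarrow> nat" where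
  "first_layer = (\<lambda>(i, s). i * block_length + (if s = 0 then 1 else (s - 1) * u + 2))"
definition last_layer :: "nat \<times> nat \<Rightarrow> nat" where
  "last_layer = (\<lambda>(i, s). i * block_length + (if s = 0 \<or> s = K then K * u + 1 else (s + 1) * u))"
definition x_layers :: "nat set" where "x_layers = (\<lambda>i. i * block_length + 1) ` {..<k}"
definition y_layer :: "nat \<times> nat \<times> nat \<Rightarrow> nat" where
  "y_layer = (\<lambda>(i, s, e). i * block_length + 1 + s * u + e)"
definition y_layers :: "nat set" where "y_layers = y_layer ` ({..<k} \<times> {..<K} \<times> {1..u})"
text \<open>The last edge of a strand enters a node where many strands meet, so its source has to
  determine it. All other marked edges are determined by their target.\<close>

definition target_pinned :: "nat \<Rightarrow> bool" where
  "target_pinned j \<longleftrightarrow> j \<in> x_layers \<or> j \<in> y_layer ` ({..<k} \<times> {..<K} \<times> {1..<u})"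

section \<open>Positions of layers inside a block\<close>

lemma block_index_unique:
  assumes "i * block_length + a = i' * block_length + b" "a < block_length" "b < block_length"
  shows "i = i' \<and> a = b"
proof -
  have "(i * block_length + a) div block_length = i" "(i' * block_length + b) div block_length = i'"
    using assms(2,3) by simp_all
  then have "i = i'" using assms(1) by metis
  then show ?thesis using assms(1) by simp
qed

lemma y_offset_less: "s < K \<Longrightarrow> e \<le> u \<Longrightarrow> 1 + s * u + e < block_length"
proof -
  assume "s < K" "e \<le> u"
  then have "(s + 1) * u \<le> K * u" by (intro mult_le_mono1) simp
  then show ?thesis using \<open>e \<le> u\<close> by (simp add: block_length_def)
qed

lemma step_index_unique:
  assumes "s * u + e = s' * u + e'" "1 \<le> e" "e \<le> u" "1 \<le> e'" "e' \<le> u"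
  shows "s = s' \<and> e = e'"
proof -
  obtain a a' where a: "e = Suc a" "e' = Suc a'" using assms(2,4) by (cases e; cases e') auto
  then have "(s * u + a) div u = s" "(s' * u + a') div u = s'" using assms(3,5) by simp_all
  moreover have "s * u + a = s' * u + a'" using assms(1) a by linarith
  ultimately have "s = s'" by metis
  then show ?thesis using assms(1) by simp
qed

lemma inj_y_layer: "inj_on y_layer ({..<k} \<times> {..<K} \<times> {1..u})"
proof (rule inj_onI)
  fix p p' assume p: "p \<in> {..<k} \<times> {..<K} \<times> {1..u}" "p' \<in> {..<k} \<times> {..<K} \<times> {1..u}" "y_layer p = y_layer p'"
  obtain i s e i' s' e' where pp: "p = (i, s, e)" "p' = (i', s', e')" by (metis prod_cases3)
  have "i * block_length + (1 + s * u + e) = i' * block_length + (1 + s' * u + e')"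
    using p by (simp add: pp y_layer_def)
  from block_index_unique[OF this] y_offset_less p have "i = i' \<and> 1 + s * u + e = 1 + s' * u + e'"
    by (simp add: pp)
  then show "p = p'" using step_index_unique[of s e s' e'] p by (simp add: pp)
qed

lemma layer_in_block:
  assumes "x \<in> coords"
  shows "\<exists>a b. first_layer x = fst x * block_length + a \<and> last_layer x = fst x * block_length + b \<and>
    1 \<le> a \<and> a \<le> b \<and> b < block_length"
proof -
  obtain i s where x: "x = (i, s)" by (cases x)
  have s: "s \<le> K" using assms by (simp add: coords_def x)
  define a where "a = (if s = 0 then 1 else (s - 1) * u + 2)"
  define b where "b = (if s = 0 \<or> s = K then K * u + 1 else (s + 1) * u)"
  have "a \<le> b"
  proof (cases "s = 0 \<or> s = K")
    case True
    have "(K - 1) * u + u = K * u" using K by (cases K) auto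
    then show ?thesis using True u K by (auto simp: a_def b_def)
  next
    case False
    have "(s - 1) * u + 2 * u = (s + 1) * u" using False by (cases s) auto
    then show ?thesis using False u by (auto simp: a_def b_def)
  qed
  moreover have "b < block_length"
  proof (cases "s = 0 \<or> s = K")
    case False
    then have "(s + 1) * u \<le> K * u" using s by (intro mult_le_mono1) simp
    then show ?thesis using False by (simp add: b_def block_length_def)
  qed (auto simp: b_def block_length_def)
  moreover have "1 \<le> a" by (simp add: a_def)
  ultimately show ?thesis by (intro exI[of _ a] exI[of _ b]) (simp add: first_layer_def last_layer_def x a_def b_def)
qed

lemma layer_coord_block:
  assumes "x \<in> coords" "first_layer x \<le> i * block_length + c" "i * block_length + c \<le> last_layer x" "c < block_length"
  shows "fst x = i"
proof -
  obtain a b where ab: "first_layer x = fst x * block_length + a" "last_layer x = fst x * block_length + b"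
    "1 \<le> a" "a \<le> b" "b < block_length" using layer_in_block[OF assms(1)] by blast
  have "\<not> fst x < i"
  proof
    assume "fst x < i"
    then have "(fst x + 1) * block_length \<le> i * block_length" by (intro mult_le_mono1) simp
    then show False using assms ab by simp
  qed
  moreover have "\<not> i < fst x"
  proof
    assume "i < fst x"
    then have "(i + 1) * block_length \<le> fst x * block_length" by (intro mult_le_mono1) simp
    then show False using assms ab by simp
  qed
  ultimately show ?thesis by simp
qed

lemma window_at:
  assumes "i < k" "c < block_length"
  shows "{x \<in> coords. first_layer x \<le> i * block_length + c \<and> i * block_length + c \<le> last_layer x} =
    (\<lambda>s. (i, s)) ` {s. s \<le> K \<and> (if s = 0 then 1 else (s - 1) * u + 2) \<le> c \<and>
      c \<le> (if s = 0 \<or> s = K then K * u + 1 else (s + 1) * u)}" (is "?L = ?R")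
proof
  show "?L \<subseteq> ?R"
  proof
    fix x assume x: "x \<in> ?L"
    then have "fst x = i" using layer_coord_block[of x i c] assms by simp
    then obtain s where "x = (i, s)" by (cases x) auto
    then show "x \<in> ?R" using x by (auto simp: coords_def first_layer_def last_layer_def)
  qed
  show "?R \<subseteq> ?L" using assms by (auto simp: coords_def first_layer_def last_layer_def)
qed

lemma window_before_block:
  assumes "i < k"
  shows "{x \<in> coords. first_layer x \<le> i * block_length \<and> i * block_length \<le> last_layer x} = {}"
proof -
  have "0 < block_length" by (simp add: block_length_def)
  from window_at[OF assms this] show ?thesis by auto
qed

lemma window_start:
  assumes "i < k"
  shows "{x \<in> coords. first_layer x \<le> i * block_length + 1 \<and> i * block_length + 1 \<le> last_layer x} = {(i, 0)}"
proof -
  have "1 < block_length" by (simp add: block_length_def)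
  from window_at[OF assms this] show ?thesis using u by auto
qed

lemma step_offset_bounds:
  assumes "s' * u + 2 \<le> 1 + s * u + e" "e \<le> u"
  shows "s' \<le> s"
proof (rule ccontr)
  assume "\<not> s' \<le> s"
  then have "(s + 1) * u \<le> s' * u" by (intro mult_le_mono1) simp
  then show False using assms by simp
qed

lemma window_inside:
  assumes "i < k" "s < K" "1 \<le> e" "e < u"
  shows "{x \<in> coords. first_layer x \<le> y_layer (i, s, e) \<and> y_layer (i, s, e) \<le> last_layer x} = {(i, 0), (i, s), (i, s + 1)}"
proof -
  let ?c = "1 + s * u + e"
  have c: "?c < block_length" using y_offset_less assms by simp
  have eq: "y_layer (i, s, e) = i * block_length + ?c" by (simp add: y_layer_def)
  have "{s'. s' \<le> K \<and> (if s' = 0 then 1 else (s' - 1) * u + 2) \<le> ?c \<and>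
      ?c \<le> (if s' = 0 \<or> s' = K then K * u + 1 else (s' + 1) * u)} = {0, s, s + 1}" (is "?S = _")
  proof (intro set_eqI iffI)
    fix s' assume s': "s' \<in> ?S"
    show "s' \<in> {0, s, s + 1}"
    proof (cases "s' = 0")
      case False
      then have "s' - 1 \<le> s" using s' assms by (intro step_offset_bounds[of "s' - 1" s e]) auto
      moreover have "s \<le> s'"
      proof (cases "s' = K")
        case False
        then have "1 + s * u + e \<le> (s' + 1) * u" using s' \<open>s' \<noteq> 0\<close> by auto
        then have "s * u < (s' + 1) * u" by simp
        then have "s < s' + 1" by (metis mult_less_cancel2)
        then show ?thesis by simp
      qed (use assms in simp)
      ultimately show ?thesis by auto
    qed simp
  next
    fix s' assume s': "s' \<in> {0, s, s + 1}"
    have 1: "?c \<le> K * u + 1"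
      using c by (simp add: block_length_def)
    have 2: "?c \<le> (s + 1) * u" "?c \<le> (s + 2) * u" using assms by auto
    have 3: "(s - 1) * u + 2 \<le> ?c" using assms by (cases s) auto
    show "s' \<in> ?S" using s' 1 2 3 assms by (cases "s' = 0"; cases "s' = s") auto
  qed
  then show ?thesis unfolding eq window_at[OF assms(1) c] by auto
qed

lemma window_node:
  assumes "i < k" "s < K"
  shows "{x \<in> coords. first_layer x \<le> y_layer (i, s, u) \<and> y_layer (i, s, u) \<le> last_layer x} = {(i, 0), (i, s + 1)}"
proof -
  let ?c = "1 + s * u + u"
  have c: "?c < block_length" using y_offset_less assms by simp
  have eq: "y_layer (i, s, u) = i * block_length + ?c" by (simp add: y_layer_def)
  have "{s'. s' \<le> K \<and> (if s' = 0 then 1 else (s' - 1) * u + 2) \<le> ?c \<and>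
      ?c \<le> (if s' = 0 \<or> s' = K then K * u + 1 else (s' + 1) * u)} = {0, s + 1}" (is "?S = _")
  proof (intro set_eqI iffI)
    fix s' assume s': "s' \<in> ?S"
    show "s' \<in> {0, s + 1}"
    proof (cases "s' = 0")
      case False
      then have "s' - 1 \<le> s" using s' assms by (intro step_offset_bounds[of "s' - 1" s u]) auto
      moreover have "s < s'"
      proof (cases "s' = K")
        case False
        then have "1 + (s + 1) * u \<le> (s' + 1) * u" using s' \<open>s' \<noteq> 0\<close> by auto
        then have "(s + 1) * u < (s' + 1) * u" by linarith
        then have "s + 1 < s' + 1" by (metis mult_less_cancel2)
        then show ?thesis by simp
      qed (use assms in simp)
      ultimately show ?thesis by auto
    qed simp
  next
    fix s' assume s': "s' \<in> {0, s + 1}"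
    have 1: "?c \<le> K * u + 1" using c by (simp add: block_length_def)
    have 2: "?c \<le> (s + 2) * u" using u by simp
    show "s' \<in> ?S" using s' 1 2 u assms by (cases "s' = 0") auto
  qed
  then show ?thesis unfolding eq window_at[OF assms(1) c] by auto
qed

lemma block_end:
  assumes "i < k" "c < block_length"
  shows "i * block_length + c < d"
proof -
  have "(i + 1) * block_length \<le> k * block_length" using assms(1) by (intro mult_le_mono1) simp
  then show ?thesis using assms(2) length by (simp add: block_length_def)
qed

lemma target_pinned_y:
  assumes "i < k" "s < K" "1 \<le> e" "e \<le> u"
  shows "target_pinned (y_layer (i, s, e)) \<longleftrightarrow> e < u"
proof
  assume "target_pinned (y_layer (i, s, e))"
  then consider i' where "i' < k" "y_layer (i, s, e) = i' * block_length + 1"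
    | i' s' e' where "i' < k" "s' < K" "1 \<le> e'" "e' < u" "y_layer (i, s, e) = y_layer (i', s', e')"
    unfolding target_pinned_def x_layers_def by auto
  then show "e < u"
  proof cases
    case 1
    then have "i * block_length + (1 + s * u + e) = i' * block_length + 1" by (simp add: y_layer_def)
    from block_index_unique[OF this] y_offset_less[of s e] assms show ?thesis by (auto simp: block_length_def)
  next
    case 2
    then have "(i, s, e) = (i', s', e')" using inj_y_layer assms by (intro inj_onD[OF inj_y_layer]) auto
    then show ?thesis using 2 by simp
  qed
next
  assume "e < u"
  then show "target_pinned (y_layer (i, s, e))" using assms unfolding target_pinned_def by auto
qed

text \<open>A layer remembers at most one gadget and two step values, all of one block; the layers
  between the blocks and after them remember nothing.\<close>

lemma ex_encoding:
  "\<exists>enc. (\<forall>j. inj_on (enc j) (PiE {x \<in> coords. first_layer x \<le> j \<and> j \<le> last_layer x} (\<lambda>x. {..<range_size x})) \<and>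
    enc j ` (PiE {x \<in> coords. first_layer x \<le> j \<and> j \<le> last_layer x} (\<lambda>x. {..<range_size x})) \<subseteq> {..<g * w\<^sup>2})"
proof -
  have "\<exists>f. inj_on f (PiE {x \<in> coords. first_layer x \<le> j \<and> j \<le> last_layer x} (\<lambda>x. {..<range_size x})) \<and>
    f ` (PiE {x \<in> coords. first_layer x \<le> j \<and> j \<le> last_layer x} (\<lambda>x. {..<range_size x})) \<subseteq> {..<g * w\<^sup>2}" for j
  proof -
    let ?W = "{x \<in> coords. first_layer x \<le> j \<and> j \<le> last_layer x}"
    have fin: "finite ?W" by (simp add: coords_def)
    have w2: "w \<le> w\<^sup>2" "1 \<le> w\<^sup>2" using w by (auto simp: power2_eq_square)
    have "(\<Prod>x\<in>?W. range_size x) \<le> g * w\<^sup>2"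
    proof (cases "?W = {}")
      case True
      then show ?thesis using g w2 by (simp only: prod.empty) (metis mult_le_mono mult_1)
    next
      case False
      then obtain x where x: "x \<in> ?W" by blast
      define i where "i = j div block_length"
      define c where "c = j mod block_length"
      have j: "j = i * block_length + c" "c < block_length"
        using div_mult_mod_eq[of j block_length] mod_less_divisor[of block_length j]
        by (simp_all add: i_def c_def) (simp add: block_length_def)
      have "fst x = i" using layer_coord_block[of x i c] x j by simp
      then have i: "i < k" using x by (auto simp: coords_def)
      have "c \<noteq> 0"
      proof
        assume "c = 0"
        then have "?W = {}" using window_before_block[OF i] j by simp
        then show False using x by blast
      qed
      \<comment> \<open>The shift by 2 below lets e range over 1, ..., u, so that the node that
        closes step s counts as \<open>e = u\<close> of that step.\<close>
      consider "c = 1" | s e where "s < K" "1 \<le> e" "e \<le> u" "c = 1 + s * u + e"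
      proof (cases "c = 1")
        case False
        define s where "s = (c - 2) div u"
        define e where "e = (c - 2) mod u + 1"
        have "c - 2 < K * u" using j(2) False \<open>c \<noteq> 0\<close> by (simp add: block_length_def)
        then have "s < K" by (simp add: s_def less_mult_imp_div_less)
        moreover have "c = 1 + s * u + e"
        proof -
          have "s * u + (c - 2) mod u = c - 2" by (simp add: s_def)
          then show ?thesis using False \<open>c \<noteq> 0\<close> by (simp add: e_def)
        qed
        moreover have "1 \<le> e" "e \<le> u" using u by (auto simp: e_def Suc_le_eq)
        ultimately show ?thesis using that(2) by blast
      qed (use that(1) in blast)
      then show ?thesis
      proof cases
        case 1
        then have "?W = {(i, 0)}" using window_start[OF i] j by simp
        then have "(\<Prod>x\<in>?W. range_size x) = g" by (simp add: range_size_def)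
        then show ?thesis using w2 by simp
      next
        case 2
        then have jy: "j = y_layer (i, s, e)" using j by (simp add: y_layer_def)
        show ?thesis
        proof (cases "e = u")
          case True
          have "?W = {(i, 0), (i, s + 1)}" using window_node[OF i 2(1)] jy True by simp
          then have "(\<Prod>x\<in>?W. range_size x) = g * w" by (simp add: range_size_def)
          then show ?thesis using w2 by simp
        next
          case False
          have W: "?W = {(i, 0), (i, s), (i, s + 1)}" using window_inside[OF i 2(1,2)] jy False 2 by simp
          show ?thesis
          proof (cases "s = 0")
            case True
            then have "(\<Prod>x\<in>?W. range_size x) = g * w" unfolding W by (simp add: range_size_def)
            then show ?thesis using w2 by simp
          next
            case False
            then have "(\<Prod>x\<in>?W. range_size x) = g * w\<^sup>2" unfolding W by (simp add: range_size_def power2_eq_square)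
            then show ?thesis by simp
          qed
        qed
      qed
    qed
    then have "card (PiE ?W (\<lambda>x. {..<range_size x})) \<le> card {..<g * w\<^sup>2}" by (simp add: card_PiE[OF fin])
    moreover have "finite (PiE ?W (\<lambda>x. {..<range_size x}))" using fin by (intro finite_PiE) auto
    ultimately obtain f where "f ` PiE ?W (\<lambda>x. {..<range_size x}) \<subseteq> {..<g * w\<^sup>2}" "inj_on f (PiE ?W (\<lambda>x. {..<range_size x}))"
      using card_le_inj[of "PiE ?W (\<lambda>x. {..<range_size x})" "{..<g * w\<^sup>2}"] finite_lessThan by blast
    then show ?thesis by (intro exI[of _ f] conjI)
  qed
  then have "\<forall>j. \<exists>f. inj_on f (PiE {x \<in> coords. first_layer x \<le> j \<and> j \<le> last_layer x} (\<lambda>x. {..<range_size x})) \<and>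
    f ` (PiE {x \<in> coords. first_layer x \<le> j \<and> j \<le> last_layer x} (\<lambda>x. {..<range_size x})) \<subseteq> {..<g * w\<^sup>2}"
    by blast
  from choice[OF this] show ?thesis .
qed

definition encode :: "nat \<Rightarrow> (nat \<times> nat \<Rightarrow> nat) \<Rightarrow> nat" where
  "encode = (SOME enc. \<forall>j. inj_on (enc j) (PiE {x \<in> coords. first_layer x \<le> j \<and> j \<le> last_layer x} (\<lambda>x. {..<range_size x})) \<and>
    enc j ` (PiE {x \<in> coords. first_layer x \<le> j \<and> j \<le> last_layer x} (\<lambda>x. {..<range_size x})) \<subseteq> {..<g * w\<^sup>2})"

lemma encode: "inj_on (encode j) (PiE {x \<in> coords. first_layer x \<le> j \<and> j \<le> last_layer x} (\<lambda>x. {..<range_size x}))"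
  "encode j ` (PiE {x \<in> coords. first_layer x \<le> j \<and> j \<le> last_layer x} (\<lambda>x. {..<range_size x})) \<subseteq> {..<g * w\<^sup>2}"
  using someI_ex[OF ex_encoding] unfolding encode_def[symmetric] by blast+

section \<open>The blocks as a windowed layered graph\<close>

lemma marked_cases:
  assumes "j \<in> x_layers \<union> y_layers"
  obtains i where "i < k" "j = i * block_length + 1" "target_pinned j"
  | i s e where "i < k" "s < K" "1 \<le> e" "e < u" "j = y_layer (i, s, e)" "target_pinned j"
  | i s where "i < k" "s < K" "j = y_layer (i, s, u)" "\<not> target_pinned j"
proof (cases "j \<in> x_layers")
  case True
  then show ?thesis using that(1) unfolding target_pinned_def x_layers_def by auto
next
  case False
  then obtain i s e where "i < k" "s < K" "1 \<le> e" "e \<le> u" "j = y_layer (i, s, e)"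
    using assms unfolding y_layers_def by auto
  then show ?thesis using target_pinned_y[of i s e] that(2)[of i s e] that(3)[of i s] by (cases "e = u") auto
qed

lemma y_layer_step_back:
  assumes "1 < e"
  shows "y_layer (i, s, e) - 1 = y_layer (i, s, e - 1)"
  using assms by (simp add: y_layer_def)

lemma window_before_step:
  assumes "i < k" "s < K"
  shows "{x \<in> coords. first_layer x \<le> y_layer (i, s, 1) - 1 \<and> y_layer (i, s, 1) - 1 \<le> last_layer x} = {(i, 0), (i, s)}"
proof (cases s)
  case 0
  then show ?thesis using window_start[OF assms(1)] by (simp add: y_layer_def)
next
  case (Suc s')
  then have "y_layer (i, s, 1) - 1 = y_layer (i, s', u)" by (simp add: y_layer_def)
  then show ?thesis using window_node[of i s'] assms Suc by simp
qed

text \<open>An edge depends on what its two ends remember together. Along a strand this is always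
  the gadget and both end values, even for the first and the last edge, each of which has a node at
  one end.\<close>

lemma y_windows:
  assumes "i < k" "s < K" "1 \<le> e" "e \<le> u"
  shows "{x \<in> coords. first_layer x \<le> y_layer (i, s, e) - 1 \<and> y_layer (i, s, e) - 1 \<le> last_layer x} \<union>
    {x \<in> coords. first_layer x \<le> y_layer (i, s, e) \<and> y_layer (i, s, e) \<le> last_layer x} = {(i, 0), (i, s), (i, s + 1)}"
proof (cases "e = 1")
  case True
  then show ?thesis using window_before_step[OF assms(1,2)] window_inside[OF assms(1,2), of 1] u by auto
next
  case e: False
  then have "y_layer (i, s, e) - 1 = y_layer (i, s, e - 1)" using assms by (intro y_layer_step_back) linarith
  moreover have "{x \<in> coords. first_layer x \<le> y_layer (i, s, e - 1) \<and> y_layer (i, s, e - 1) \<le> last_layer x}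
     = {(i, 0), (i, s), (i, s + 1)}"
    using e assms by (intro window_inside) auto
  moreover have "{x \<in> coords. first_layer x \<le> y_layer (i, s, e) \<and> y_layer (i, s, e) \<le> last_layer x}
     \<subseteq> {(i, 0), (i, s), (i, s + 1)}"
    using window_node[OF assms(1,2)] window_inside[OF assms(1,2), of e] assms by (cases "e = u") auto
  ultimately show ?thesis by (simp only: sup.absorb1)
qed

sublocale walks: windowed_walks n d h "g * w\<^sup>2" coords range_size first_layer last_layer encode
  "x_layers \<union> y_layers" target_pinned
proof
  show "finite coords" by (simp add: coords_def)
  have "1 * 2 \<le> k * (K * u + 2)" using k1 by (intro mult_le_mono) auto
  then show "1 \<le> d" using length by linarith
  show "1 \<le> g * w\<^sup>2" using g w by (simp add: Suc_le_eq)
  show "1 \<le> first_layer x \<and> first_layer x \<le> last_layer x \<and> last_layer x < d" if x: "x \<in> coords" for x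
  proof -
    obtain a b where ab: "first_layer x = fst x * block_length + a" "last_layer x = fst x * block_length + b"
      "1 \<le> a" "a \<le> b" "b < block_length" using layer_in_block[OF x] by blast
    moreover have "fst x < k" using x by (auto simp: coords_def)
    ultimately show ?thesis using block_end[of "fst x" b] by auto
  qed
  show "inj_on (encode j) (PiE {x \<in> coords. first_layer x \<le> j \<and> j \<le> last_layer x} (\<lambda>x. {..<range_size x}))"
   "encode j ` (PiE {x \<in> coords. first_layer x \<le> j \<and> j \<le> last_layer x} (\<lambda>x. {..<range_size x})) \<subseteq> {..<g * w\<^sup>2}" for j
    by (rule encode)+
  have range: "1 \<le> j \<and> j < d" if "j \<in> x_layers \<union> y_layers" for j
    using that
  proof (cases j rule: marked_cases)
    case (1 i)
    then show ?thesis using block_end[of i 1] by (auto simp: block_length_def)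
  next
    case (2 i s e)
    then show ?thesis using block_end[of i "1 + s * u + e"] y_offset_less[of s e] by (auto simp: y_layer_def add.assoc)
  next
    case (3 i s)
    then show ?thesis using block_end[of i "1 + s * u + u"] y_offset_less[of s u] by (auto simp: y_layer_def add.assoc)
  qed
  then show "1 \<le> j \<and> j \<le> d" if "j \<in> x_layers \<union> y_layers" for j using that by fastforce
  show "j < d" if "j \<in> x_layers \<union> y_layers" "target_pinned j" for j using range that by blast
  show "1 < j" if "j \<in> x_layers \<union> y_layers" "\<not> target_pinned j" for j
    using that by (cases j rule: marked_cases) (use u in \<open>auto simp: y_layer_def\<close>)
  show "j \<le> last_layer x" if j: "j \<in> x_layers \<union> y_layers" "target_pinned j"
    and x: "x \<in> coords" "first_layer x \<le> j - 1" "j - 1 \<le> last_layer x" for j x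
    using j(1)
  proof (cases j rule: marked_cases)
    case (1 i)
    then have "x \<in> {x \<in> coords. first_layer x \<le> i * block_length \<and> i * block_length \<le> last_layer x}" using x by simp
    then show ?thesis using window_before_block[OF 1(1)] by blast
  next
    case (2 i s e)
    then have "x \<in> {(i, 0), (i, s), (i, s + 1)}" using y_windows[of i s e] x by auto
    then show ?thesis using window_inside[OF 2(1-4)] 2(5) by auto
  next
    case (3 i s)
    then show ?thesis using j by simp
  qed
  show "first_layer x \<le> j - 1" if j: "j \<in> x_layers \<union> y_layers" "\<not> target_pinned j"
    and x: "x \<in> coords" "first_layer x \<le> j" "j \<le> last_layer x" for j x
    using j(1)
  proof (cases j rule: marked_cases)
    case (3 i s)
    have "x \<in> {(i, 0), (i, s + 1)}" using window_node[OF 3(1,2)] x 3(3) by auto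
    moreover have "j - 1 = y_layer (i, s, u - 1)" using 3(3) u y_layer_step_back[of u i s] by simp
    moreover have "{x \<in> coords. first_layer x \<le> y_layer (i, s, u - 1) \<and> y_layer (i, s, u - 1) \<le> last_layer x}
      = {(i, 0), (i, s), (i, s + 1)}"
      using 3(1,2) u by (intro window_inside) auto
    ultimately show ?thesis by auto
  qed (use j in auto)
qed (use h1 size in auto)

section \<open>Edges, Y-monomials of walks and their overlaps\<close>

lemma window_eq: "walks.window j = {x \<in> coords. first_layer x \<le> j \<and> j \<le> last_layer x}"
  by (simp add: walks.window_def)

lemma y_edge_eq:
  assumes "\<rho> \<in> walks.labelings" "c \<in> walks.codes" "c' \<in> walks.codes" "i < k" "s < K" "1 \<le> e" "e \<le> u"
  shows "walks.edge \<rho> (y_layer (i, s, e)) c = walks.edge \<rho> (y_layer (i, s, e)) c' \<longleftrightarrow>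
    c (i, 0) = c' (i, 0) \<and> c (i, s) = c' (i, s) \<and> c (i, s + 1) = c' (i, s + 1)"
proof -
  have "y_layer (i, s, e) \<in> x_layers \<union> y_layers" using assms(4-7) by (auto simp: y_layers_def)
  then have "y_layer (i, s, e) \<le> d" using walks.marked by blast
  then show ?thesis
    using walks.edge_eq_iff[OF assms(1) _ assms(2,3), of "y_layer (i, s, e)" "y_layer (i, s, e)"] y_windows[OF assms(4-7)]
    by (simp add: window_eq)
qed

lemma x_edge_eq:
  assumes "\<rho> \<in> walks.labelings" "c \<in> walks.codes" "c' \<in> walks.codes" "i < k"
  shows "walks.edge \<rho> (i * block_length + 1) c = walks.edge \<rho> (i * block_length + 1) c' \<longleftrightarrow> c (i, 0) = c' (i, 0)"
proof -
  have "i * block_length + 1 \<in> x_layers \<union> y_layers" using assms(4) by (auto simp: x_layers_def)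
  then have "i * block_length + 1 \<le> d" using walks.marked by blast
  moreover have "walks.window (i * block_length + 1 - 1) \<union> walks.window (i * block_length + 1) = {(i, 0)}"
    using window_before_block[OF assms(4)] window_start[OF assms(4)] by (simp only: window_eq add_diff_cancel_right' Un_empty_left)
  ultimately show ?thesis
    using walks.edge_eq_iff[OF assms(1) _ assms(2,3), of "i * block_length + 1" "i * block_length + 1"]
    by (simp only: ball_simps refl simp_thms)
qed

lemma layers_disjoint: "x_layers \<inter> y_layers = {}"
proof -
  have False if "i < k" "i' < k" "s < K" "1 \<le> e" "e \<le> u" "i * block_length + 1 = y_layer (i', s, e)" for i i' s e
  proof -
    have "i * block_length + 1 = i' * block_length + (1 + s * u + e)" using that by (simp add: y_layer_def)
    from block_index_unique[OF this] y_offset_less[of s e] that show False by (auto simp: block_length_def)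
  qed
  then show ?thesis unfolding x_layers_def y_layers_def by fastforce
qed

lemma card_y_layers: "finite y_layers" "card y_layers = k * (K * u)"
  unfolding y_layers_def using card_image[OF inj_y_layer] by (auto simp: card_cartesian_product)

definition beta :: "(nat \<times> nat \<Rightarrow> nat) \<Rightarrow> (nat \<times> nat \<Rightarrow> nat) \<Rightarrow> imm_var set" where
  "beta \<rho> c = (\<lambda>j. walks.edge \<rho> j c) ` y_layers"

lemma fst_edge: "fst (walks.edge \<rho> j c) = j"
  by (simp add: walks.edge_def)

lemma inj_edge: "inj_on (\<lambda>j. walks.edge \<rho> j c) J"
  by (intro inj_onI) (metis fst_edge)

lemma card_beta: "finite (beta \<rho> c)" "card (beta \<rho> c) = k * (K * u)"
  unfolding beta_def using card_image[OF inj_edge] card_y_layers by auto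

definition shared :: "(nat \<times> nat \<Rightarrow> nat) \<Rightarrow> (nat \<times> nat \<Rightarrow> nat) \<Rightarrow> nat" where
  "shared c c' = (\<Sum>i<k. shared_steps K (\<lambda>s\<in>{..K}. c (i, s)) (\<lambda>s\<in>{..K}. c' (i, s)))"

text \<open>Strands are shared entirely or not at all, so each shared step contributes exactly u
  common edges.\<close>

lemma card_beta_Int:
  assumes "\<rho> \<in> walks.labelings" "c \<in> walks.codes" "c' \<in> walks.codes"
  shows "card (beta \<rho> c \<inter> beta \<rho> c') = u * shared c c'"
proof -
  define agree where "agree i s \<longleftrightarrow> c (i, 0) = c' (i, 0) \<and> c (i, s) = c' (i, s) \<and> c (i, s + 1) = c' (i, s + 1)" for i s
  have "beta \<rho> c \<inter> beta \<rho> c' = (\<lambda>j. walks.edge \<rho> j c) ` {j \<in> y_layers. walks.edge \<rho> j c = walks.edge \<rho> j c'}"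
  proof (intro set_eqI iffI)
    fix v assume "v \<in> beta \<rho> c \<inter> beta \<rho> c'"
    then obtain j j' where j: "j \<in> y_layers" "v = walks.edge \<rho> j c" "v = walks.edge \<rho> j' c'"
      unfolding beta_def by blast
    then have "j = j'" using fst_edge by metis
    then show "v \<in> (\<lambda>j. walks.edge \<rho> j c) ` {j \<in> y_layers. walks.edge \<rho> j c = walks.edge \<rho> j c'}"
      using j by blast
  next
    fix v assume "v \<in> (\<lambda>j. walks.edge \<rho> j c) ` {j \<in> y_layers. walks.edge \<rho> j c = walks.edge \<rho> j c'}"
    then obtain j where "j \<in> y_layers" "v = walks.edge \<rho> j c" "v = walks.edge \<rho> j c'" by auto
    then show "v \<in> beta \<rho> c \<inter> beta \<rho> c'" unfolding beta_def by blast
  qed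
  then have "card (beta \<rho> c \<inter> beta \<rho> c') = card {j \<in> y_layers. walks.edge \<rho> j c = walks.edge \<rho> j c'}"
    using card_image[OF inj_edge] by simp
  also have "{j \<in> y_layers. walks.edge \<rho> j c = walks.edge \<rho> j c'} = y_layer ` (SIGMA i:{..<k}. {s. s < K \<and> agree i s} \<times> {1..u})"
    unfolding y_layers_def agree_def using y_edge_eq[OF assms] by auto
  also have "card \<dots> = card (SIGMA i:{..<k}. {s. s < K \<and> agree i s} \<times> {1..u})"
    by (rule card_image, rule inj_on_subset[OF inj_y_layer]) auto
  also have "\<dots> = (\<Sum>i<k. card {s. s < K \<and> agree i s} * u)"
    by (subst card_SigmaI) (auto simp: card_cartesian_product)
  also have "\<dots> = (\<Sum>i<k. shared_steps K (\<lambda>s\<in>{..K}. c (i, s)) (\<lambda>s\<in>{..K}. c' (i, s)) * u)"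
  proof (rule sum.cong[OF refl])
    fix i
    \<comment> \<open>Steps are numbered from 0 in \<open>y_layer\<close> and from 1 in
      \<open>shared_steps\<close>.\<close>
    have "{s \<in> {1..K}. (\<lambda>s\<in>{..K}. c (i, s)) 0 = (\<lambda>s\<in>{..K}. c' (i, s)) 0 \<and>
        (\<lambda>s\<in>{..K}. c (i, s)) (s - 1) = (\<lambda>s\<in>{..K}. c' (i, s)) (s - 1) \<and>
        (\<lambda>s\<in>{..K}. c (i, s)) s = (\<lambda>s\<in>{..K}. c' (i, s)) s} = Suc ` {s. s < K \<and> agree i s}"
    proof (intro set_eqI iffI)
      fix s assume "s \<in> {s \<in> {1..K}. (\<lambda>s\<in>{..K}. c (i, s)) 0 = (\<lambda>s\<in>{..K}. c' (i, s)) 0 \<and>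
        (\<lambda>s\<in>{..K}. c (i, s)) (s - 1) = (\<lambda>s\<in>{..K}. c' (i, s)) (s - 1) \<and>
        (\<lambda>s\<in>{..K}. c (i, s)) s = (\<lambda>s\<in>{..K}. c' (i, s)) s}"
      moreover from this have "s - 1 \<le> K" by auto
      ultimately show "s \<in> Suc ` {s. s < K \<and> agree i s}"
        by (intro image_eqI[of _ _ "s - 1"]) (auto simp: agree_def)
    qed (auto simp: agree_def)
    then show "card {s. s < K \<and> agree i s} * u = shared_steps K (\<lambda>s\<in>{..K}. c (i, s)) (\<lambda>s\<in>{..K}. c' (i, s)) * u"
      unfolding shared_steps_def by (simp add: card_image)
  qed
  finally show ?thesis unfolding shared_def by (simp add: sum_distrib_left mult.commute)
qed

lemma shared_le: "shared c c' \<le> k * K"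
proof -
  have "shared c c' \<le> (\<Sum>i<k. K)" unfolding shared_def by (intro sum_mono shared_steps_le)
  then show ?thesis by simp
qed

lemma card_beta_Un:
  assumes "\<rho> \<in> walks.labelings" "c \<in> walks.codes" "c' \<in> walks.codes"
  shows "card (beta \<rho> c \<union> beta \<rho> c') = 2 * (k * (K * u)) - u * shared c c'"
  using card_Un_Int[OF card_beta(1)[of \<rho> c] card_beta(1)[of \<rho> c']] card_beta(2)[of \<rho>] card_beta_Int[OF assms] by simp

lemma inj_beta:
  assumes "\<rho> \<in> walks.labelings"
  shows "inj_on (beta \<rho>) walks.codes"
proof (rule inj_onI)
  fix c c' assume c: "c \<in> walks.codes" "c' \<in> walks.codes" "beta \<rho> c = beta \<rho> c'"
  have "c x = c' x" if x: "x \<in> coords" for x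
  proof -
    obtain i s where xis: "x = (i, s)" "i < k" "s \<le> K" using x by (auto simp: coords_def)
    define s' where "s' = (if s = 0 then 0 else s - 1)"
    have s': "s' < K" "s = 0 \<or> s = s' + 1" using K xis by (auto simp: s'_def)
    have j: "y_layer (i, s', 1) \<in> y_layers" using xis s' u unfolding y_layers_def by auto
    then have "walks.edge \<rho> (y_layer (i, s', 1)) c \<in> beta \<rho> c'" using c(3) unfolding beta_def by blast
    then have "walks.edge \<rho> (y_layer (i, s', 1)) c = walks.edge \<rho> (y_layer (i, s', 1)) c'"
      unfolding beta_def using fst_edge by (metis (no_types, lifting) imageE)
    then show ?thesis using y_edge_eq[OF assms c(1,2) xis(2) s'(1), of 1] s'(2) u xis(1) by auto
  qed
  then show "c = c'" using c(1,2) unfolding walks.codes_def by (intro PiE_ext[of c coords _ c']) auto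
qed

text \<open>The choices of one gadget per block. They index the sets A of X-variables, and
  \<open>codes_from a\<close> are the walks through the chosen gadgets.\<close>

definition starts :: "(nat \<Rightarrow> nat) set" where "starts = {..<k} \<rightarrow>\<^sub>E {..<g}"
definition codes_from :: "(nat \<Rightarrow> nat) \<Rightarrow> (nat \<times> nat \<Rightarrow> nat) set" where
  "codes_from a = {c \<in> walks.codes. \<forall>i<k. c (i, 0) = a i}"

lemma card_starts: "finite starts" "card starts = g ^ k"
  by (auto simp: starts_def card_PiE intro: finite_PiE)

lemma codes_PiE: "walks.codes = PiE ({..<k} \<times> {..K}) (\<lambda>(i, s). if s = 0 then {..<g} else {..<w})"
  unfolding walks.codes_def unfolding coords_def range_size_def by (intro PiE_cong) auto

lemma codes_from_PiE:
  assumes "a \<in> starts"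
  shows "codes_from a = PiE ({..<k} \<times> {..K}) (\<lambda>(i, s). if s = 0 then {a i} else {..<w})"
proof (intro set_eqI iffI)
  fix c assume c: "c \<in> codes_from a"
  then have "c \<in> PiE ({..<k} \<times> {..K}) (\<lambda>(i, s). if s = 0 then {..<g} else {..<w})"
    by (simp add: codes_from_def codes_PiE)
  note cP = this
  show "c \<in> PiE ({..<k} \<times> {..K}) (\<lambda>(i, s). if s = 0 then {a i} else {..<w})"
  proof (rule PiE_I)
    fix p assume p: "p \<in> {..<k} \<times> {..K}"
    then show "c p \<in> (case p of (i, s) \<Rightarrow> if s = 0 then {a i} else {..<w})"
      using PiE_mem[OF cP p] c by (cases p) (auto simp: codes_from_def split: if_splits)
  qed (rule PiE_arb[OF cP])
next
  fix c assume c: "c \<in> PiE ({..<k} \<times> {..K}) (\<lambda>(i, s). if s = 0 then {a i} else {..<w})"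
  have c0: "c (i, 0) = a i" if "i < k" for i using PiE_mem[OF c, of "(i, 0)"] that by simp
  have "a i < g" if "i < k" for i using assms that by (auto simp: starts_def)
  note ag = this
  have "c \<in> PiE ({..<k} \<times> {..K}) (\<lambda>(i, s). if s = 0 then {..<g} else {..<w})"
  proof (intro PiE_I)
    fix p assume p: "p \<in> {..<k} \<times> {..K}"
    then show "c p \<in> (case p of (i, s) \<Rightarrow> if s = 0 then {..<g} else {..<w})"
      using PiE_mem[OF c p] ag by (cases p) (auto split: if_splits)
  qed (rule PiE_arb[OF c])
  then show "c \<in> codes_from a" using c0 by (simp add: codes_from_def codes_PiE)
qed

lemma card_codes_from:
  assumes "a \<in> starts"
  shows "card (codes_from a) = w ^ (k * K)"
proof -
  have "card (codes_from a) = (\<Prod>(i, s)\<in>{..<k} \<times> {..K}. if s = 0 then 1 else w)"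
    unfolding codes_from_PiE[OF assms] by (subst card_PiE) (auto intro!: prod.cong)
  also have "\<dots> = (\<Prod>i<k. \<Prod>s\<le>K. if s = 0 then 1 else w)" by (rule prod.cartesian_product[symmetric])
  also have "(\<Prod>s\<le>K. if s = 0 then 1 else w) = w ^ K"
  proof -
    have "{..K} = insert 0 {1..K}" by auto
    then show ?thesis by simp
  qed
  finally show ?thesis by (simp add: power_mult[symmetric] mult.commute)
qed

text \<open>The sum factorises over the blocks. In each block all walks use the same gadget, so the
  bound for equal starts applies with a single start.\<close>

lemma sum_shared_codes_from:
  fixes \<psi> :: real
  assumes "a \<in> starts" "0 \<le> \<psi>" "\<psi> \<le> real w + 1"
  shows "(\<Sum>c\<in>codes_from a. \<Sum>c'\<in>codes_from a. \<psi> ^ shared c c') \<le>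
    (sqrt (real w) * (1 + 2 / sqrt (real w)) ^ K * real w ^ (2 * K)) ^ k"
proof -
  let ?R = "\<lambda>(i :: nat, s :: nat). if s = 0 then {a i} else {..<w}"
  have "(\<Sum>c\<in>codes_from a. \<Sum>c'\<in>codes_from a. \<psi> ^ shared c c') =
    (\<Prod>i<k. \<Sum>b\<in>PiE {..K} (\<lambda>s. ?R (i, s)). \<Sum>b'\<in>PiE {..K} (\<lambda>s. ?R (i, s)). \<psi> ^ shared_steps K b b')"
    unfolding codes_from_PiE[OF assms(1)] shared_def power_sum
    by (rule sum_pairs_product_PiE) auto
  also have "\<dots> \<le> (\<Prod>i<k. sqrt (real w) * (1 + 2 / sqrt (real w)) ^ K * real w ^ (2 * K))"
  proof (rule prod_mono, intro conjI)
    fix i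
    show "0 \<le> (\<Sum>b\<in>PiE {..K} (\<lambda>s. ?R (i, s)). \<Sum>b'\<in>PiE {..K} (\<lambda>s. ?R (i, s)). \<psi> ^ shared_steps K b b')"
      using assms(2) by (intro sum_nonneg) auto
    have "(\<Sum>b\<in>PiE {..K} (\<lambda>s. ?R (i, s)). \<Sum>b'\<in>PiE {..K} (\<lambda>s. ?R (i, s)). \<psi> ^ shared_steps K b b')
      = (\<Sum>b\<in>PiE {..K} (\<lambda>s. ?R (i, s)). \<Sum>b'\<in>PiE {..K} (\<lambda>s. ?R (i, s)). if b 0 = b' 0 then \<psi> ^ shared_steps K b b' else 0)"
    proof (intro sum.cong refl)
      fix b b' assume b: "b \<in> PiE {..K} (\<lambda>s. ?R (i, s))" "b' \<in> PiE {..K} (\<lambda>s. ?R (i, s))"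
      have "b 0 \<in> ?R (i, 0)" "b' 0 \<in> ?R (i, 0)" using PiE_mem[OF b(1), of 0] PiE_mem[OF b(2), of 0] by auto
      then show "\<psi> ^ shared_steps K b b' = (if b 0 = b' 0 then \<psi> ^ shared_steps K b b' else 0)" by simp
    qed
    also have "\<dots> \<le> sqrt (real w) * (1 + 2 / sqrt (real w)) ^ K * real w ^ (2 * K) * real (card (?R (i, 0)))"
      by (rule sum_shared_steps_same_start[where R = "\<lambda>s. ?R (i, s)"]) (use assms w in auto)
    finally show "(\<Sum>b\<in>PiE {..K} (\<lambda>s. ?R (i, s)). \<Sum>b'\<in>PiE {..K} (\<lambda>s. ?R (i, s)). \<psi> ^ shared_steps K b b')
      \<le> sqrt (real w) * (1 + 2 / sqrt (real w)) ^ K * real w ^ (2 * K)" by simp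
  qed
  finally show ?thesis by simp
qed

lemma sum_shared_codes:
  fixes \<psi> \<theta> \<tau> :: real
  assumes "0 \<le> \<psi>" "\<psi> \<le> real w + 1" "\<tau> \<ge> 1" "0 \<le> \<theta>" "\<theta> \<le> \<tau> * \<psi>"
  shows "(\<Sum>c\<in>walks.codes. \<Sum>c'\<in>walks.codes. \<theta> ^ shared c c') \<le>
    (real w ^ (2 * K) * real g * (real g + \<tau> ^ K * (sqrt (real w) * (1 + 2 / sqrt (real w)) ^ K))) ^ k"
proof -
  let ?R = "\<lambda>(i :: nat, s :: nat). if s = 0 then {..<g} else {..<w}"
  have "(\<Sum>c\<in>walks.codes. \<Sum>c'\<in>walks.codes. \<theta> ^ shared c c') =
    (\<Prod>i<k. \<Sum>b\<in>PiE {..K} (\<lambda>s. ?R (i, s)). \<Sum>b'\<in>PiE {..K} (\<lambda>s. ?R (i, s)). \<theta> ^ shared_steps K b b')"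
    unfolding codes_PiE shared_def power_sum
    by (rule sum_pairs_product_PiE) auto
  also have "\<dots> \<le> (\<Prod>i<k. real w ^ (2 * K) * real g * (real g + \<tau> ^ K * (sqrt (real w) * (1 + 2 / sqrt (real w)) ^ K)))"
  proof (rule prod_mono, intro conjI)
    fix i
    show "0 \<le> (\<Sum>b\<in>PiE {..K} (\<lambda>s. ?R (i, s)). \<Sum>b'\<in>PiE {..K} (\<lambda>s. ?R (i, s)). \<theta> ^ shared_steps K b b')"
      using assms by (intro sum_nonneg) auto
    have "(\<Sum>b\<in>PiE {..K} (\<lambda>s. ?R (i, s)). \<Sum>b'\<in>PiE {..K} (\<lambda>s. ?R (i, s)). \<theta> ^ shared_steps K b b')
      \<le> real w ^ (2 * K) * real (card (?R (i, 0))) * (real (card (?R (i, 0))) + \<tau> ^ K * (sqrt (real w) * (1 + 2 / sqrt (real w)) ^ K))"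
      by (rule sum_shared_steps[where \<psi> = \<psi> and R = "\<lambda>s. ?R (i, s)"]) (use assms w in auto)
    then show "(\<Sum>b\<in>PiE {..K} (\<lambda>s. ?R (i, s)). \<Sum>b'\<in>PiE {..K} (\<lambda>s. ?R (i, s)). \<theta> ^ shared_steps K b b')
      \<le> real w ^ (2 * K) * real g * (real g + \<tau> ^ K * (sqrt (real w) * (1 + 2 / sqrt (real w)) ^ K))" by simp
  qed
  finally show ?thesis by simp
qed

end

section \<open>The bound for fixed parameters\<close>

lemma power_one_plus_le_2:
  fixes y :: real
  assumes "0 \<le> y" "real m * y \<le> 1 / 2"
  shows "(1 + y) ^ m \<le> 2"
proof -
  have "(1 + y) ^ m \<le> exp y ^ m" using assms(1) exp_ge_add_one_self[of y] by (intro power_mono) auto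
  also have "\<dots> = exp (real m * y)" by (simp add: exp_of_nat_mult)
  also have "\<dots> \<le> exp (1 / 2)" using assms by simp
  also have "\<dots> \<le> 1 + 1 / 2 + (1 / 2)\<^sup>2" by (rule exp_bound) auto
  also have "\<dots> \<le> 2" by (simp add: power2_eq_square)
  finally show ?thesis .
qed

text \<open>At the level \<open>N / (1 + x)\<close> a random set has density
  \<open>1 / (1 + x)\<close>, and \<open>(N - l) / l\<close>, the growth of the levels, is about x.
  The bound \<open>100 * D\<^sup>2 \<le> N\<close> keeps the errors from rounding and from a move by
  D elements within constant factors even in powers up to \<open>2 * D\<close>; \<open>gap\<close>
  keeps the level \<open>l + D\<close> at or below the middle.\<close>

lemma middle_level_bounds:
  fixes x :: real and N l D :: nat
  assumes x: "1 < x" "x \<le> 2" and D: "1 \<le> D" and N: "100 * D\<^sup>2 \<le> N" and gap: "6 * real D \<le> real N * (x - 1)"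
    and l: "real l \<le> real N / (1 + x)" "real N / (1 + x) < real l + 1"
  shows "2 * (l + D) \<le> N" "x / (1 + x) \<le> real (N - l) / real N"
    "1 / 4 \<le> (real (N - l - D) / real (N - l)) ^ (2 * D)"
    "\<And>m. m \<le> 2 * D \<Longrightarrow> (real (N - l) / real (l + 1)) ^ m \<le> 2 * x ^ m"
    "(real (l + D) / real N) ^ (2 * D) \<le> 2 / (1 + x) ^ (2 * D)"
proof -
  have D2: "real D \<le> real D ^ 2" using D by (simp add: power2_eq_square)
  have N': "100 * real D ^ 2 \<le> real N" using N by (metis of_nat_le_iff of_nat_mult of_nat_numeral of_nat_power)
  have Npos: "real N \<ge> 100" using N' D2 D by linarith
  have "2 * (real l + real D) \<le> 2 * (real N / (1 + x)) + 2 * real D" using l by simp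
  also have "\<dots> \<le> real N"
  proof -
    have "2 * real D * (1 + x) \<le> 2 * real D * 3" using x by (intro mult_left_mono) auto
    then have "2 * real D * (1 + x) \<le> real N * (x - 1)" using gap by linarith
    then show ?thesis using x by (simp add: field_simps)
  qed
  finally have a: "2 * (real l + real D) \<le> real N" .
  then show a': "2 * (l + D) \<le> N" by (metis of_nat_add of_nat_le_iff of_nat_mult of_nat_numeral)
  have Nl: "real (N - l) = real N - real l" using a' by (simp add: of_nat_diff)
  have NlD: "real (N - l - D) = real N - real l - real D" using a' by (simp add: of_nat_diff)
  show "x / (1 + x) \<le> real (N - l) / real N"
  proof -
    have "x / (1 + x) = 1 - 1 / (1 + x)" using x by (simp add: field_simps)
    also have "\<dots> \<le> 1 - real l / real N"
      using l(1) Npos x by (simp add: field_simps)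
    also have "\<dots> = real (N - l) / real N" using Npos by (simp add: Nl field_simps)
    finally show ?thesis .
  qed
  have half: "real N / 2 \<le> real (N - l)" using a by (simp add: Nl)
  have "1 / 4 \<le> 1 + real (2 * D) * (- (real D / real (N - l)))"
  proof -
    have "real (2 * D) * (real D / real (N - l)) \<le> 2 * real D ^ 2 / (real N / 2)"
      using half Npos by (simp add: power2_eq_square field_simps mult_left_mono)
    also have "\<dots> \<le> 3 / 4" using N' Npos by (simp add: field_simps)
    finally show ?thesis by simp
  qed
  also have "\<dots> \<le> (1 + (- (real D / real (N - l)))) ^ (2 * D)"
    by (rule Bernoulli_inequality) (use a half Npos in \<open>simp add: Nl field_simps\<close>)
  also have "1 + (- (real D / real (N - l))) = real (N - l - D) / real (N - l)"
  proof -
    have "real (N - l - D) = real (N - l) - real D" by (simp only: Nl NlD)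
    then show ?thesis using half Npos by (simp only: diff_divide_distrib) simp
  qed
  finally show "1 / 4 \<le> (real (N - l - D) / real (N - l)) ^ (2 * D)" .
  show "(real (N - l) / real (l + 1)) ^ m \<le> 2 * x ^ m" if m: "m \<le> 2 * D" for m
  proof -
    have "real (N - l) / real (l + 1) \<le> (real N * x / (1 + x) + 1) / (real N / (1 + x))"
    proof (rule frac_le)
      have "real N / (1 + x) - 1 \<le> real l" using l by simp
      then have "real (N - l) \<le> real N - (real N / (1 + x) - 1)" by (simp add: Nl)
      also have "\<dots> = real N * x / (1 + x) + 1" using x by (simp add: field_simps)
      finally show "real (N - l) \<le> real N * x / (1 + x) + 1" .
    qed (use l x Npos in auto)
    also have "\<dots> = x + (1 + x) / real N"
    proof -
      have "(a * x / y + 1) / (a / y) = x + y / a" if "a > 0" "y > 0" for a y :: real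
        using that by (simp add: field_simps)
      from this[of "real N" "1 + x"] show ?thesis using x Npos by simp
    qed
    also have "\<dots> \<le> x + 2 * x / real N" using x Npos by (intro add_left_mono divide_right_mono) auto
    also have "\<dots> = x * (1 + 2 / real N)" by (simp add: distrib_left)
    finally have "(real (N - l) / real (l + 1)) ^ m \<le> (x * (1 + 2 / real N)) ^ m"
      by (rule power_mono) auto
    also have "\<dots> = x ^ m * (1 + 2 / real N) ^ m" by (rule power_mult_distrib)
    also have "\<dots> \<le> x ^ m * 2"
    proof (rule mult_left_mono, rule power_one_plus_le_2)
      have "real m * (2 / real N) \<le> real (2 * D) * (2 / real N)" using m Npos by (intro mult_right_mono) auto
      also have "\<dots> \<le> 1 / 2"
      proof -
        have "8 * real D \<le> real N" using N' D2 D by linarith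
        then show ?thesis using Npos by (simp add: field_simps)
      qed
      finally show "real m * (2 / real N) \<le> 1 / 2" .
    qed (use x Npos in auto)
    finally show ?thesis by (simp add: mult.commute)
  qed
  have "real (l + D) / real N \<le> 1 / (1 + x) * (1 + 3 * real D / real N)"
  proof -
    have "real (l + D) \<le> real N / (1 + x) + real D" using l by simp
    also have "\<dots> \<le> real N / (1 + x) + 3 * real D / (1 + x)"
    proof -
      have "real D * (1 + x) \<le> real D * 3" using x by (intro mult_left_mono) auto
      then have "real D \<le> 3 * real D / (1 + x)" using x by (simp add: field_simps)
      then show ?thesis by simp
    qed
    finally have "real (l + D) / real N \<le> (real N / (1 + x) + 3 * real D / (1 + x)) / real N"
      by (rule divide_right_mono) simp
    also have "\<dots> = 1 / (1 + x) * (1 + 3 * real D / real N)"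
    proof -
      have "(a / y + 3 * b / y) / a = 1 / y * (1 + 3 * b / a)" if "a > 0" "y > 0" for a b y :: real
        using that by (simp add: field_simps)
      from this[of "real N" "1 + x" "real D"] show ?thesis using x Npos by simp
    qed
    finally show ?thesis .
  qed
  then have "(real (l + D) / real N) ^ (2 * D) \<le> (1 / (1 + x) * (1 + 3 * real D / real N)) ^ (2 * D)"
    by (rule power_mono) auto
  also have "\<dots> = (1 / (1 + x)) ^ (2 * D) * (1 + 3 * real D / real N) ^ (2 * D)" by (rule power_mult_distrib)
  also have "\<dots> \<le> (1 / (1 + x)) ^ (2 * D) * 2"
  proof (rule mult_left_mono, rule power_one_plus_le_2)
    show "real (2 * D) * (3 * real D / real N) \<le> 1 / 2" using N' Npos by (simp add: field_simps power2_eq_square)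
  qed (use x Npos in auto)
  finally show "(real (l + D) / real N) ^ (2 * D) \<le> 2 / (1 + x) ^ (2 * D)" by (simp add: power_divide)
qed

lemma prod_set_monomial: "finite B \<Longrightarrow> (\<Prod>v\<in>B. set_monomial {v} U) = set_monomial B U"
proof (induction B rule: finite_induct)
  case empty
  then show ?case by (simp add: set_monomial_def)
next
  case (insert v B)
  then show ?case using set_monomial_mult[of "{v}" U B] by simp
qed

context imm_blocks
begin

section \<open>The substitution for a choice of gadgets\<close>

definition x_edges_from :: "(nat \<times> nat \<Rightarrow> nat) \<Rightarrow> (nat \<Rightarrow> nat) \<Rightarrow> imm_var set" where
  "x_edges_from \<rho> a = {walks.edge \<rho> j c | j c. j \<in> x_layers \<and> c \<in> codes_from a}"

text \<open>The value \<open>undefined\<close> off \<open>imm_vars\<close> is there because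
  \<open>agree_on_cube\<close> ranges over extensional assignments. The edges that become 1 are the
  returns to the common vertices and the padding.\<close>

definition theta :: "(nat \<times> nat \<Rightarrow> nat) \<Rightarrow> (nat \<Rightarrow> nat) \<Rightarrow> imm_var set \<Rightarrow> imm_var \<Rightarrow> 'a::field poly" where
  "theta \<rho> a U v = (if v \<notin> imm_vars n d then [:undefined:]
     else if v \<in> walks.edges \<rho> y_layers then [:set_monomial {v} U:]
     else if v \<in> walks.edges \<rho> x_layers then (if v \<in> x_edges_from \<rho> a then [:0, 1:] else 0)
     else if v \<in> walks.edges \<rho> {1..d} then 1 else 0)"

lemma edge_in_edges:
  assumes "c \<in> walks.codes"
  shows "walks.edge \<rho> j c \<in> walks.edges \<rho> J \<longleftrightarrow> j \<in> J"
proof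
  assume "walks.edge \<rho> j c \<in> walks.edges \<rho> J"
  then obtain j' c' where "j' \<in> J" "walks.edge \<rho> j c = walks.edge \<rho> j' c'" unfolding walks.edges_def by auto
  then show "j \<in> J" using fst_edge by metis
qed (use assms in \<open>auto simp: walks.edges_def\<close>)

lemma edges_mono: "J \<subseteq> J' \<Longrightarrow> walks.edges \<rho> J \<subseteq> walks.edges \<rho> J'"
  unfolding walks.edges_def by blast

lemma layers_subset: "x_layers \<subseteq> {1..d}" "y_layers \<subseteq> {1..d}"
  using walks.marked by auto

lemma eval_edge:
  assumes "\<rho> \<in> walks.labelings" "c \<in> walks.codes" "j \<in> {1..d}"
  shows "poly (theta \<rho> a U (walks.edge \<rho> j c)) 1 = (if j \<in> y_layers then set_monomial {walks.edge \<rho> j c} U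
    else if j \<in> x_layers \<and> walks.edge \<rho> j c \<notin> x_edges_from \<rho> a then 0 else 1)"
  using walks.edge_in_imm_vars[OF assms(1), of j c] assms
  by (auto simp: theta_def edge_in_edges[OF assms(2)])

text \<open>By \<open>x_edge_eq\<close> an X-edge is determined by its gadget, so at
  \<open>z = 1\<close> a walk with a gadget other than that of a meets an X-edge with value 0. In
  the remaining walks only the Y-edges are left as variables.\<close>

lemma eval_IMM:
  assumes \<rho>: "\<rho> \<in> walks.labelings"
  shows "mpoly_eval (\<lambda>v. poly (theta \<rho> a U v) 1) (IMM n d) = (\<Sum>c\<in>codes_from a. set_monomial (beta \<rho> c) U :: 'a::field)"
proof -
  let ?\<alpha> = "\<lambda>v. poly (theta \<rho> a U v) 1 :: 'a"
  have "mpoly_eval ?\<alpha> (IMM n d) = (\<Sum>c\<in>walks.codes. \<Prod>j = 1..d. ?\<alpha> (walks.edge \<rho> j c))"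
  proof (rule walks.walk_sum[OF \<rho>])
    fix v assume "v \<in> imm_vars n d" "v \<notin> walks.edges \<rho> {1..d}"
    moreover from this have "v \<notin> walks.edges \<rho> y_layers" "v \<notin> walks.edges \<rho> x_layers"
      using edges_mono[OF layers_subset(1)] edges_mono[OF layers_subset(2)] by blast+
    ultimately show "?\<alpha> v = 0" by (simp add: theta_def)
  qed
  also have "\<dots> = (\<Sum>c\<in>codes_from a. \<Prod>j = 1..d. ?\<alpha> (walks.edge \<rho> j c))"
  proof (rule sum.mono_neutral_right)
    show "\<forall>c\<in>walks.codes - codes_from a. (\<Prod>j = 1..d. ?\<alpha> (walks.edge \<rho> j c)) = 0"
    proof
      fix c assume c: "c \<in> walks.codes - codes_from a"
      then obtain i where i: "i < k" "c (i, 0) \<noteq> a i" unfolding codes_from_def by auto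
      define j where "j = i * block_length + 1"
      have j: "j \<in> x_layers" using i by (auto simp: x_layers_def j_def)
      have "walks.edge \<rho> j c \<notin> x_edges_from \<rho> a"
      proof
        assume "walks.edge \<rho> j c \<in> x_edges_from \<rho> a"
        then obtain j' c' where c': "c' \<in> codes_from a" "walks.edge \<rho> j c = walks.edge \<rho> j' c'"
          unfolding x_edges_from_def by auto
        then have "walks.edge \<rho> j c = walks.edge \<rho> j c'" using fst_edge by metis
        then have "c (i, 0) = c' (i, 0)" using x_edge_eq[OF \<rho> _ _ i(1), of c c'] c c' by (auto simp: codes_from_def j_def)
        then show False using i c' by (auto simp: codes_from_def)
      qed
      then have "?\<alpha> (walks.edge \<rho> j c) = 0"
      proof -
        have "j \<in> {1..d}" "j \<notin> y_layers" using j layers_disjoint layers_subset by blast+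
        then show ?thesis using eval_edge[OF \<rho>, of c j a U] c j \<open>walks.edge \<rho> j c \<notin> x_edges_from \<rho> a\<close> by simp
      qed
      then show "(\<Prod>j = 1..d. ?\<alpha> (walks.edge \<rho> j c)) = 0"
        using j layers_subset by (intro prod_zero) (auto simp: subset_iff)
    qed
  qed (auto simp: codes_from_def walks.finite_codes)
  also have "\<dots> = (\<Sum>c\<in>codes_from a. set_monomial (beta \<rho> c) U)"
  proof (rule sum.cong[OF refl])
    fix c assume c: "c \<in> codes_from a"
    then have cc: "c \<in> walks.codes" by (simp add: codes_from_def)
    have "(\<Prod>j = 1..d. ?\<alpha> (walks.edge \<rho> j c)) = (\<Prod>j = 1..d. if j \<in> y_layers then set_monomial {walks.edge \<rho> j c} U else 1)"
    proof (rule prod.cong[OF refl])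
      fix j assume j: "j \<in> {1..d}"
      have "walks.edge \<rho> j c \<in> x_edges_from \<rho> a" if "j \<in> x_layers" using that c unfolding x_edges_from_def by blast
      then show "?\<alpha> (walks.edge \<rho> j c) = (if j \<in> y_layers then set_monomial {walks.edge \<rho> j c} U else 1)"
        using eval_edge[OF \<rho> cc j, of a U, where 'a = 'a] by (cases "j \<in> x_layers") simp_all
    qed
    also have "\<dots> = (\<Prod>j\<in>{1..d} \<inter> y_layers. set_monomial {walks.edge \<rho> j c} U)"
      by (rule prod.inter_restrict[symmetric]) simp
    also have "{1..d} \<inter> y_layers = y_layers" using layers_subset by blast
    also have "(\<Prod>j\<in>y_layers. set_monomial {walks.edge \<rho> j c} U) = (\<Prod>v\<in>beta \<rho> c. set_monomial {v} U)"
      unfolding beta_def by (simp add: prod.reindex[OF inj_edge])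
    also have "\<dots> = set_monomial (beta \<rho> c) U" by (rule prod_set_monomial[OF card_beta(1)])
    finally show "(\<Prod>j = 1..d. ?\<alpha> (walks.edge \<rho> j c)) = set_monomial (beta \<rho> c) U" .
  qed
  finally show ?thesis .
qed

text \<open>All walks of \<open>codes_from a\<close> use the same X-edge in a given block. This
  yields the degree bound \<open>r * k\<close> in z.\<close>

lemma card_x_edges_from:
  assumes \<rho>: "\<rho> \<in> walks.labelings"
  shows "finite (x_edges_from \<rho> a) \<and> card (x_edges_from \<rho> a) \<le> k"
proof (cases "codes_from a = {}")
  case True
  then show ?thesis by (simp add: x_edges_from_def)
next
  case False
  then obtain c0 where c0: "c0 \<in> codes_from a" by blast
  have "x_edges_from \<rho> a \<subseteq> (\<lambda>i. walks.edge \<rho> (i * block_length + 1) c0) ` {..<k}"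
  proof
    fix v assume "v \<in> x_edges_from \<rho> a"
    then obtain i c where i: "i < k" "c \<in> codes_from a" "v = walks.edge \<rho> (i * block_length + 1) c"
      unfolding x_edges_from_def x_layers_def by auto
    then have "v = walks.edge \<rho> (i * block_length + 1) c0"
      using x_edge_eq[OF \<rho> _ _ i(1), of c c0] c0 by (auto simp: codes_from_def)
    then show "v \<in> (\<lambda>i. walks.edge \<rho> (i * block_length + 1) c0) ` {..<k}" using i by blast
  qed
  then show ?thesis
    using card_mono[of "(\<lambda>i. walks.edge \<rho> (i * block_length + 1) c0) ` {..<k}" "x_edges_from \<rho> a"]
      card_image_le[of "{..<k}" "\<lambda>i. walks.edge \<rho> (i * block_length + 1) c0"]
      finite_subset[of "x_edges_from \<rho> a" "(\<lambda>i. walks.edge \<rho> (i * block_length + 1) c0) ` {..<k}"]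
    by auto
qed

text \<open>Setting z to 1 turns \<open>theta\<close> into a point of the cube, so the agreement
  with \<open>IMM\<close> applies; for other values of z nothing is known.\<close>

lemma eval_circuit:
  assumes \<rho>: "\<rho> \<in> walks.labelings" and agree: "agree_on_cube (imm_vars n d) P (IMM n d)"
  shows "poly (hom_eval (\<lambda>x. [:x:]) (theta \<rho> a U) P) 1 = (\<Sum>c\<in>codes_from a. set_monomial (beta \<rho> c) U :: 'a::field)"
proof -
  have "(\<lambda>v. poly (theta \<rho> a U v) 1 :: 'a) \<in> imm_vars n d \<rightarrow>\<^sub>E {0, 1}"
  proof (rule PiE_I)
    fix v
    show "poly (theta \<rho> a U v) 1 \<in> {0, 1 :: 'a}" if "v \<in> imm_vars n d"
      using that by (simp add: theta_def set_monomial_def)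
    show "poly (theta \<rho> a U v) 1 = (undefined :: 'a)" if "v \<notin> imm_vars n d"
      using that by (simp add: theta_def)
  qed
  then show ?thesis
    using agree eval_IMM[OF \<rho>, of a U] unfolding agree_on_cube_def by (simp add: poly_hom_eval_const)
qed

lemma degree_circuit:
  assumes \<rho>: "\<rho> \<in> walks.labelings" and "individual_degree_le P r"
  shows "degree (hom_eval (\<lambda>x. [:x:]) (theta \<rho> a U) P :: 'a::field poly) \<le> r * k"
proof -
  have "degree (hom_eval (\<lambda>x. [:x:]) (theta \<rho> a U) P) \<le> r * card (x_edges_from \<rho> a)"
    by (rule degree_hom_eval_le[OF assms(2)]) (use card_x_edges_from[OF \<rho>] in \<open>auto simp: theta_def\<close>)
  also have "\<dots> \<le> r * k" using card_x_edges_from[OF \<rho>, of a] by (intro mult_le_mono2) blast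
  finally show ?thesis .
qed

text \<open>A product gate that does not survive either contains a variable off the graph, which is
  replaced by 0, or has at most t marked variables, in particular at most t from Y. This is the
  support condition of \<open>depth_four_span\<close>.\<close>

lemma circuit_span:
  fixes C :: "(imm_var, 'a::field) circuit"
  assumes \<rho>: "\<rho> \<in> walks.labelings" and C: "circuit_over (imm_vars n d) C" "depth_four C" "formal_degree C = d"
    "individual_degree_le (circuit_poly C) r" "agree_on_cube (imm_vars n d) (circuit_poly C) (IMM n d)" and "t \<ge> 1"
    and killed: "\<And>i js. i < length C \<Longrightarrow> C ! i = Prod js \<Longrightarrow> \<not> walks.survives \<rho> t (product_vars C js)"
  defines "Y \<equiv> walks.edges \<rho> y_layers"
  shows "\<exists>G :: (imm_var set \<Rightarrow> 'a) set. finite G \<and>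
    real (card G) \<le> real (length C) * (2 ^ (r * k) * (3 / 2) ^ (2 * d div t + 1)) * real (\<Sum>i\<le>l + t * (r * k). card Y choose i) \<and>
    (\<forall>a S. S \<subseteq> Y \<longrightarrow> card S = l \<longrightarrow> (\<lambda>U. \<Sum>\<beta>\<in>beta \<rho> ` codes_from a. set_monomial (S \<union> \<beta>) U) \<in> fun_vs.span G)"
proof -
  have finY: "finite Y" unfolding Y_def by (rule walks.finite_edges) (rule card_y_layers)
  have YV: "Y \<subseteq> imm_vars n d"
    unfolding Y_def walks.edges_def using walks.edge_in_imm_vars[OF \<rho>] layers_subset(2) by auto
  define \<eta> :: "(nat \<Rightarrow> nat) \<Rightarrow> imm_var \<Rightarrow> 'a poly" where "\<eta> a v = theta \<rho> a {} v" for a v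
  \<comment> \<open>At \<open>z = 0\<close> an X-edge vanishes whether a selects it or not; hence
    the constant terms do not depend on a.\<close>
  define \<zeta> :: "imm_var \<Rightarrow> 'a" where "\<zeta> v = (if v \<in> walks.edges \<rho> x_layers then 0 else if v \<in> walks.edges \<rho> {1..d} then 1 else 0)" for v
  have "\<exists>G :: (imm_var set \<Rightarrow> 'a) set. finite G \<and>
    real (card G) \<le> real (length C) * (2 ^ (r * k) * (3 / 2) ^ (2 * d div t + 1)) * real (\<Sum>i\<le>l + t * (r * k). card Y choose i) \<and>
    (\<forall>a S. (\<forall>U. degree (hom_eval (\<lambda>x. [:x:]) (theta \<rho> a U) (circuit_poly C)) \<le> r * k) \<longrightarrow> S \<subseteq> Y \<longrightarrow> card S = l \<longrightarrow>
      (\<lambda>U. set_monomial S U * poly (hom_eval (\<lambda>x. [:x:]) (theta \<rho> a U) (circuit_poly C)) 1) \<in> fun_vs.span G)"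
  proof (rule depth_four_span[where V = "imm_vars n d" and \<eta> = \<eta> and \<zeta> = \<zeta>])
    show "theta \<rho> a U v = [:set_monomial {v} U:]" if "v \<in> Y" for a U v
      using that YV unfolding Y_def by (auto simp: theta_def)
    show "theta \<rho> a U v = \<eta> a v" if "v \<in> imm_vars n d - Y" for a U v
      using that unfolding Y_def \<eta>_def by (auto simp: theta_def)
    show "coeff (\<eta> a v) 0 = \<zeta> v" if "v \<in> imm_vars n d - Y" for a v
      using that unfolding Y_def \<eta>_def \<zeta>_def by (auto simp: theta_def)
    fix i js assume i: "i < length C" "C ! i = Prod js"
    have sub: "product_vars C js \<subseteq> imm_vars n d"
    proof
      fix v assume "v \<in> product_vars C js"
      then obtain j where j: "j \<in> set js" "C ! j = Var v" by (auto simp: product_vars_def)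
      have "j < length C" using C(1) i j(1) unfolding circuit_over_def
        by (metis children.simps(4) order.strict_trans)
      then show "v \<in> imm_vars n d" using C(1) j(2) nth_mem unfolding circuit_over_def by metis
    qed
    show "(\<exists>v\<in>product_vars C js. \<forall>a U. theta \<rho> a U v = (0 :: 'a poly)) \<or> card (product_vars C js \<inter> Y) \<le> t"
    proof (cases "product_vars C js \<subseteq> walks.edges \<rho> {1..d}")
      case True
      have fin: "finite (product_vars C js)" using card_product_vars by blast
      have "card (product_vars C js \<inter> Y) \<le> card {v \<in> product_vars C js. fst v \<in> x_layers \<union> y_layers}"
        by (rule card_mono) (use fin in \<open>auto simp: Y_def walks.edges_def walks.edge_def\<close>)
      also have "\<dots> \<le> t" using killed[OF i] True unfolding walks.survives_def by simp
      finally show ?thesis by blast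
    next
      case False
      then obtain v where v: "v \<in> product_vars C js" "v \<notin> walks.edges \<rho> {1..d}" by blast
      then have "v \<notin> walks.edges \<rho> y_layers" "v \<notin> walks.edges \<rho> x_layers"
        using edges_mono[OF layers_subset(1)] edges_mono[OF layers_subset(2)] by blast+
      then have "\<forall>a U. theta \<rho> a U v = (0 :: 'a poly)" using v sub by (auto simp: theta_def)
      then show ?thesis using v by blast
    qed
  qed (use C \<open>t \<ge> 1\<close> finY in auto)
  then obtain G :: "(imm_var set \<Rightarrow> 'a) set" where G: "finite G"
    "real (card G) \<le> real (length C) * (2 ^ (r * k) * (3 / 2) ^ (2 * d div t + 1)) * real (\<Sum>i\<le>l + t * (r * k). card Y choose i)"
    "\<And>a S. (\<forall>U. degree (hom_eval (\<lambda>x. [:x:]) (theta \<rho> a U) (circuit_poly C)) \<le> r * k) \<Longrightarrow> S \<subseteq> Y \<Longrightarrow> card S = l \<Longrightarrow>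
      (\<lambda>U. set_monomial S U * poly (hom_eval (\<lambda>x. [:x:]) (theta \<rho> a U) (circuit_poly C)) 1) \<in> fun_vs.span G"
    by blast
  have "(\<lambda>U. \<Sum>\<beta>\<in>beta \<rho> ` codes_from a. set_monomial (S \<union> \<beta>) U) \<in> fun_vs.span G" if S: "S \<subseteq> Y" "card S = l" for a S
  proof -
    have "inj_on (beta \<rho>) (codes_from a)" by (rule inj_on_subset[OF inj_beta[OF \<rho>]]) (auto simp: codes_from_def)
    then have "(\<Sum>\<beta>\<in>beta \<rho> ` codes_from a. set_monomial (S \<union> \<beta>) U :: 'a) =
      set_monomial S U * poly (hom_eval (\<lambda>x. [:x:]) (theta \<rho> a U) (circuit_poly C)) 1" for U
      by (simp add: sum.reindex eval_circuit[OF \<rho> C(5)] sum_distrib_left set_monomial_mult)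
    then show ?thesis using G(3)[of a S] degree_circuit[OF \<rho> C(4)] S by simp
  qed
  then show ?thesis using G(1,2) by (intro exI[of _ G]) blast
qed

text \<open>Different gadgets have different Y-edges already in one layer. Weak as it is, the bound
  suffices, because g will be large compared with the square of the number of Y-layers.\<close>

lemma card_y_vars_ge:
  assumes \<rho>: "\<rho> \<in> walks.labelings"
  shows "g \<le> card (walks.edges \<rho> y_layers)"
proof -
  define code where "code v = (\<lambda>x\<in>coords. if snd x = 0 then v else 0)" for v :: nat
  have code: "code v \<in> walks.codes" if "v < g" for v
    using that w unfolding walks.codes_def unfolding code_def range_size_def by (auto simp: PiE_iff)
  let ?j = "y_layer (0, 0, 1)"
  have j: "?j \<in> y_layers" using k1 K u unfolding y_layers_def by (auto intro!: imageI)
  have "inj_on (\<lambda>v. walks.edge \<rho> ?j (code v)) {..<g}"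
  proof (rule inj_onI)
    fix v v' assume v: "v \<in> {..<g}" "v' \<in> {..<g}" "walks.edge \<rho> ?j (code v) = walks.edge \<rho> ?j (code v')"
    then have "code v (0, 0) = code v' (0, 0)"
      using y_edge_eq[OF \<rho> code code, of v v' 0 0 1] k1 K u by auto
    then show "v = v'" using k1 by (simp add: code_def coords_def)
  qed
  moreover have "(\<lambda>v. walks.edge \<rho> ?j (code v)) ` {..<g} \<subseteq> walks.edges \<rho> y_layers"
    using j code unfolding walks.edges_def by blast
  ultimately have "card {..<g} \<le> card (walks.edges \<rho> y_layers)"
    by (rule card_inj_on_le) (rule walks.finite_edges, rule card_y_layers)
  then show ?thesis by simp
qed

lemma card_y_vars_le:
  assumes \<rho>: "\<rho> \<in> walks.labelings"
  shows "card (walks.edges \<rho> y_layers) \<le> d * n\<^sup>2"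
proof -
  have "walks.edges \<rho> y_layers \<subseteq> imm_vars n d"
    unfolding walks.edges_def using walks.edge_in_imm_vars[OF \<rho>] layers_subset(2) by auto
  then have "card (walks.edges \<rho> y_layers) \<le> card (imm_vars n d)"
    by (intro card_mono) (auto simp: imm_vars_def)
  then show ?thesis by (simp add: imm_vars_def card_cartesian_product power2_eq_square)
qed

text \<open>Two walks are avoided together with probability at most q to the size of their union, so
  a shared step wins \<open>(1 / q) ^ u\<close>, which is at most \<open>w + 1\<close> by \<psi>.
  Hence the second moment exceeds the squared first moment by a factor of at most
  \<open>4 * Q ^ k\<close>, and that bounds the loss from requiring only some walk to be
  avoided.\<close>

lemma avoiding_sets_bound:
  assumes \<rho>: "\<rho> \<in> walks.labelings" and a: "a \<in> starts"
  defines "Y \<equiv> walks.edges \<rho> y_layers" and "D \<equiv> k * (K * u)" and "Q \<equiv> sqrt (real w) * (1 + 2 / sqrt (real w)) ^ K"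
  assumes l: "2 * (l + D) \<le> card Y" and \<psi>: "(real (card Y) / real (card Y - l)) ^ u \<le> real w + 1"
    and quarter: "1 / 4 \<le> (real (card Y - l - D) / real (card Y - l)) ^ (2 * D)"
  shows "real (card Y choose l) \<le> 4 * Q ^ k *
    real (card {S. S \<subseteq> Y \<and> card S = l \<and> (\<exists>\<beta>\<in>beta \<rho> ` codes_from a. S \<inter> \<beta> = {})})"
proof -
  define N where "N = card Y"
  define q where "q = real (N - l) / real N"
  define GA where "GA = {S. S \<subseteq> Y \<and> card S = l \<and> (\<exists>\<beta>\<in>beta \<rho> ` codes_from a. S \<inter> \<beta> = {})}"
  have "1 * 2 \<le> K * u" using K u by (intro mult_le_mono) auto
  then have "1 * 2 \<le> k * (K * u)" using k1 by (intro mult_le_mono) auto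
  then have Dpos: "2 \<le> D" by (simp add: D_def)
  have Npos: "N > 0" "l < N" using l Dpos by (auto simp: N_def)
  have qpos: "q > 0" using Npos by (simp add: q_def)
  have finY: "finite Y" unfolding Y_def by (rule walks.finite_edges) (rule card_y_layers)
  have betaY: "beta \<rho> c \<subseteq> Y" if "c \<in> walks.codes" for c
    using that unfolding beta_def Y_def walks.edges_def by blast
  have sub: "codes_from a \<subseteq> walks.codes" by (auto simp: codes_from_def)
  have inj: "inj_on (beta \<rho>) (codes_from a)" by (rule inj_on_subset[OF inj_beta[OF \<rho>] sub])
  have CN: "real (N choose l) > 0" using Npos by (simp add: zero_less_binomial_iff)
  have "(card (beta \<rho> ` codes_from a) * ((card Y - D) choose l))\<^sup>2 \<le> card GA *
    (\<Sum>\<beta>\<in>beta \<rho> ` codes_from a. \<Sum>\<beta>'\<in>beta \<rho> ` codes_from a. (card Y - card (\<beta> \<union> \<beta>')) choose l)"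
    unfolding GA_def
    by (rule avoiding_second_moment[OF finY]) (use betaY sub card_beta in \<open>auto simp: D_def\<close>)
  then have "(w ^ (k * K) * ((N - D) choose l))\<^sup>2 \<le> card GA *
    (\<Sum>c\<in>codes_from a. \<Sum>c'\<in>codes_from a. (N - card (beta \<rho> c \<union> beta \<rho> c')) choose l)"
    by (simp add: card_image[OF inj] card_codes_from[OF a] sum.reindex[OF inj] N_def)
  then have "real ((w ^ (k * K) * ((N - D) choose l))\<^sup>2) \<le> real (card GA *
    (\<Sum>c\<in>codes_from a. \<Sum>c'\<in>codes_from a. (N - card (beta \<rho> c \<union> beta \<rho> c')) choose l))"
    by (simp only: of_nat_le_iff)
  then have m: "(real w ^ (k * K))\<^sup>2 * (real ((N - D) choose l))\<^sup>2 \<le> real (card GA) *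
    (\<Sum>c\<in>codes_from a. \<Sum>c'\<in>codes_from a. real ((N - card (beta \<rho> c \<union> beta \<rho> c')) choose l))"
    by (simp add: power_mult_distrib)
  have "(\<Sum>c\<in>codes_from a. \<Sum>c'\<in>codes_from a. real ((N - card (beta \<rho> c \<union> beta \<rho> c')) choose l)) \<le>
    (\<Sum>c\<in>codes_from a. \<Sum>c'\<in>codes_from a. real (N choose l) * q ^ (2 * D) * ((1 / q) ^ u) ^ shared c c')"
  proof (intro sum_mono)
    fix c c' assume c: "c \<in> codes_from a" "c' \<in> codes_from a"
    let ?i = "card (beta \<rho> c \<union> beta \<rho> c')"
    have i: "?i = 2 * D - u * shared c c'" using card_beta_Un[OF \<rho>, of c c'] c sub by (auto simp: D_def)
    have us: "u * shared c c' \<le> 2 * D"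
    proof -
      have "u * shared c c' \<le> u * (k * K)" by (intro mult_le_mono2 shared_le)
      also have "u * (k * K) = D" by (simp add: D_def mult_ac)
      finally show ?thesis by linarith
    qed
    have "?i \<le> N" unfolding N_def by (rule card_mono[OF finY]) (use betaY c sub in auto)
    then have "real ((N - ?i) choose l) \<le> real (N choose l) * q ^ ?i"
      using binomial_drop_upper[of ?i N l] Npos by (simp add: q_def power_divide field_simps)
    also have "q ^ ?i = q ^ (2 * D) * ((1 / q) ^ u) ^ shared c c'"
      unfolding i using qpos us by (simp add: power_diff power_mult[symmetric] power_divide)
    finally show "real ((N - ?i) choose l) \<le> real (N choose l) * q ^ (2 * D) * ((1 / q) ^ u) ^ shared c c'"
      by (simp add: mult.assoc)
  qed
  also have "\<dots> = real (N choose l) * q ^ (2 * D) * (\<Sum>c\<in>codes_from a. \<Sum>c'\<in>codes_from a. ((1 / q) ^ u) ^ shared c c')"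
    by (simp only: sum_distrib_left)
  also have "\<dots> \<le> real (N choose l) * q ^ (2 * D) * (Q * real w ^ (2 * K)) ^ k"
  proof (rule mult_left_mono)
    have "1 / q = real (card Y) / real (card Y - l)" by (simp add: q_def N_def)
    then show "(\<Sum>c\<in>codes_from a. \<Sum>c'\<in>codes_from a. ((1 / q) ^ u) ^ shared c c') \<le> (Q * real w ^ (2 * K)) ^ k"
      unfolding Q_def using \<psi> qpos by (intro sum_shared_codes_from[OF a]) auto
  qed (use qpos in auto)
  finally have second: "(\<Sum>c\<in>codes_from a. \<Sum>c'\<in>codes_from a. real ((N - card (beta \<rho> c \<union> beta \<rho> c')) choose l))
     \<le> real (N choose l) * q ^ (2 * D) * (Q ^ k * (real w ^ (k * K))\<^sup>2)"
    by (simp add: power_mult_distrib power_mult[symmetric] mult_ac)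
  have first: "real (N choose l) * (real (N - l - D) / real N) ^ D \<le> real ((N - D) choose l)"
    using binomial_drop_lower[of D l N] l Npos by (simp add: N_def power_divide field_simps)
  have wpos: "(real w ^ (k * K))\<^sup>2 > 0" using w by simp
  have "(real w ^ (k * K))\<^sup>2 * (real (N choose l) * (real (N - l - D) / real N) ^ D)\<^sup>2 \<le>
      (real w ^ (k * K))\<^sup>2 * (real ((N - D) choose l))\<^sup>2"
    by (intro mult_left_mono power_mono first) auto
  also have "\<dots> \<le> real (card GA) * (real (N choose l) * q ^ (2 * D) * (Q ^ k * (real w ^ (k * K))\<^sup>2))"
    using m mult_left_mono[OF second, of "real (card GA)"] by simp
  finally have "(real w ^ (k * K))\<^sup>2 * (real (N choose l) * (real (N choose l) * (real (N - l - D) / real N) ^ (2 * D))) \<le>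
     (real w ^ (k * K))\<^sup>2 * (real (N choose l) * (real (card GA) * q ^ (2 * D) * Q ^ k))"
    by (simp add: power_mult_distrib power_mult power2_eq_square mult_ac)
  then have "real (N choose l) * (real (N - l - D) / real N) ^ (2 * D) \<le> real (card GA) * q ^ (2 * D) * Q ^ k"
    using wpos CN by (simp only: mult_le_cancel_left_pos)
  \<comment> \<open>Splitting off \<open>q ^ (2 * D)\<close> cancels the same power in the second
    moment; what remains is the correction bounded by \<open>quarter\<close>.\<close>
  moreover have "(real (N - l - D) / real N) ^ (2 * D) = (real (N - l - D) / real (N - l)) ^ (2 * D) * q ^ (2 * D)"
    unfolding power_mult_distrib[symmetric] q_def using Npos by simp
  ultimately have "real (N choose l) * (real (N - l - D) / real (N - l)) ^ (2 * D) * q ^ (2 * D) \<le> real (card GA) * Q ^ k * q ^ (2 * D)"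
    by (simp add: mult_ac)
  then have "real (N choose l) * (real (N - l - D) / real (N - l)) ^ (2 * D) \<le> real (card GA) * Q ^ k"
    using qpos by (simp only: mult_le_cancel_right_pos zero_less_power)
  moreover have "real (N choose l) * (1 / 4) \<le> real (N choose l) * (real (N - l - D) / real (N - l)) ^ (2 * D)"
    using quarter by (intro mult_left_mono) (auto simp: N_def)
  ultimately show ?thesis unfolding GA_def N_def by (simp add: mult_ac)
qed

text \<open>For density p a shared step wins \<open>(1 / p) ^ u\<close>, which factors into \<tau>'
  and the gain of \<open>avoiding_sets_bound\<close>. The width absorbs the latter, and the surplus
  \<tau>' amounts to at most \<open>2 * g\<close> over a block. So in each block the pairs in the
  same gadget, fewer by a factor g, weigh at most \<open>2 * Q\<close> times as much as all pairs
  would without overlaps.\<close>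

lemma covered_sets_bound:
  assumes \<rho>: "\<rho> \<in> walks.labelings"
  defines "Y \<equiv> walks.edges \<rho> y_layers" and "D \<equiv> k * (K * u)" and "Q \<equiv> sqrt (real w) * (1 + 2 / sqrt (real w)) ^ K"
  assumes l: "2 * (l + D) \<le> card Y" and \<psi>: "(real (card Y) / real (card Y - l)) ^ u \<le> real w + 1"
    and \<tau>: "(real (card Y - l) / real (l + D)) ^ (K * u) \<le> 2 * real g"
  shows "real (\<Sum>T | T \<subseteq> Y \<and> card T = l + D. (card {(a, \<beta>). a \<in> starts \<and> \<beta> \<in> beta \<rho> ` codes_from a \<and> \<beta> \<subseteq> T})\<^sup>2)
    \<le> real (card Y choose (l + D)) * (real (l + D) / real (card Y)) ^ (2 * D) * (real w ^ (2 * K) * real g ^ 2 * (3 * Q)) ^ k"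
proof -
  define N where "N = card Y"
  define p where "p = real (l + D) / real N"
  have "1 * 2 \<le> K * u" using K u by (intro mult_le_mono) auto
  then have "1 * 2 \<le> k * (K * u)" using k1 by (intro mult_le_mono) auto
  then have Dpos: "2 \<le> D" by (simp add: D_def)
  have Npos: "N > 0" "l < N" using l Dpos by (auto simp: N_def)
  have ppos: "p > 0" using Npos Dpos by (simp add: p_def)
  have finY: "finite Y" unfolding Y_def by (rule walks.finite_edges) (rule card_y_layers)
  have betaY: "beta \<rho> c \<subseteq> Y" if "c \<in> walks.codes" for c
    using that unfolding beta_def Y_def walks.edges_def by blast
  have "card {(a, \<beta>). a \<in> starts \<and> \<beta> \<in> beta \<rho> ` codes_from a \<and> \<beta> \<subseteq> T} \<le> card {c \<in> walks.codes. beta \<rho> c \<subseteq> T}" for T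
  proof (rule surj_card_le)
    show "finite {c \<in> walks.codes. beta \<rho> c \<subseteq> T}" using walks.finite_codes by simp
    show "{(a, \<beta>). a \<in> starts \<and> \<beta> \<in> beta \<rho> ` codes_from a \<and> \<beta> \<subseteq> T} \<subseteq>
        (\<lambda>c. (\<lambda>i\<in>{..<k}. c (i, 0), beta \<rho> c)) ` {c \<in> walks.codes. beta \<rho> c \<subseteq> T}"
    proof
      fix z assume "z \<in> {(a, \<beta>). a \<in> starts \<and> \<beta> \<in> beta \<rho> ` codes_from a \<and> \<beta> \<subseteq> T}"
      then obtain a c where z: "z = (a, beta \<rho> c)" "a \<in> starts" "c \<in> codes_from a" "beta \<rho> c \<subseteq> T" by auto
      have "a = (\<lambda>i\<in>{..<k}. c (i, 0))"
      proof
        fix i show "a i = (\<lambda>i\<in>{..<k}. c (i, 0)) i"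
          using z(2,3) by (auto simp: starts_def codes_from_def PiE_iff extensional_def)
      qed
      then show "z \<in> (\<lambda>c. (\<lambda>i\<in>{..<k}. c (i, 0), beta \<rho> c)) ` {c \<in> walks.codes. beta \<rho> c \<subseteq> T}"
        using z by (auto simp: codes_from_def)
    qed
  qed
  then have "(\<Sum>T | T \<subseteq> Y \<and> card T = l + D. (card {(a, \<beta>). a \<in> starts \<and> \<beta> \<in> beta \<rho> ` codes_from a \<and> \<beta> \<subseteq> T})\<^sup>2)
    \<le> (\<Sum>T | T \<subseteq> Y \<and> card T = l + D. (card {c \<in> walks.codes. beta \<rho> c \<subseteq> T})\<^sup>2)"
    by (intro sum_mono power_mono) auto
  then have "real (\<Sum>T | T \<subseteq> Y \<and> card T = l + D. (card {(a, \<beta>). a \<in> starts \<and> \<beta> \<in> beta \<rho> ` codes_from a \<and> \<beta> \<subseteq> T})\<^sup>2)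
    \<le> real (\<Sum>T | T \<subseteq> Y \<and> card T = l + D. (card {c \<in> walks.codes. beta \<rho> c \<subseteq> T})\<^sup>2)"
    by (simp only: of_nat_le_iff)
  also have "\<dots> \<le> (\<Sum>c\<in>walks.codes. \<Sum>c'\<in>walks.codes. real (card Y choose (l + D)) * (real (l + D) / real (card Y)) ^ card (beta \<rho> c \<union> beta \<rho> c'))"
    by (rule covering_second_moment[OF finY walks.finite_codes]) (use betaY l in auto)
  also have "\<dots> = (\<Sum>c\<in>walks.codes. \<Sum>c'\<in>walks.codes. real (N choose (l + D)) * p ^ (2 * D) * ((1 / p) ^ u) ^ shared c c')"
  proof (intro sum.cong refl)
    fix c c' assume c: "c \<in> walks.codes" "c' \<in> walks.codes"
    have i: "card (beta \<rho> c \<union> beta \<rho> c') = 2 * D - u * shared c c'" using card_beta_Un[OF \<rho> c] by (simp add: D_def)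
    have us: "u * shared c c' \<le> 2 * D"
    proof -
      have "u * shared c c' \<le> u * (k * K)" by (intro mult_le_mono2 shared_le)
      also have "u * (k * K) = D" by (simp add: D_def mult_ac)
      finally show ?thesis by linarith
    qed
    have "p ^ card (beta \<rho> c \<union> beta \<rho> c') = p ^ (2 * D) * ((1 / p) ^ u) ^ shared c c'"
      unfolding i using ppos us by (simp add: power_diff power_mult[symmetric] power_divide)
    then show "real (card Y choose (l + D)) * (real (l + D) / real (card Y)) ^ card (beta \<rho> c \<union> beta \<rho> c') =
      real (N choose (l + D)) * p ^ (2 * D) * ((1 / p) ^ u) ^ shared c c'" by (simp add: N_def p_def)
  qed
  also have "\<dots> = real (N choose (l + D)) * p ^ (2 * D) * (\<Sum>c\<in>walks.codes. \<Sum>c'\<in>walks.codes. ((1 / p) ^ u) ^ shared c c')"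
    by (simp only: sum_distrib_left)
  also have "\<dots> \<le> real (N choose (l + D)) * p ^ (2 * D) * (real w ^ (2 * K) * real g ^ 2 * (3 * Q)) ^ k"
  proof (rule mult_left_mono)
    define \<tau>' where "\<tau>' = (real (N - l) / real (l + D)) ^ u"
    have q1: "Q \<ge> 1"
    proof -
      have "1 * 1 \<le> sqrt (real w) * (1 + 2 / sqrt (real w)) ^ K" using w by (intro mult_mono one_le_power) auto
      then show ?thesis by (simp add: Q_def)
    qed
    have "(\<Sum>c\<in>walks.codes. \<Sum>c'\<in>walks.codes. ((1 / p) ^ u) ^ shared c c') \<le>
      (real w ^ (2 * K) * real g * (real g + \<tau>' ^ K * (sqrt (real w) * (1 + 2 / sqrt (real w)) ^ K))) ^ k"
    proof (rule sum_shared_codes[where \<psi> = "(real N / real (N - l)) ^ u"])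
      have "1 \<le> real (N - l) / real (l + D)" using l Dpos by (simp add: N_def le_divide_eq)
      then show "1 \<le> \<tau>'" unfolding \<tau>'_def by (rule one_le_power)
      have "\<tau>' * (real N / real (N - l)) ^ u = (1 / p) ^ u"
        unfolding \<tau>'_def power_mult_distrib[symmetric] p_def using Npos by simp
      then show "(1 / p) ^ u \<le> \<tau>' * (real N / real (N - l)) ^ u" by simp
    qed (use \<psi> ppos in \<open>auto simp: N_def\<close>)
    also have "\<dots> \<le> (real w ^ (2 * K) * real g ^ 2 * (3 * Q)) ^ k"
    proof (rule power_mono)
      have "\<tau>' ^ K \<le> 2 * real g" using \<tau> by (simp add: \<tau>'_def N_def power_mult[symmetric] mult.commute)
      then have "\<tau>' ^ K * Q \<le> 2 * real g * Q" using q1 by (intro mult_right_mono) auto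
      moreover have "real g \<le> real g * Q" using q1 by (simp add: mult_le_cancel_left1)
      ultimately have "real g + \<tau>' ^ K * Q \<le> real g * (3 * Q)" by simp
      then have "real w ^ (2 * K) * real g * (real g + \<tau>' ^ K * Q) \<le> real w ^ (2 * K) * real g * (real g * (3 * Q))"
        by (intro mult_left_mono) auto
      then show "real w ^ (2 * K) * real g * (real g + \<tau>' ^ K * (sqrt (real w) * (1 + 2 / sqrt (real w)) ^ K))
        \<le> real w ^ (2 * K) * real g ^ 2 * (3 * Q)" by (simp add: Q_def power2_eq_square mult_ac)
      show "0 \<le> real w ^ (2 * K) * real g * (real g + \<tau>' ^ K * (sqrt (real w) * (1 + 2 / sqrt (real w)) ^ K))"
        by (intro mult_nonneg_nonneg add_nonneg_nonneg) (auto simp: \<tau>'_def)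
    qed
    finally show "(\<Sum>c\<in>walks.codes. \<Sum>c'\<in>walks.codes. ((1 / p) ^ u) ^ shared c c') \<le> (real w ^ (2 * K) * real g ^ 2 * (3 * Q)) ^ k" .
  qed (use ppos in auto)
  finally show ?thesis by (simp add: N_def p_def)
qed

text \<open>In \<open>shifted_monomials_rank\<close> the factors \<open>g ^ (2 * k)\<close> on both
  sides cancel. The count of level \<open>l + D\<close>, the density and the width combine to
  \<open>x ^ (-D)\<close> times the count of level l, so the rank is at least about that count times
  \<open>x ^ D\<close>. The circuit allows the same count times \<open>x ^ (t * (r * k))\<close> and
  the factors listed.\<close>

lemma size_lower_bound:
  fixes C :: "(imm_var, 'a::field) circuit" and x :: real
  assumes C: "circuit_over (imm_vars n d) C" "depth_four C" "formal_degree C = d"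
    "individual_degree_le (circuit_poly C) r" "agree_on_cube (imm_vars n d) (circuit_poly C) (IMM n d)"
    and t: "t \<ge> 1" "t * (r * k) \<le> k * (K * u)" and small: "(length C)\<^sup>2 < h ^ (t + 1)"
    and x: "1 < x" "x \<le> 2" "x ^ (K * u) \<le> real g"
    and wx: "real w \<le> ((1 + x) / x) ^ u" "((1 + x) / x) ^ u \<le> real w + 1"
    and g: "100 * (k * (K * u))\<^sup>2 \<le> g" "6 * real (k * (K * u)) \<le> real g * (x - 1)"
  shows "x ^ (k * (K * u)) \<le> 128 * real (length C) * (2 ^ (r * k) * (3 / 2) ^ (2 * d div t + 1)) * (real d * real n ^ 2 + 1) *
    (3 * (sqrt (real w) * (1 + 2 / sqrt (real w)) ^ K) ^ 3) ^ k * x ^ (t * (r * k))"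
proof -
  define D where "D = k * (K * u)"
  define Q where "Q = sqrt (real w) * (1 + 2 / sqrt (real w)) ^ K"
  define s where "s = length C"
  define E :: real where "E = 2 ^ (r * k) * (3 / 2) ^ (2 * d div t + 1)"
  let ?mon = "\<lambda>i. case C ! i of Prod js \<Rightarrow> product_vars C js | _ \<Rightarrow> {}"
  have "\<exists>\<rho>\<in>walks.labelings. \<forall>m\<in>?mon ` {..<s}. \<not> walks.survives \<rho> t m"
  proof (rule walks.ex_killing_labeling)
    show "finite m" if "m \<in> ?mon ` {..<s}" for m
      using that by (auto simp: card_product_vars[THEN conjunct1] split: gate.splits)
    have "card (?mon ` {..<s}) \<le> s" using card_image_le[of "{..<s}" ?mon] by simp
    then have "(card (?mon ` {..<s}))\<^sup>2 \<le> s\<^sup>2" by (rule power_mono) simp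
    then show "(card (?mon ` {..<s}))\<^sup>2 < h ^ (t + 1)"
      by (rule order.strict_trans1) (use small in \<open>simp only: s_def\<close>)
  qed simp
  then obtain \<rho> where \<rho>: "\<rho> \<in> walks.labelings" and kill: "\<And>m. m \<in> ?mon ` {..<s} \<Longrightarrow> \<not> walks.survives \<rho> t m" by blast
  have killed: "\<not> walks.survives \<rho> t (product_vars C js)" if "i < length C" "C ! i = Prod js" for i js
  proof (rule kill)
    show "product_vars C js \<in> ?mon ` {..<s}" by (rule image_eqI[of _ _ i]) (use that in \<open>auto simp: s_def\<close>)
  qed
  define Y where "Y = walks.edges \<rho> y_layers"
  define N where "N = card Y"
  have N: "g \<le> N" "N \<le> d * n\<^sup>2" using card_y_vars_ge[OF \<rho>] card_y_vars_le[OF \<rho>] by (auto simp: N_def Y_def)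
  have "1 * 2 \<le> K * u" using K u by (intro mult_le_mono) auto
  then have "1 * 2 \<le> k * (K * u)" using k1 by (intro mult_le_mono) auto
  then have D1: "1 \<le> D" unfolding D_def by linarith
  \<comment> \<open>The level at which one more element multiplies the number of sets by about
    x.\<close>
  define l where "l = nat \<lfloor>real N / (1 + x)\<rfloor>"
  have l: "real l \<le> real N / (1 + x)" "real N / (1 + x) < real l + 1"
    using x by (auto simp: l_def of_nat_nat)
  have gap: "6 * real D \<le> real N * (x - 1)"
  proof -
    have "real g * (x - 1) \<le> real N * (x - 1)" using N x by (intro mult_right_mono) auto
    then show ?thesis using g(2) by (simp add: D_def)
  qed
  have N100: "100 * D\<^sup>2 \<le> N" using g(1) N(1) by (simp add: D_def)
  note mid = middle_level_bounds[OF x(1,2) D1 N100 gap l]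
  have Npos: "N > 0" "l < N" using mid(1) D1 by auto
  define CN where "CN = real (N choose l)"
  have CN: "CN > 0" using Npos by (simp add: CN_def zero_less_binomial_iff)
  have w1: "real w \<ge> 1" using w by simp
  have Q1: "Q \<ge> 1"
  proof -
    have "1 * 1 \<le> sqrt (real w) * (1 + 2 / sqrt (real w)) ^ K" using w by (intro mult_mono one_le_power) auto
    then show ?thesis by (simp add: Q_def)
  qed
  have \<psi>: "(real N / real (N - l)) ^ u \<le> real w + 1"
  proof -
    have "real N / real (N - l) \<le> (1 + x) / x" using mid(2) Npos x by (simp add: field_simps)
    then have "(real N / real (N - l)) ^ u \<le> ((1 + x) / x) ^ u" by (rule power_mono) simp
    then show ?thesis using wx(2) by linarith
  qed
  have \<tau>: "(real (N - l) / real (l + D)) ^ (K * u) \<le> 2 * real g"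
  proof -
    have "K * u \<le> D" using k1 by (simp add: D_def)
    have "(real (N - l) / real (l + D)) ^ (K * u) \<le> (real (N - l) / real (l + 1)) ^ (K * u)"
      using D1 by (intro power_mono divide_left_mono) auto
    also have "\<dots> \<le> 2 * x ^ (K * u)" using \<open>K * u \<le> D\<close> by (intro mid(4)) simp
    finally show ?thesis using x(3) by simp
  qed
  have "\<exists>G :: (imm_var set \<Rightarrow> 'a) set. finite G \<and>
    real (card G) \<le> real s * E * real (\<Sum>i\<le>l + t * (r * k). N choose i) \<and>
    (\<forall>a S. S \<subseteq> Y \<longrightarrow> card S = l \<longrightarrow> (\<lambda>U. \<Sum>\<beta>\<in>beta \<rho> ` codes_from a. set_monomial (S \<union> \<beta>) U) \<in> fun_vs.span G)"
    unfolding N_def Y_def s_def E_def by (rule circuit_span[OF \<rho> C t(1) killed])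
  then obtain G :: "(imm_var set \<Rightarrow> 'a) set" where G0: "finite G \<and>
    real (card G) \<le> real s * E * real (\<Sum>i\<le>l + t * (r * k). N choose i) \<and>
    (\<forall>a S. S \<subseteq> Y \<longrightarrow> card S = l \<longrightarrow> (\<lambda>U. \<Sum>\<beta>\<in>beta \<rho> ` codes_from a. set_monomial (S \<union> \<beta>) U) \<in> fun_vs.span G)"
    by (elim exE)
  note G = conjunct1[OF G0] conjunct1[OF conjunct2[OF G0]]
    mp[OF mp[OF spec[OF spec[OF conjunct2[OF conjunct2[OF G0]]]]]]
  define good where "good a = card {S. S \<subseteq> Y \<and> card S = l \<and> (\<exists>\<beta>\<in>beta \<rho> ` codes_from a. S \<inter> \<beta> = {})}" for a
  define Z where "Z = (\<Sum>T | T \<subseteq> Y \<and> card T = l + D. (card {(a, \<beta>). a \<in> starts \<and> \<beta> \<in> beta \<rho> ` codes_from a \<and> \<beta> \<subseteq> T})\<^sup>2)"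
  have finY: "finite Y" unfolding Y_def by (rule walks.finite_edges) (rule card_y_layers)
  have rank: "(\<Sum>a\<in>starts. good a)\<^sup>2 \<le> card G * Z"
    unfolding good_def Z_def
  proof (rule shifted_monomials_rank[OF finY card_starts(1) G(1) _ G(3)])
    fix a \<beta> assume "\<beta> \<in> beta \<rho> ` codes_from a"
    then show "\<beta> \<subseteq> Y \<and> card \<beta> = D"
      using card_beta by (auto simp: beta_def Y_def walks.edges_def codes_from_def D_def)
  qed
  have good: "CN \<le> 4 * Q ^ k * real (good a)" if "a \<in> starts" for a
    using avoiding_sets_bound[where l = l, OF \<rho> that] mid(1,3) \<psi>
    unfolding CN_def good_def N_def Y_def[symmetric] D_def[symmetric] Q_def[symmetric] by blast
  have "real g ^ k * CN = (\<Sum>a\<in>starts. CN)" by (simp add: card_starts)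
  also have "\<dots> \<le> (\<Sum>a\<in>starts. 4 * Q ^ k * real (good a))" by (intro sum_mono good)
  also have "\<dots> = 4 * Q ^ k * real (\<Sum>a\<in>starts. good a)" by (simp add: sum_distrib_left)
  finally have "(real g ^ k * CN)\<^sup>2 \<le> (4 * Q ^ k * real (\<Sum>a\<in>starts. good a))\<^sup>2"
    using CN by (intro power_mono) auto
  also have "\<dots> = 16 * (Q ^ k)\<^sup>2 * real ((\<Sum>a\<in>starts. good a)\<^sup>2)" by (simp add: power_mult_distrib)
  also have "\<dots> \<le> 16 * (Q ^ k)\<^sup>2 * real (card G * Z)"
    by (intro mult_left_mono) (use rank in \<open>simp_all only: of_nat_le_iff\<close>, simp)
  also have "\<dots> = 16 * (Q ^ k)\<^sup>2 * real (card G) * real Z" by simp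
  also have "\<dots> \<le> 16 * (Q ^ k)\<^sup>2 * real (card G) *
      (2 * CN * x ^ D * (2 / (1 + x) ^ (2 * D)) * ((((1 + x) / x) ^ D)\<^sup>2 * (real g ^ k)\<^sup>2 * (3 * Q) ^ k))"
  proof (rule mult_left_mono)
    have "real Z \<le> real (N choose (l + D)) * (real (l + D) / real N) ^ (2 * D) * (real w ^ (2 * K) * real g ^ 2 * (3 * Q)) ^ k"
      using covered_sets_bound[where l = l, OF \<rho>] mid(1) \<psi> \<tau>
      unfolding Z_def N_def Y_def[symmetric] D_def[symmetric] Q_def[symmetric] by blast
    also have "\<dots> \<le> (2 * CN * x ^ D) * (2 / (1 + x) ^ (2 * D)) * ((((1 + x) / x) ^ D)\<^sup>2 * (real g ^ k)\<^sup>2 * (3 * Q) ^ k)"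
    proof (intro mult_mono)
      have "real (N choose (l + D)) * real (l + 1) ^ D \<le> CN * real (N - l) ^ D"
        unfolding CN_def using mid(1) by (intro binomial_raise) simp
      then have "real (N choose (l + D)) \<le> CN * (real (N - l) / real (l + 1)) ^ D"
        by (simp add: power_divide field_simps)
      also have "\<dots> \<le> CN * (2 * x ^ D)" using CN by (intro mult_left_mono mid(4)) auto
      finally show "real (N choose (l + D)) \<le> 2 * CN * x ^ D" by simp
      show "(real (l + D) / real N) ^ (2 * D) \<le> 2 / (1 + x) ^ (2 * D)" by (rule mid(5))
      have "real w ^ (2 * K) \<le> (((1 + x) / x) ^ u) ^ (2 * K)" using wx(1) by (intro power_mono) auto
      then have "(real w ^ (2 * K) * real g ^ 2 * (3 * Q)) ^ k \<le> ((((1 + x) / x) ^ u) ^ (2 * K) * real g ^ 2 * (3 * Q)) ^ k"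
        using Q1 w1 by (intro power_mono[OF mult_right_mono[OF mult_right_mono]]) auto
      also have "\<dots> = (((1 + x) / x) ^ D)\<^sup>2 * (real g ^ k)\<^sup>2 * (3 * Q) ^ k"
        by (simp add: power_mult_distrib power_mult[symmetric] D_def mult_ac)
      finally show "(real w ^ (2 * K) * real g ^ 2 * (3 * Q)) ^ k \<le> (((1 + x) / x) ^ D)\<^sup>2 * (real g ^ k)\<^sup>2 * (3 * Q) ^ k" .
    qed (use CN x Q1 in auto)
    finally show "real Z \<le> 2 * CN * x ^ D * (2 / (1 + x) ^ (2 * D)) * ((((1 + x) / x) ^ D)\<^sup>2 * (real g ^ k)\<^sup>2 * (3 * Q) ^ k)" .
  qed simp
  also have "\<dots> = (real g ^ k)\<^sup>2 * CN * (64 * real (card G) * ((Q ^ k)\<^sup>2 * (3 * Q) ^ k) * (x ^ D * ((1 / (1 + x) ^ (2 * D)) * (((1 + x) / x) ^ D)\<^sup>2)))"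
    by simp
  \<comment> \<open>The powers of \<open>1 + x\<close> from the density and from the width cancel.
    Of the powers of x, the level contributes D and the width removes \<open>2 * D\<close>.\<close>
  also have "x ^ D * ((1 / (1 + x) ^ (2 * D)) * (((1 + x) / x) ^ D)\<^sup>2) = 1 / x ^ D"
  proof -
    have "((1 + x) ^ D)\<^sup>2 = (1 + x) ^ (2 * D)" by (simp add: power_mult[symmetric] mult.commute)
    then show ?thesis using x by (simp add: power_divide power2_eq_square)
  qed
  also have "(Q ^ k)\<^sup>2 * (3 * Q) ^ k = (3 * Q ^ 3) ^ k"
  proof -
    have "(Q ^ k)\<^sup>2 * (3 * Q) ^ k = 3 ^ k * (Q ^ k) ^ 3"
      by (simp add: power_mult_distrib power2_eq_square power3_eq_cube)
    also have "(Q ^ k) ^ 3 = (Q ^ 3) ^ k" by (simp add: power_mult[symmetric] mult.commute)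
    finally show ?thesis by (simp only: power_mult_distrib)
  qed
  finally have "((real g ^ k)\<^sup>2 * CN) * CN \<le> ((real g ^ k)\<^sup>2 * CN) * (64 * real (card G) * (3 * Q ^ 3) ^ k * (1 / x ^ D))"
    by (simp add: power_mult_distrib power2_eq_square mult_ac)
  moreover have "(real g ^ k)\<^sup>2 * CN > 0"
  proof -
    have "real g > 0" using imm_blocks_axioms by (simp add: imm_blocks_def)
    then show ?thesis using CN by simp
  qed
  ultimately have "CN \<le> 64 * real (card G) * (3 * Q ^ 3) ^ k * (1 / x ^ D)"
    by (simp only: mult_le_cancel_left_pos)
  then have "CN * x ^ D \<le> 64 * (3 * Q ^ 3) ^ k * real (card G)"
    using x by (simp add: field_simps)
  also have "\<dots> \<le> 64 * (3 * Q ^ 3) ^ k * (real s * E * (real d * real n ^ 2 + 1) * (2 * CN * x ^ (t * (r * k))))"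
  proof (rule mult_left_mono)
    let ?q = "t * (r * k)"
    have q: "?q \<le> D" using t(2) by (simp add: D_def)
    \<comment> \<open>As \<open>l + ?q\<close> is not above the middle, its level is the largest of
      those summed; their number is absorbed by the factor polynomial in n and d.\<close>
    have "(\<Sum>i\<le>l + ?q. N choose i) \<le> (l + ?q + 1) * (N choose (l + ?q))"
      using mid(1) q by (intro sum_binomial_le) simp
    then have "real (\<Sum>i\<le>l + ?q. N choose i) \<le> real ((l + ?q + 1) * (N choose (l + ?q)))" by (simp only: of_nat_le_iff)
    also have "\<dots> = real (l + ?q + 1) * real (N choose (l + ?q))" by (simp only: of_nat_mult)
    also have "\<dots> \<le> (real d * real n ^ 2 + 1) * (2 * CN * x ^ ?q)"
    proof (rule mult_mono)
      have "l + ?q \<le> l + D" using q by (rule add_left_mono)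
      also have "\<dots> \<le> N" using mid(1) by simp
      also have "\<dots> \<le> d * n\<^sup>2" by (rule N(2))
      finally have "l + ?q + 1 \<le> d * n\<^sup>2 + 1" by (rule add_right_mono)
      then have "real (l + ?q + 1) \<le> real (d * n\<^sup>2 + 1)" by (simp only: of_nat_le_iff)
      then show "real (l + ?q + 1) \<le> real d * real n ^ 2 + 1" by simp
      have "real (N choose (l + ?q)) * real (l + 1) ^ ?q \<le> CN * real (N - l) ^ ?q"
        unfolding CN_def using mid(1) q by (intro binomial_raise) simp
      then have "real (N choose (l + ?q)) \<le> CN * (real (N - l) / real (l + 1)) ^ ?q"
        by (simp add: power_divide field_simps)
      also have "\<dots> \<le> CN * (2 * x ^ ?q)" using CN q by (intro mult_left_mono mid(4)) auto
      finally show "real (N choose (l + ?q)) \<le> 2 * CN * x ^ ?q" by simp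
    qed (use CN x in auto)
    finally have "real s * E * real (\<Sum>i\<le>l + ?q. N choose i) \<le> real s * E * ((real d * real n ^ 2 + 1) * (2 * CN * x ^ ?q))"
      by (rule mult_left_mono) (simp add: E_def)
    then show "real (card G) \<le> real s * E * (real d * real n ^ 2 + 1) * (2 * CN * x ^ ?q)"
      using G(2) by (simp only: mult.assoc)
  qed (use Q1 in simp)
  also have "\<dots> = CN * (128 * real s * E * (real d * real n ^ 2 + 1) * (3 * Q ^ 3) ^ k * x ^ (t * (r * k)))"
    by simp
  finally show ?thesis using CN by (simp only: mult_le_cancel_left_pos D_def Q_def s_def E_def)
qed

end

section \<open>Choice of the parameters\<close>

text \<open>The exponents are linked: \<open>85 / 100\<close> for g, \<open>8 / 100\<close> for the
  squared width and \<open>5 / 100\<close> for h add up to \<open>98 / 100\<close>, which leaves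
  room for the constant 4 among the n indices of a layer. The exponents \<open>849 / 1000\<close>
  and \<open>49 / 1000\<close> absorb the rounding of g and h.\<close>

definition large_enough :: "real \<Rightarrow> real \<Rightarrow> real \<Rightarrow> bool" where
  "large_enough c \<kappa> n \<longleftrightarrow> 400 \<le> log 2 n \<and> 4 * n powr (98 / 100) \<le> n \<and> n powr (849 / 1000) \<le> n powr (85 / 100) - 1 \<and>
    n powr (49 / 1000) \<le> n powr (5 / 100) - 1 \<and> 100 * n powr (2 / 100) \<le> n powr (849 / 1000) \<and>
    17496 * n powr (6 / 100) \<le> n powr (7 / 100) \<and> 512 * n powr (201 / 100) \<le> n powr 3 \<and>
    200 \<le> \<kappa> * sqrt (12 * c * log 2 n) \<and> 3 \<le> n powr (849 / 1000)"

lemma eventually_large_enough: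
  assumes "c > 0" "\<kappa> > 0"
  shows "\<exists>n0::nat. \<forall>n\<ge>n0. large_enough c \<kappa> (real n)"
proof -
  have "eventually (\<lambda>n::real. 400 \<le> log 2 n) at_top" by real_asymp
  moreover have "eventually (\<lambda>n::real. 4 * n powr (98 / 100) \<le> n) at_top" by real_asymp
  moreover have "eventually (\<lambda>n::real. n powr (849 / 1000) \<le> n powr (85 / 100) - 1) at_top" by real_asymp
  moreover have "eventually (\<lambda>n::real. n powr (49 / 1000) \<le> n powr (5 / 100) - 1) at_top" by real_asymp
  moreover have "eventually (\<lambda>n::real. 100 * n powr (2 / 100) \<le> n powr (849 / 1000)) at_top" by real_asymp
  moreover have "eventually (\<lambda>n::real. 17496 * n powr (6 / 100) \<le> n powr (7 / 100)) at_top" by real_asymp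
  moreover have "eventually (\<lambda>n::real. 512 * n powr (201 / 100) \<le> n powr 3) at_top" by real_asymp
  moreover have "eventually (\<lambda>n::real. 200 \<le> \<kappa> * sqrt (12 * c * log 2 n)) at_top" using assms by real_asymp
  moreover have "eventually (\<lambda>n::real. 3 \<le> n powr (849 / 1000)) at_top" by real_asymp
  ultimately have "eventually (large_enough c \<kappa>) at_top"
    unfolding large_enough_def by eventually_elim auto
  then have "eventually (\<lambda>n. large_enough c \<kappa> (real n)) sequentially"
    using filterlim_real_sequentially by (rule eventually_compose_filterlim)
  then show ?thesis by (simp add: eventually_sequentially)
qed

section \<open>Numerical estimates\<close>

lemma nat_floor_bounds:
  fixes a :: real
  assumes "0 \<le> a"
  shows "real (nat \<lfloor>a\<rfloor>) \<le> a" "a < real (nat \<lfloor>a\<rfloor>) + 1"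
  using assms floor_correct[of a] by (simp_all add: of_nat_nat)

lemma exp_2_le_9: "exp (2 :: real) \<le> 9"
proof -
  have "exp (2 :: real) = exp 1 ^ 2" using exp_double[of "1::real"] by simp
  also have "\<dots> \<le> 3 ^ 2" using exp_le by (intro power_mono) auto
  finally show ?thesis by simp
qed

lemma powr_power_eq: "0 < a \<Longrightarrow> (a powr b) ^ j = a powr (b * real j)" for a b :: real
  using powr_powr[of a b "real j"] powr_realpow[of "a powr b" j] by simp

text \<open>\<open>(3 / 2) ^ 5 = 243 / 32 < 8 = 2 ^ 3\<close>. The exponent has to be this close to
  \<open>log 2 (3 / 2)\<close> because more than 6 groups per unit of \<open>r * k\<close> enter the
  final count.\<close>

lemma three_halves_power_le: "(3 / 2 :: real) ^ m \<le> 2 powr (6 / 10 * real m)"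
proof -
  have "(2 powr (6 / 10)) ^ 5 = 2 powr (6 / 10 * real 5)" by (rule powr_power_eq) simp
  also have "\<dots> = (2 :: real) ^ 3" using powr_realpow[of "2 :: real" 3] by simp
  finally have "(3 / 2 :: real) ^ Suc 4 \<le> (2 powr (6 / 10)) ^ Suc 4" by (simp add: power_divide)
  then have "(3 / 2 :: real) \<le> 2 powr (6 / 10)" by (rule power_le_imp_le_base) simp
  then have "(3 / 2 :: real) ^ m \<le> (2 powr (6 / 10)) ^ m" by (intro power_mono) auto
  also have "\<dots> = 2 powr (6 / 10 * real m)" by (rule powr_power_eq) simp
  finally show ?thesis .
qed

text \<open>There are \<open>g \<approx> n powr 0.85\<close> gadgets per block and \<open>h \<approx> n powr 0.05\<close> labels per vertex, and the width
  \<open>w \<le> 2 * d ^ 4\<close> of a gadget is at most \<open>2 * n powr 0.04\<close>. As \<open>t * (r * k)\<close> is at most a third of the walk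
  length, the gain is \<open>g powr (2 / 3 * k) \<ge> n powr (0.566 * k)\<close>. As \<open>r \<le> log 2 n / 12\<close>, the number of products of
  constant terms is at most about \<open>n powr (0.406 * k)\<close>; the powers of w cost another \<open>n powr (0.07 * k)\<close>.\<close>

lemma size_bound_large:
  fixes C :: "(imm_var, 'a::field) circuit"
  assumes "c > 0" and \<kappa>: "0 < \<kappa>" "\<kappa> \<le> 1" "\<kappa> \<le> sqrt c" and large: "large_enough c \<kappa> (real n)"
    and dc: "c * (log 2 (real n))\<^sup>2 \<le> real d" and dn: "real d \<le> real n powr (1 / 100)"
    and r: "1 \<le> r" "real r \<le> log 2 (real n) / 12"
    and C: "circuit_over (imm_vars n d) C" "depth_four C" "formal_degree C = d"
      "individual_degree_le (circuit_poly C) r" "agree_on_cube (imm_vars n d) (circuit_poly C) (IMM n d)"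
  shows "real n powr (7 / 1000 * \<kappa> * sqrt (real d / real r)) \<le> real (length C)"
proof -
  define L where "L = log 2 (real n)"
  define y where "y = sqrt (real d / real r)"
  have F: "400 \<le> log 2 (real n)" "4 * real n powr (98 / 100) \<le> real n"
    "real n powr (849 / 1000) \<le> real n powr (85 / 100) - 1" "real n powr (49 / 1000) \<le> real n powr (5 / 100) - 1"
    "100 * real n powr (2 / 100) \<le> real n powr (849 / 1000)" "17496 * real n powr (6 / 100) \<le> real n powr (7 / 100)"
    "512 * real n powr (201 / 100) \<le> real n powr 3" "200 \<le> \<kappa> * sqrt (12 * c * log 2 (real n))"
    "3 \<le> real n powr (849 / 1000)"
    using large unfolding large_enough_def by blast+
  have L400: "400 \<le> L" using F by (simp add: L_def)
  have n1: "real n > 1" using L400 unfolding L_def by (cases "n \<le> 1") (auto simp: le_Suc_eq log_def)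
  have nL: "real n = 2 powr L" using n1 by (simp add: L_def)
  have n_powr: "real n powr a = 2 powr (L * a)" for a by (simp add: nL powr_powr)
  have d0: "real d > 0"
  proof -
    have "0 < c * L\<^sup>2" using \<open>c > 0\<close> L400 by simp
    then show ?thesis using dc by (simp add: L_def)
  qed
  have r0: "real r > 0" using r by simp
  have y0: "y > 0" using d0 r0 by (simp add: y_def)
  have y2: "y\<^sup>2 = real d / real r" using d0 r0 by (simp add: y_def)
  have yd: "real r * y\<^sup>2 = real d" using r0 y2 by simp
  have "12 * c * L \<le> real d / real r"
  proof -
    have "12 * c * L * real r \<le> 12 * c * L * (L / 12)" using r \<open>c > 0\<close> L400 by (intro mult_left_mono) (auto simp: L_def)
    also have "\<dots> = c * L\<^sup>2" by (simp add: power2_eq_square)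
    finally show ?thesis using dc r0 by (simp add: L_def pos_le_divide_eq)
  qed
  then have "sqrt (12 * c * L) \<le> y" unfolding y_def by simp
  then have "\<kappa> * sqrt (12 * c * L) \<le> \<kappa> * y" using \<kappa> by (intro mult_left_mono) auto
  then have ky: "200 \<le> \<kappa> * y" using F by (simp add: L_def)
  have y200: "200 \<le> y"
  proof -
    have "\<kappa> * y \<le> 1 * y" using \<kappa> y0 by (intro mult_right_mono) auto
    then show ?thesis using ky by simp
  qed
  \<comment> \<open>\<open>\<kappa> \<le> sqrt c\<close> leaves at least L layers for each block,
    which \<open>x \<le> 2\<close> requires; \<open>\<kappa> \<le> 1\<close> gives
    \<open>k \<le> y\<close>, so that t can be of order y.\<close>
  define k where "k = nat \<lfloor>\<kappa> * y\<rfloor>"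
  have k: "real k \<le> \<kappa> * y" "\<kappa> * y < real k + 1" using ky nat_floor_bounds[of "\<kappa> * y", folded k_def] by linarith+
  have k199: "199 \<le> real k" using k ky by linarith
  have k0: "k > 0" using k199 by linarith
  have kL: "real k * L \<le> real d"
  proof -
    have sq: "sqrt c * L \<le> sqrt (real d)"
      using dc L400 by (intro real_le_rsqrt) (simp add: L_def power_mult_distrib \<open>c > 0\<close> less_imp_le)
    have "y \<le> sqrt (real d)"
      unfolding y_def using r d0 by (intro real_sqrt_le_mono) (simp add: divide_le_eq mult_le_cancel_left1)
    have "real k * L \<le> (\<kappa> * y) * L" using k L400 by (intro mult_right_mono) auto
    also have "\<dots> \<le> (sqrt c * y) * L" using \<kappa> y0 L400 by (intro mult_right_mono) auto
    also have "\<dots> = (sqrt c * L) * y" by simp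
    also have "\<dots> \<le> sqrt (real d) * sqrt (real d)" using sq \<open>y \<le> sqrt (real d)\<close> y0 by (intro mult_mono) auto
    finally show ?thesis by simp
  qed
  have log_d: "log 2 (real d) \<le> L / 100"
  proof -
    have "log 2 (real d) \<le> log 2 (real n powr (1 / 100))" using d0 dn by (intro log_mono) auto
    then show ?thesis by (simp add: nL powr_powr)
  qed
  have d_powr: "real d = 2 powr log 2 (real d)" using d0 by simp
  have d_big: "1000 \<le> real d"
  proof -
    have "199 * 400 \<le> real k * L" using k199 L400 by (intro mult_mono) auto
    then show ?thesis using kL by linarith
  qed
  \<comment> \<open>As \<open>z = (1 + x) / x\<close> will lie between \<open>3 / 2 > sqrt 2\<close>
    and 2, this u puts \<open>z ^ u\<close> between \<open>d ^ 2\<close> and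
    \<open>2 * d ^ 4\<close>, and w is \<open>z ^ u\<close> rounded down.\<close>
  define u where "u = nat \<lceil>4 * log 2 (real d)\<rceil>"
  have logd1: "log 2 (real d) \<ge> 1" using d_big by (simp add: le_log_iff)
  have u: "4 * log 2 (real d) \<le> real u" "real u \<le> 4 * log 2 (real d) + 1"
  proof -
    have "0 \<le> \<lceil>4 * log 2 (real d)\<rceil>" using logd1 by (simp add: less_imp_le)
    then have "real u = of_int \<lceil>4 * log 2 (real d)\<rceil>" unfolding u_def by (rule of_nat_nat)
    then show "4 * log 2 (real d) \<le> real u" "real u \<le> 4 * log 2 (real d) + 1"
      using ceiling_correct[of "4 * log 2 (real d)"] by linarith+
  qed
  have u2: "u \<ge> 2" using u(1) logd1 by linarith
  define m where "m = d div k"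
  define K where "K = (m - 2) div u"
  have km: "k * m \<le> d" by (simp add: m_def)
  have "d < k * (m + 1)" using k0 by (simp add: m_def dividend_less_times_div)
  then have "real d < real (k * (m + 1))" by (simp only: of_nat_less_iff)
  then have m: "real d < real k * (real m + 1)" by (simp add: algebra_simps)
  define \<mu> where "\<mu> = real d / real k"
  have \<mu>: "L \<le> \<mu>" "\<mu> < real m + 1" using kL m k0 by (auto simp: \<mu>_def field_simps)
  have m2: "m \<ge> 2" using \<mu> L400 by linarith
  have Ku_le: "K * u \<le> m - 2" by (simp add: K_def)
  have "m - 2 < (K + 1) * u" using u2 by (simp add: K_def dividend_less_div_times)
  then have "real (m - 2) < real ((K + 1) * u)" by (simp only: of_nat_less_iff)
  then have "real m - 2 < real (K * u) + real u" using m2 by (simp add: of_nat_diff algebra_simps)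
  \<comment> \<open>Rounding loses at most 4 layers and
    \<open>4 * log 2 (real d) \<le> L / 25\<close>; since \<open>\<mu> \<ge> L \<ge> 400\<close>,
    this is within 5 percent of \<mu>.\<close>
  then have Ku: "95 / 100 * \<mu> \<le> real (K * u)"
    using \<mu> u(2) log_d L400 by linarith
  have Ku0: "K * u > 0" using Ku \<mu> L400 by (intro Nat.gr0I) auto
  have K1: "K \<ge> 1" using Ku0 by (cases K) auto
  define D where "D = k * (K * u)"
  have D_le: "D \<le> d"
  proof -
    have "D \<le> k * m" unfolding D_def using Ku_le by (intro mult_le_mono2) simp
    then show ?thesis using km by linarith
  qed
  have D_ge: "95 / 100 * real d \<le> real D"
  proof -
    have "real k * (95 / 100 * \<mu>) \<le> real k * real (K * u)" using Ku by (intro mult_left_mono) auto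
    then show ?thesis using k0 by (simp add: \<mu>_def D_def)
  qed
  define g where "g = nat \<lfloor>real n powr (85 / 100)\<rfloor>"
  define h where "h = nat \<lfloor>real n powr (5 / 100)\<rfloor>"
  have g_le: "real g \<le> real n powr (85 / 100)" and g_ge: "real n powr (849 / 1000) \<le> real g"
    using F(3) nat_floor_bounds[OF powr_ge_zero[of "real n" "85 / 100"], folded g_def] by linarith+
  have h_le: "real h \<le> real n powr (5 / 100)" and h_ge: "real n powr (49 / 1000) \<le> real h"
    using F(4) nat_floor_bounds[OF powr_ge_zero[of "real n" "5 / 100"], folded h_def] by linarith+
  have g3: "3 \<le> real g" using g_ge F by linarith
  have h0: "h \<ge> 1"
  proof -
    have "0 < real n powr (49 / 1000)" using n1 by simp
    then show ?thesis using h_ge by linarith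
  qed
  define x where "x = real g powr (1 / real (K * u))"
  have xg: "x ^ (K * u) = real g"
    unfolding x_def using Ku0 g3 by (subst powr_power_eq) auto
  have x1: "1 < x" using g3 Ku0 unfolding x_def by (intro gr_one_powr) auto
  \<comment> \<open>A block has at least \<open>95 / 100 * L\<close> Y-layers, while
    \<open>log 2 g\<close> is at most \<open>85 / 100 * L\<close>.\<close>
  have x2: "x \<le> 2"
  proof -
    have "real g \<le> 2 powr real (K * u)"
    proof -
      have "real g \<le> 2 powr (L * (85 / 100))" using g_le by (simp add: n_powr)
      also have "\<dots> \<le> 2 powr real (K * u)" using Ku \<mu> L400 by (intro powr_mono) auto
      finally show ?thesis .
    qed
    then have "x \<le> (2 powr real (K * u)) powr (1 / real (K * u))" unfolding x_def by (intro powr_mono2) auto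
    also have "\<dots> = 2" using Ku0 by (simp add: powr_powr)
    finally show ?thesis .
  qed
  define z where "z = (1 + x) / x"
  have z: "3 / 2 \<le> z" "z \<le> 2" using x1 x2 by (auto simp: z_def field_simps)
  define w where "w = nat \<lfloor>z ^ u\<rfloor>"
  have zu1: "1 \<le> z ^ u" using z by (intro one_le_power) auto
  have w_le: "real w \<le> z ^ u" and w_ge: "z ^ u \<le> real w + 1"
    using zu1 nat_floor_bounds[of "z ^ u", folded w_def] by linarith+
  have w1: "w \<ge> 1" using zu1 by (simp add: w_def le_nat_iff le_floor_iff)
  have w_upper: "real w \<le> 2 * real d ^ 4"
  proof -
    have "z ^ u \<le> 2 ^ u" using z by (intro power_mono) auto
    then have "real w \<le> 2 ^ u" using w_le by linarith
    also have "\<dots> = 2 powr real u" by (simp add: powr_realpow)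
    also have "\<dots> \<le> 2 powr (1 + 4 * log 2 (real d))" using u by (intro powr_mono) auto
    also have "\<dots> = 2 * (2 powr log 2 (real d)) ^ 4" by (simp add: powr_add powr_power_eq mult.commute)
    also have "2 powr log 2 (real d) = real d" using d0 by simp
    finally show ?thesis .
  qed
  have w_lower: "real d ^ 2 \<le> real w + 1"
  proof -
    have "real d ^ 2 = 2 powr (2 * log 2 (real d))"
      using d0 powr_power_eq[of 2 "log 2 (real d)" 2] by (simp add: mult.commute)
    also have "\<dots> \<le> 2 powr (real u / 2)" using u by (intro powr_mono) auto
    also have "\<dots> = (2 powr (1 / 2)) ^ u" by (simp add: powr_power_eq)
    also have "\<dots> \<le> z ^ u"
    proof (rule power_mono)
      have "2 powr (1 / 2) = sqrt (2 :: real)" by (simp add: powr_half_sqrt)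
      also have "\<dots> \<le> 3 / 2" by (rule real_le_lsqrt) (auto simp: power2_eq_square)
      finally show "2 powr (1 / 2) \<le> z" using z by linarith
    qed simp
    finally show ?thesis using w_ge by linarith
  qed
  \<comment> \<open>This makes \<open>(1 + 2 / sqrt w) ^ K\<close> at most \<open>exp 2\<close>, so
    that the repeated meetings of two walks cost a constant factor only.\<close>
  have K_sqrt: "real K \<le> sqrt (real w)"
  proof (rule real_le_rsqrt)
    have "m \<le> d" by (simp add: m_def)
    then have "K * u \<le> d" using Ku_le by linarith
    moreover have "K * 2 \<le> K * u" using u2 by (intro mult_le_mono2) simp
    ultimately have "K * 2 \<le> d" by linarith
    then have "real K * 2 \<le> real d" by (metis of_nat_le_iff of_nat_mult of_nat_numeral)
    then have "real K ^ 2 * 4 \<le> real d ^ 2"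
      using power_mono[of "real K * 2" "real d" 2] by (simp add: power_mult_distrib)
    moreover have "2 \<le> real d ^ 2"
    proof -
      have "1000 * 1 \<le> real d * real d" using d_big by (intro mult_mono) auto
      then show ?thesis by (simp add: power2_eq_square)
    qed
    ultimately show "(real K)\<^sup>2 \<le> real w" using w_lower by linarith
  qed
  define Q where "Q = sqrt (real w) * (1 + 2 / sqrt (real w)) ^ K"
  have Q_le: "Q \<le> 18 * real d ^ 2"
  proof -
    have sw: "sqrt (real w) > 0" using w1 by simp
    have "(1 + 2 / sqrt (real w)) ^ K \<le> exp (2 / sqrt (real w)) ^ K"
      using exp_ge_add_one_self[of "2 / sqrt (real w)"] by (intro power_mono) auto
    also have "\<dots> = exp (real K * (2 / sqrt (real w)))" by (rule exp_of_nat_mult[symmetric])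
    also have "\<dots> \<le> exp 2"
      using K_sqrt sw by (simp add: field_simps)
    also have "\<dots> \<le> 9" by (rule exp_2_le_9)
    finally have "Q \<le> sqrt (real w) * 9" unfolding Q_def by (intro mult_left_mono) auto
    also have "sqrt (real w) \<le> 2 * real d ^ 2"
    proof (rule real_le_lsqrt)
      have "(2 * real d ^ 2)\<^sup>2 = 4 * real d ^ 4" by (simp add: power_mult_distrib flip: power_mult)
      then show "real w \<le> (2 * real d ^ 2)\<^sup>2" using w_upper by (simp add: add_increasing)
    qed auto
    finally show ?thesis by simp
  qed
  have Q0: "Q \<ge> 0" by (simp add: Q_def)
  have d_pow: "real d ^ j \<le> real n powr (real j / 100)" for j
  proof -
    have "real d ^ j \<le> (real n powr (1 / 100)) ^ j" using dn by (intro power_mono) auto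
    also have "\<dots> = real n powr (real j / 100)" using n1 by (simp add: powr_power_eq)
    finally show ?thesis .
  qed
  have Q3: "3 * Q ^ 3 \<le> real n powr (7 / 100)"
  proof -
    have "Q ^ 3 \<le> (18 * real d ^ 2) ^ 3" using Q_le Q0 by (rule power_mono)
    also have "\<dots> = 5832 * real d ^ 6" by (simp add: power_mult_distrib flip: power_mult)
    also have "\<dots> \<le> 5832 * real n powr (6 / 100)" using d_pow[of 6] by simp
    finally show ?thesis using F by linarith
  qed
  have size: "g * w\<^sup>2 * h \<le> n"
  proof -
    have "real w ^ 2 \<le> (2 * real d ^ 4) ^ 2" using w_upper by (intro power_mono) auto
    also have "\<dots> = 4 * real d ^ 8" by (simp add: power_mult_distrib flip: power_mult)
    also have "\<dots> \<le> 4 * real n powr (8 / 100)" using d_pow[of 8] by simp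
    finally have "real g * real w ^ 2 * real h \<le> real n powr (85 / 100) * (4 * real n powr (8 / 100)) * real n powr (5 / 100)"
      using g_le h_le by (intro mult_mono) auto
    also have "\<dots> = 4 * real n powr (98 / 100)" using n1 by (simp flip: powr_add)
    also have "\<dots> \<le> real n" using F by blast
    finally have "real (g * w\<^sup>2 * h) \<le> real n" by simp
    then show ?thesis by (simp only: of_nat_le_iff)
  qed
  interpret imm_blocks n d h k K u g w
  proof
    show "k * (K * u + 2) \<le> d"
    proof -
      have "K * u + 2 \<le> m" using Ku_le m2 by linarith
      then have "k * (K * u + 2) \<le> k * m" by (rule mult_le_mono2)
      then show ?thesis using km by linarith
    qed
    show "1 \<le> g" using g3 by linarith
  qed (use K1 u2 w1 h0 k0 size in auto)
  \<comment> \<open>The largest t for which the shift \<open>t * (r * k)\<close> takes at most a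
    third of D.\<close>
  define t where "t = D div (3 * (r * k))"
  define T where "T = real D / (3 * (real r * real k))"
  have rk0: "real r * real k > 0" using r0 k0 by simp
  have T_ge: "3 / 10 * y \<le> T"
  proof -
    have "3 / 10 * y * (3 * (real r * real k)) \<le> 3 / 10 * y * (3 * (real r * y))"
    proof -
      have "\<kappa> * y \<le> 1 * y" using \<kappa> y0 by (intro mult_right_mono) auto
      then have "real k \<le> y" using k by linarith
      then show ?thesis using y0 r0 by (intro mult_left_mono) auto
    qed
    also have "\<dots> = 9 / 10 * (real r * y\<^sup>2)" by (simp add: power2_eq_square)
    also have "\<dots> \<le> real D" using D_ge d0 unfolding yd by linarith
    finally show ?thesis using rk0 by (simp add: T_def pos_le_divide_eq)
  qed
  have t_gt: "T < real t + 1"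
  proof -
    have "D < 3 * (r * k) * (t + 1)" using r k0 by (simp add: t_def dividend_less_times_div)
    then have "real D < real (3 * (r * k) * (t + 1))" by (simp only: of_nat_less_iff)
    then show ?thesis using rk0 by (simp add: T_def pos_divide_less_eq algebra_simps)
  qed
  have t_ge: "98 / 100 * T \<le> real t" using t_gt T_ge y200 by linarith
  have t1: "t \<ge> 1" using t_gt T_ge y200 by linarith
  have t3: "3 * (t * (r * k)) \<le> D"
  proof -
    have "D div (3 * (r * k)) * (3 * (r * k)) \<le> D" by simp
    then show ?thesis by (simp add: t_def mult_ac)
  qed
  have final: "real n powr (7 / 1000 * \<kappa> * y) \<le> real (length C)"
  proof (cases "(length C)\<^sup>2 < h ^ (t + 1)")
    case True
    have D100: "100 * (k * (K * u))\<^sup>2 \<le> g"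
    proof -
      have "real (100 * D\<^sup>2) \<le> 100 * real d ^ 2" using D_le by (simp add: power_mono)
      also have "\<dots> \<le> 100 * real n powr (2 / 100)" using d_pow[of 2] by simp
      also have "\<dots> \<le> real g" using F g_ge by linarith
      finally show ?thesis unfolding D_def by (simp only: of_nat_le_iff)
    qed
    \<comment> \<open>\<open>x - 1 \<ge> ln x = ln g / (K * u)\<close>, and g is at least
      \<open>6 * D * (K * u)\<close> because it is at least \<open>100 * D\<^sup>2\<close>.\<close>
    have gap: "6 * real (k * (K * u)) \<le> real g * (x - 1)"
    proof -
      have "1 \<le> ln (real g)"
      proof -
        have "exp 1 \<le> real g" using exp_le g3 by linarith
        then show ?thesis using g3 by (simp add: ln_ge_iff)
      qed
      then have "1 / real (K * u) \<le> ln (real g) / real (K * u)" by (intro divide_right_mono) auto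
      also have "\<dots> = ln x" using g3 by (simp add: x_def ln_powr)
      also have "\<dots> \<le> x - 1" using x1 by (intro ln_le_minus_one) auto
      finally have a: "1 / real (K * u) \<le> x - 1" .
      have "6 * real D * real (K * u) \<le> real g"
      proof -
        have "1 * (K * u) \<le> k * (K * u)" using k0 by (intro mult_le_mono1) simp
        then have "real (K * u) \<le> real D" by (simp only: D_def mult_1 of_nat_le_iff)
        then have "6 * real D * real (K * u) \<le> 6 * real D * real D" by (intro mult_left_mono) auto
        also have "\<dots> \<le> real (100 * D\<^sup>2)" using zero_le_square[of "real D"] by (simp add: power2_eq_square)
        also have "\<dots> \<le> real g" using D100 unfolding D_def by (simp only: of_nat_le_iff)
        finally show ?thesis .
      qed
      then have "6 * real D \<le> real g * (1 / real (K * u))" using Ku0 by (simp add: pos_le_divide_eq)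
      also have "\<dots> \<le> real g * (x - 1)" using a by (intro mult_left_mono) auto
      finally show ?thesis by (simp add: D_def)
    qed
    define s where "s = real (length C)"
    have main: "x ^ D \<le> 128 * s * (2 ^ (r * k) * (3 / 2) ^ (2 * d div t + 1)) * (real d * real n ^ 2 + 1) *
      (3 * Q ^ 3) ^ k * x ^ (t * (r * k))"
      unfolding D_def Q_def s_def
      by (rule size_lower_bound[OF C t1 _ True x1 x2 _ _ _ D100 gap])
         (use t3 xg w_le w_ge in \<open>auto simp: D_def z_def\<close>)
    have s0: "s \<ge> 0" by (simp add: s_def)
    have xD: "x ^ D = real g ^ k" by (simp add: D_def xg[symmetric] power_mult[symmetric] mult.commute)
    have xt: "x ^ (t * (r * k)) \<le> real g powr (real k / 3)"
    proof -
      have "real (t * (r * k)) \<le> real D / 3" using t3 by linarith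
      have "x ^ (t * (r * k)) = x powr real (t * (r * k))"
        by (rule powr_realpow[symmetric]) (use x1 in simp)
      also have "\<dots> \<le> x powr (real D / 3)" using x1 \<open>real (t * (r * k)) \<le> real D / 3\<close> by (intro powr_mono) auto
      also have "\<dots> = (x powr real D) powr (1 / 3)" by (simp add: powr_powr)
      also have "x powr real D = real g powr real k" using x1 g3 by (simp add: powr_realpow xD)
      also have "(real g powr real k) powr (1 / 3) = real g powr (real k / 3)" by (simp add: powr_powr)
      finally show ?thesis .
    qed
    \<comment> \<open>From \<open>D \<ge> 0.95 * d\<close> and \<open>t \<ge> 0.98 * T\<close> there
      are at most \<open>6.45 * R + 1\<close> groups, and
      \<open>(1 + 0.6 * 6.45) / 12 = 4.87 / 12 < 0.406\<close>. The 12 is that of the bound on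
      r.\<close>
    have E: "2 ^ (r * k) * (3 / 2) ^ (2 * d div t + 1) \<le> 2 * real n powr (406 / 1000 * real k)"
    proof -
      define R where "R = real r * real k"
      have R0: "R > 0" using rk0 by (simp add: R_def)
      have "real (2 * d div t) \<le> 2 * real d / real t"
      proof -
        have "2 * d div t * t \<le> 2 * d" by simp
        then have "real (2 * d div t * t) \<le> real (2 * d)" by (simp only: of_nat_le_iff)
        then show ?thesis using t1 by (simp add: pos_le_divide_eq)
      qed
      also have "\<dots> \<le> 2 * real d / (98 / 100 * T)" using t_ge T_ge y200 by (intro divide_left_mono) auto
      also have "\<dots> \<le> 645 / 100 * R"
      proof -
        have "R * T = real D / 3" using r0 k0 by (simp add: T_def R_def)
        moreover have "645 / 100 * R * (98 / 100 * T) = 63210 / 10000 * (R * T)" by simp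
        ultimately have "2 * real d \<le> 645 / 100 * R * (98 / 100 * T)" using D_ge d0 by linarith
        moreover have "T > 0" using T_ge y200 by linarith
        ultimately show ?thesis by (simp add: pos_divide_le_eq)
      qed
      finally have dt: "real (2 * d div t) \<le> 645 / 100 * R" .
      have p: "(2 :: real) ^ (r * k) = 2 powr R" using powr_realpow[of 2 "r * k"] by (simp add: R_def)
      have "2 ^ (r * k) * (3 / 2) ^ (2 * d div t + 1) \<le> 2 powr R * 2 powr (6 / 10 * real (2 * d div t + 1))"
        unfolding p by (intro mult_left_mono three_halves_power_le) auto
      also have "\<dots> = 2 powr (R + 6 / 10 * real (2 * d div t + 1))" by (simp add: powr_add)
      also have "\<dots> \<le> 2 powr (1 + L * (406 / 1000 * real k))"
      proof (intro powr_mono)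
        have "R \<le> L / 12 * real k" using r unfolding R_def L_def by (intro mult_right_mono) auto
        also have "\<dots> = L * real k / 12" by simp
        finally have 1: "R \<le> L * real k / 12" .
        have 2: "real (2 * d div t + 1) = real (2 * d div t) + 1" by (simp only: of_nat_add of_nat_1)
        have 3: "L * (406 / 1000 * real k) = 406 / 1000 * (L * real k)" by simp
        have "R + 6 / 10 * (V + 1) \<le> 1 + 406 / 1000 * Z"
          if "V \<le> 645 / 100 * R" "R \<le> Z / 12" "0 \<le> Z" for V Z :: real
          using that by (simp add: field_simps)
        from this[OF dt 1] show "R + 6 / 10 * real (2 * d div t + 1) \<le> 1 + L * (406 / 1000 * real k)"
          unfolding 2 3 using L400 by simp
      qed simp
      also have "\<dots> = 2 * real n powr (406 / 1000 * real k)" by (simp add: powr_add n_powr)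
      finally show ?thesis .
    qed
    have dn2: "real d * real n ^ 2 + 1 \<le> 2 * real n powr (201 / 100)"
    proof -
      have "real d * real n ^ 2 \<le> real n powr (1 / 100) * real n powr 2"
        using dn n1 by (intro mult_mono) auto
      also have "\<dots> = real n powr (201 / 100)" by (subst powr_add[symmetric]) simp
      finally have "real d * real n ^ 2 \<le> real n powr (201 / 100)" .
      moreover have "1 \<le> real n powr (201 / 100)" using n1 by (intro ge_one_powr_ge_zero) auto
      ultimately show ?thesis by linarith
    qed
    have Qk: "(3 * Q ^ 3) ^ k \<le> real n powr (7 / 100 * real k)"
    proof -
      have "(3 * Q ^ 3) ^ k \<le> (real n powr (7 / 100)) ^ k" using Q3 Q0 by (intro power_mono) auto
      also have "\<dots> = real n powr (7 / 100 * real k)" using n1 by (simp add: powr_power_eq)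
      finally show ?thesis .
    qed
    have gk: "real g ^ k = real g powr (2 / 3 * real k) * real g powr (real k / 3)"
      using g3 powr_add[of "real g" "2 / 3 * real k" "real k / 3"] powr_realpow[of "real g" k] by simp
    have "real g powr (2 / 3 * real k) * real g powr (real k / 3) \<le>
       (128 * s * (2 * real n powr (406 / 1000 * real k)) * (2 * real n powr (201 / 100)) * real n powr (7 / 100 * real k)) * real g powr (real k / 3)"
      unfolding gk[symmetric] xD[symmetric]
      by (rule order.trans[OF main],
          rule mult_mono[OF mult_mono[OF mult_mono[OF mult_mono[OF order.refl E] dn2] Qk] xt])
         (use s0 Q0 x1 in auto)
    moreover have "0 < real g powr (real k / 3)" using g3 by simp
    ultimately have "real g powr (2 / 3 * real k) \<le> 128 * s * (2 * real n powr (406 / 1000 * real k)) * (2 * real n powr (201 / 100)) * real n powr (7 / 100 * real k)"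
      by (rule mult_right_le_imp_le)
    also have "\<dots> = s * (512 * real n powr (201 / 100)) * (real n powr (406 / 1000 * real k) * real n powr (7 / 100 * real k))"
      by simp
    also have "\<dots> = s * (512 * real n powr (201 / 100)) * real n powr (476 / 1000 * real k)"
      by (subst powr_add[symmetric]) simp
    also have "\<dots> \<le> s * real n powr 3 * real n powr (476 / 1000 * real k)"
      using F(7) s0 by (intro mult_right_mono mult_left_mono) auto
    also have "\<dots> = s * real n powr (3 + 476 / 1000 * real k)" by (simp add: powr_add)
    finally have "real g powr (2 / 3 * real k) \<le> s * real n powr (3 + 476 / 1000 * real k)" .
    moreover have "real n powr (566 / 1000 * real k) \<le> real g powr (2 / 3 * real k)"
    proof -
      have "real n powr (566 / 1000 * real k) = (real n powr (849 / 1000)) powr (2 / 3 * real k)" by (simp add: powr_powr)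
      also have "\<dots> \<le> real g powr (2 / 3 * real k)" using g_ge by (intro powr_mono2) auto
      finally show ?thesis .
    qed
    ultimately have a: "real n powr (566 / 1000 * real k) \<le> s * real n powr (3 + 476 / 1000 * real k)" by linarith
    have "real n powr (566 / 1000 * real k - (3 + 476 / 1000 * real k)) \<le> s"
    proof -
      have "0 < real n powr (3 + 476 / 1000 * real k)" using n1 by simp
      then show ?thesis using a by (simp only: powr_diff pos_divide_le_eq)
    qed
    \<comment> \<open>The gain left is \<open>0.09 * k - 3\<close>, which for
      \<open>k \<ge> 199\<close> is well above \<open>0.007 * (k + 1)\<close>.\<close>
    moreover have "real n powr (7 / 1000 * \<kappa> * y) \<le> real n powr (566 / 1000 * real k - (3 + 476 / 1000 * real k))"
      using n1 k k199 ky by (intro powr_mono) auto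
    ultimately show ?thesis by (simp add: s_def)
  next
    case False
    \<comment> \<open>This case fixes the constant \<open>7 / 1000\<close>: the exponent from h is
      at least \<open>0.049 * 0.98 * 0.3 * y\<close>, just above \<open>0.0144 * y\<close>, against
      twice 0.007.\<close>
    have "(real n powr (7 / 1000 * \<kappa> * y))\<^sup>2 \<le> (real (length C))\<^sup>2"
    proof -
      have "(real n powr (7 / 1000 * \<kappa> * y))\<^sup>2 = real n powr (14 / 1000 * (\<kappa> * y))"
        using n1 powr_power_eq[of "real n" "7 / 1000 * \<kappa> * y" 2] by (simp add: mult_ac)
      also have "\<dots> \<le> real n powr (49 / 1000 * real t)"
      proof (intro powr_mono)
        have "\<kappa> * y \<le> 1 * y" using \<kappa> y0 by (intro mult_right_mono) auto
        then show "14 / 1000 * (\<kappa> * y) \<le> 49 / 1000 * real t" using t_ge T_ge by linarith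
      qed (use n1 in auto)
      also have "\<dots> = (real n powr (49 / 1000)) ^ t" using n1 by (simp add: powr_power_eq)
      also have "\<dots> \<le> real h ^ t" using h_ge by (intro power_mono) auto
      also have "\<dots> \<le> real h ^ (t + 1)" using h0 by (intro power_increasing) auto
      also have "\<dots> = real (h ^ (t + 1))" by simp
      also have "\<dots> \<le> real ((length C)\<^sup>2)" using False by (simp only: of_nat_le_iff not_less)
      finally show ?thesis by simp
    qed
    then show ?thesis by (rule power2_le_imp_le) simp
  qed
  then show ?thesis by (simp add: y_def)
qed

text \<open>The output is a sum gate, so a circuit with a single node is the empty sum and computes
  0, whereas \<open>IMM\<close> takes the value 1. The bound is for the finitely many small
  n.\<close>

lemma circuit_length_ge_2:
  fixes C :: "(imm_var, 'a::field) circuit"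
  assumes "circuit_over (imm_vars n d) C" "depth_four C" "agree_on_cube (imm_vars n d) (circuit_poly C) (IMM n d)"
    and "n \<ge> 1" "d \<ge> 1"
  shows "length C \<ge> 2"
proof (rule ccontr)
  assume "\<not> length C \<ge> 2"
  moreover have "length C > 0" using assms(1) by (simp add: circuit_over_def)
  ultimately have len: "length C = 1" by linarith
  then have out: "output_node C = 0" by (simp add: output_node_def)
  then obtain js where js: "C ! 0 = Sum js" using assms(2) by (auto simp: depth_four_def Let_def)
  then have "js = []" using assms(1) len unfolding circuit_over_def by (cases js) force+
  then have zero: "circuit_poly C = 0"
    unfolding circuit_poly_def out by (subst gate_poly.simps) (simp add: js)
  \<comment> \<open>With only the (1, 1) entries set to 1, exactly one summand of \<open>IMM\<close>
    survives, the path that stays at 1.\<close>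
  define \<alpha> :: "imm_var \<Rightarrow> 'a" where "\<alpha> = (\<lambda>v\<in>imm_vars n d. if snd v = (1, 1) then 1 else 0)"
  have "\<alpha> \<in> imm_vars n d \<rightarrow>\<^sub>E {0, 1}" by (auto simp: \<alpha>_def)
  then have "mpoly_eval \<alpha> (IMM n d) = 0"
    using assms(3) zero unfolding agree_on_cube_def by (metis id_hom.hom_eval_zero mpoly_eval_hom_eval)
  moreover have "mpoly_eval \<alpha> (IMM n d) = 1"
  proof -
    define p1 where "p1 = (\<lambda>j\<in>{1..d - 1}. 1 :: nat)"
    define f where "f p = (\<Prod>k = 1..d. \<alpha> (k, (p(0 := 1, d := 1)) (k - 1), (p(0 := 1, d := 1)) k))" for p
    have p1: "p1 \<in> {1..d - 1} \<rightarrow>\<^sub>E {1..n}" using assms(4) by (auto simp: p1_def)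
    have "mpoly_eval \<alpha> (IMM n d) = (\<Sum>p\<in>{1..d - 1} \<rightarrow>\<^sub>E {1..n}. f p)"
      unfolding f_def by (rule mpoly_eval_IMM)
    also have "\<dots> = (\<Sum>p\<in>{p1}. f p)"
    proof (rule sum.mono_neutral_right)
      show "\<forall>p\<in>({1..d - 1} \<rightarrow>\<^sub>E {1..n}) - {p1}. f p = 0"
      proof
        fix p assume p: "p \<in> ({1..d - 1} \<rightarrow>\<^sub>E {1..n}) - {p1}"
        have "\<exists>j\<in>{1..d - 1}. p j \<noteq> 1"
        proof (rule ccontr)
          assume "\<not> ?thesis"
          then have "p = p1" using p p1 by (intro PiE_ext[of p _ _ p1]) (auto simp: p1_def)
          then show False using p by blast
        qed
        then obtain j where j: "j \<in> {1..d - 1}" "p j \<noteq> 1" by blast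
        have zero: "\<alpha> (j, (p(0 := 1, d := 1)) (j - 1), (p(0 := 1, d := 1)) j) = 0"
        proof -
          have "(p(0 := 1, d := 1)) i \<in> {1..n}" if "i \<le> d" for i
            using p that assms(4) by (cases "i = 0 \<or> i = d") (auto simp: PiE_iff)
          from this[of j] this[of "j - 1"] have "(j, (p(0 := 1, d := 1)) (j - 1), (p(0 := 1, d := 1)) j) \<in> imm_vars n d"
            using j by (auto simp: imm_vars_def)
          then show ?thesis using j by (auto simp: \<alpha>_def)
        qed
        show "f p = 0" unfolding f_def
        proof (rule prod_zero)
          have "j \<in> {1..d}" using j by auto
          with zero show "\<exists>k\<in>{1..d}. \<alpha> (k, (p(0 := 1, d := 1)) (k - 1), (p(0 := 1, d := 1)) k) = 0"
            by (intro bexI[of _ j])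
        qed simp
      qed
      show "finite ({1..d - 1} \<rightarrow>\<^sub>E {1..n})" by (intro finite_PiE) auto
      show "{p1} \<subseteq> {1..d - 1} \<rightarrow>\<^sub>E {1..n}" using p1 by blast
    qed
    also have "\<dots> = f p1" by simp
    also have "f p1 = 1" unfolding f_def
    proof (rule prod.neutral, rule ballI)
      fix k assume k: "k \<in> {1..d}"
      have "(p1(0 := 1, d := 1)) j = 1" if "j \<le> d" for j using that by (auto simp: p1_def)
      from this[of k] this[of "k - 1"] have "(p1(0 := 1, d := 1)) (k - 1) = 1" "(p1(0 := 1, d := 1)) k = 1" using k by auto
      moreover have "(k, 1, 1) \<in> imm_vars n d" using k assms(4) by (simp add: imm_vars_def)
      ultimately show "\<alpha> (k, (p1(0 := 1, d := 1)) (k - 1), (p1(0 := 1, d := 1)) k) = 1"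
        by (simp only: \<alpha>_def restrict_apply' snd_conv if_True refl)
    qed
    finally show ?thesis .
  qed
  ultimately show False by simp
qed

theorem theorem3:
  fixes c :: real
  assumes "c > 0"
  shows "\<exists>\<delta>>0. \<forall>n d r :: nat. \<forall>C :: (imm_var, 'a::field) circuit.
    c * (log 2 (real n))\<^sup>2 \<le> real d \<longrightarrow>
    real d \<le> real n powr (1 / 100) \<longrightarrow>
    1 \<le> r \<longrightarrow> real r \<le> log 2 (real n) / 12 \<longrightarrow>
    circuit_over (imm_vars n d) C \<longrightarrow>
    depth_four C \<longrightarrow>
    formal_degree C = d \<longrightarrow>
    individual_degree_le (circuit_poly C) r \<longrightarrow>
    agree_on_cube (imm_vars n d) (circuit_poly C) (IMM n d) \<longrightarrow>
    real (circuit_size C) \<ge> real n powr (\<delta> * sqrt (real d / real r))"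
proof -
  define \<kappa> where "\<kappa> = min 1 (sqrt c)"
  have \<kappa>: "0 < \<kappa>" "\<kappa> \<le> 1" "\<kappa> \<le> sqrt c" using assms by (auto simp: \<kappa>_def)
  obtain n0 :: nat where n0: "\<And>n. n \<ge> n0 \<Longrightarrow> large_enough c \<kappa> (real n)"
    using eventually_large_enough[OF assms \<kappa>(1)] by blast
  define \<nu> where "\<nu> = real n0 + 2"
  \<comment> \<open>For n below n0 one has \<open>sqrt (d / r) \<le> \<nu>\<close>, so the second
    bound on \<delta> makes the exponent at most \<open>1 / \<nu>\<close>; as
    \<open>\<nu> powr (1 / \<nu>) \<le> 2\<close>, two nodes suffice there.\<close>
  define \<delta> where "\<delta> = min (7 / 1000 * \<kappa>) (1 / \<nu>\<^sup>2)"
  have \<nu>: "\<nu> \<ge> 2" by (simp add: \<nu>_def)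
  have \<delta>0: "\<delta> > 0" using \<kappa> \<nu> by (simp add: \<delta>_def)
  have "real n powr (\<delta> * sqrt (real d / real r)) \<le> real (circuit_size C)"
    if h: "c * (log 2 (real n))\<^sup>2 \<le> real d" "real d \<le> real n powr (1 / 100)" "1 \<le> r" "real r \<le> log 2 (real n) / 12"
      "circuit_over (imm_vars n d) C" "depth_four C" "formal_degree C = d"
      "individual_degree_le (circuit_poly C) r" "agree_on_cube (imm_vars n d) (circuit_poly C) (IMM n d)"
    for n d r and C :: "(imm_var, 'a) circuit"
  proof -
    have L: "log 2 (real n) \<ge> 12" using h(3,4) by linarith
    have n1: "real n > 1" using L by (cases "n \<le> 1") (auto simp: le_Suc_eq log_def)
    show ?thesis
    proof (cases "n \<ge> n0")
      case True
      have "real n powr (\<delta> * sqrt (real d / real r)) \<le> real n powr (7 / 1000 * \<kappa> * sqrt (real d / real r))"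
        using n1 by (intro powr_mono mult_right_mono) (auto simp: \<delta>_def)
      also have "\<dots> \<le> real (length C)"
        by (rule size_bound_large[OF assms \<kappa> n0[OF True] h])
      finally show ?thesis by (simp add: circuit_size_def)
    next
      case False
      have n\<nu>: "real n \<le> \<nu>" using False by (simp add: \<nu>_def)
      have "0 < c * (log 2 (real n))\<^sup>2" using assms L by simp
      then have d0: "real d > 0" using h(1) by linarith
      have "sqrt (real d / real r) \<le> \<nu>"
      proof (rule real_le_lsqrt)
        have "real d / real r \<le> real d" using h(3) d0 by (simp add: divide_le_eq mult_le_cancel_left1)
        also have "\<dots> \<le> real n powr 1" using h(2) n1 powr_mono[of "1 / 100" 1 "real n"] by linarith
        also have "\<dots> \<le> \<nu>" using n1 n\<nu> by simp
        also have "\<dots> \<le> \<nu>\<^sup>2" using \<nu> by (simp add: power2_eq_square)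
        finally show "real d / real r \<le> \<nu>\<^sup>2" .
      qed (use \<nu> in auto)
      then have "\<delta> * sqrt (real d / real r) \<le> 1 / \<nu>\<^sup>2 * \<nu>"
        using \<nu> by (intro mult_mono) (auto simp: \<delta>_def)
      also have "\<dots> = 1 / \<nu>" using \<nu> by (simp add: power2_eq_square)
      finally have e: "\<delta> * sqrt (real d / real r) \<le> 1 / \<nu>" .
      have "real n powr (\<delta> * sqrt (real d / real r)) \<le> real n powr (1 / \<nu>)"
        using n1 e by (intro powr_mono) auto
      also have "\<dots> \<le> \<nu> powr (1 / \<nu>)" using n1 n\<nu> \<nu> by (intro powr_mono2) auto
      also have "\<dots> \<le> (2 powr \<nu>) powr (1 / \<nu>)"
      proof (rule powr_mono2)
        have "\<nu> = real (n0 + 2)" by (simp add: \<nu>_def)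
        also have "\<dots> \<le> 2 ^ (n0 + 2)" using less_exp[of "n0 + 2"] by (metis less_imp_le of_nat_le_iff of_nat_numeral of_nat_power)
        also have "\<dots> = 2 powr \<nu>" unfolding \<nu>_def by (simp add: powr_add powr_realpow)
        finally show "\<nu> \<le> 2 powr \<nu>" .
      qed (use \<nu> in auto)
      also have "\<dots> = 2" using \<nu> by (simp add: powr_powr)
      also have "2 \<le> real (length C)"
        using circuit_length_ge_2[OF h(5,6,9)] n1 d0 by simp
      finally show ?thesis by (simp add: circuit_size_def)
    qed
  qed
  then show ?thesis using \<delta>0 by blast
qed

end
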